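(* Let $n\ge 1$ and $\mathfrak{g}=\mathfrak{gl}(n+1,\mathbb{C})$. Let $\Phi:\mathfrak{g}\to\mathbb{C}^{\binom{n+2}{2}}$ be $\Phi(x)=(f_{i,j}(x))_{1\le j\le i\le n+1}$ with $f_{i,j}(x)=\mathrm{Tr}(x_i^j)$, and let $\Phi^{-1}(0)_{sreg}=\Phi^{-1}(0,\dots,0)\cap\mathfrak{g}_{sreg}$. Consider the $2^n$ sequences $\mathcal{Q}=(Q_1,\dots,Q_{n+1})$ with $Q_i\in\{Q_{+,i},Q_{-,i}\}$ for each $i$ (where $Q_{+,1}=Q_{-,1}$). Then: (a) every $x\in\Phi^{-1}(0)_{sreg}$ lies in $\mathfrak{b}_{\mathcal{Q}}$ for some such sequence $\mathcal{Q}$; (b) $\Phi^{-1}(0)_{sreg}=\coprod_{\mathcal{Q}}\mathfrak{n}_{\mathcal{Q}}^{reg}$, the union being disjoint and taken over all $2^n$ such sequences, and this is the decomposition of the variety $\Phi^{-1}(0)_{sreg}$ into its irreducible components (each $\mathfrak{n}_{\mathcal{Q}}^{reg}$ is an irreducible component, and every irreducible component is of this form).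
   Context: For $1\le i\le n+1$, $\mathfrak{g}_i\cong\mathfrak{gl}(i,\mathbb{C})$ denotes the subalgebra of $\mathfrak{g}$ of matrices supported in the upper left $i\times i$ corner, and for $x\in\mathfrak{g}$, $x_i=\pi_i(x)\in\mathfrak{g}_i$ is obtained from $x$ by keeping the entries in the upper left $i\times i$ corner and setting all other entries to $0$; $x_i^j$ is its $j$-th power as an $i\times i$ matrix. An element $x\in\mathfrak{g}$ is strongly regular if the differentials $\{df_{i,j}(x):1\le j\le i\le n+1\}$ are linearly independent in $T_x^*\mathfrak{g}$; $\mathfrak{g}_{sreg}$ is the set of strongly regular elements. $\mathcal{B}_i$ is the flag variety of Borel subalgebras of $\mathfrak{g}_i$. $K_i=GL(i-1,\mathbb{C})\times GL(1,\mathbb{C})\subset GL(i,\mathbb{C})$ is the group of invertible block diagonal matrices with an $(i-1)\times(i-1)$ block and a $1\times 1$ block (the fixed points of conjugation by $\mathrm{diag}(1,\dots,1,-1)$), acting on $\mathcal{B}_i$ by conjugation. $Q_{+,i}$ (resp. $Q_{-,i}$) is the $K_i$-orbit in $\mathcal{B}_i$ of the Borel subalgebra of upper (resp. lower) triangular matrices in $\mathfrak{g}_i$. For such a sequence $\mathcal{Q}$ there is exactly one Borel subalgebra $\mathfrak{b}$ of $\mathfrak{g}$ such that $\pi_i(\mathfrak{b})$ is a Borel subalgebra of $\mathfrak{g}_i$ lying in $Q_i$ for all $i=1,\dots,n+1$; it is denoted $\mathfrak{b}_{\mathcal{Q}}$. Let $\mathfrak{n}_{\mathcal{Q}}=[\mathfrak{b}_{\mathcal{Q}},\mathfrak{b}_{\mathcal{Q}}]$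 and $\mathfrak{n}_{\mathcal{Q}}^{reg}$ the set of elements of $\mathfrak{n}_{\mathcal{Q}}$ that are regular in $\mathfrak{g}$ (centralizer of dimension $n+1$). *)

theory Defs
  imports "HOL-Analysis.Analysis" "Jordan_Normal_Form.Matrix"
begin

(* Conventions: g = gl(n+1,C) is carrier_mat (n+1) (n+1) of complex matrices.
   Matrix indices are 0-based; "the upper-left i x i corner" keeps indices < i. *)

definition mtrace :: "complex mat \<Rightarrow> complex" where
  "mtrace A = (\<Sum>a<dim_row A. A $$ (a,a))"

definition corner :: "nat \<Rightarrow> complex mat \<Rightarrow> complex mat" where
  "corner i x = mat i i (\<lambda>(a,b). x $$ (a,b))"

definition fij :: "nat \<Rightarrow> nat \<Rightarrow> complex mat \<Rightarrow> complex" where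
  "fij i j x = mtrace (corner i x ^\<^sub>m j)"

definition GZidx :: "nat \<Rightarrow> (nat \<times> nat) set" where
  "GZidx N = {(i,j). 1 \<le> j \<and> j \<le> i \<and> i \<le> N}"

definition dfij :: "nat \<Rightarrow> nat \<Rightarrow> complex mat \<Rightarrow> complex mat \<Rightarrow> complex" where
  "dfij i j x y = deriv (\<lambda>t::complex. fij i j (x + t \<cdot>\<^sub>m y)) 0"

definition strongly_regular :: "nat \<Rightarrow> complex mat \<Rightarrow> bool" where
  "strongly_regular N x \<longleftrightarrow> x \<in> carrier_mat N N \<and>
     (\<forall>c :: nat \<times> nat \<Rightarrow> complex.
        (\<forall>y \<in> carrier_mat N N. (\<Sum>p\<in>GZidx N. c p * dfij (fst p) (snd p) x y) = 0)
        \<longrightarrow> (\<forall>p\<in>GZidx N. c p = 0))"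

definition PhiZeroSreg :: "nat \<Rightarrow> complex mat set" where
  "PhiZeroSreg n = {x \<in> carrier_mat (n+1) (n+1).
      (\<forall>p\<in>GZidx (n+1). fij (fst p) (snd p) x = 0) \<and> strongly_regular (n+1) x}"

definition msubspace :: "nat \<Rightarrow> complex mat set \<Rightarrow> bool" where
  "msubspace m V \<longleftrightarrow> V \<subseteq> carrier_mat m m \<and> 0\<^sub>m m m \<in> V \<and>
     (\<forall>A\<in>V. \<forall>B\<in>V. A + B \<in> V) \<and> (\<forall>c::complex. \<forall>A\<in>V. c \<cdot>\<^sub>m A \<in> V)"

definition bracket :: "complex mat \<Rightarrow> complex mat \<Rightarrow> complex mat" where
  "bracket A B = A * B - B * A"

definition subalgebra :: "nat \<Rightarrow> complex mat set \<Rightarrow> bool" where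
  "subalgebra m S \<longleftrightarrow> msubspace m S \<and> (\<forall>A\<in>S. \<forall>B\<in>S. bracket A B \<in> S)"

definition derived_alg :: "nat \<Rightarrow> complex mat set \<Rightarrow> complex mat set" where
  "derived_alg m S = \<Inter>{V. msubspace m V \<and> {bracket A B | A B. A \<in> S \<and> B \<in> S} \<subseteq> V}"

fun derived_series :: "nat \<Rightarrow> complex mat set \<Rightarrow> nat \<Rightarrow> complex mat set" where
  "derived_series m S 0 = S"
| "derived_series m S (Suc k) = derived_alg m (derived_series m S k)"

definition solvable_alg :: "nat \<Rightarrow> complex mat set \<Rightarrow> bool" where
  "solvable_alg m S \<longleftrightarrow> (\<exists>k. derived_series m S k = {0\<^sub>m m m})"

definition borel :: "nat \<Rightarrow> complex mat set \<Rightarrow> bool" where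
  "borel m b \<longleftrightarrow> subalgebra m b \<and> solvable_alg m b \<and>
     (\<forall>c. subalgebra m c \<and> solvable_alg m c \<and> b \<subseteq> c \<longrightarrow> c = b)"

definition flag_variety :: "nat \<Rightarrow> complex mat set set" where
  "flag_variety m = {b. borel m b}"

definition upper_borel :: "nat \<Rightarrow> complex mat set" where
  "upper_borel m = {A \<in> carrier_mat m m. \<forall>a<m. \<forall>b<a. A $$ (a,b) = 0}"

definition lower_borel :: "nat \<Rightarrow> complex mat set" where
  "lower_borel m = {A \<in> carrier_mat m m. \<forall>a<m. \<forall>b<a. A $$ (b,a) = 0}"

(* K_m = GL(m-1) x GL(1), invertible block diagonal matrices *)
definition Kgrp :: "nat \<Rightarrow> complex mat set" where
  "Kgrp m = {g \<in> carrier_mat m m. invertible_mat g \<and>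
      (\<forall>a < m - 1. g $$ (a, m - 1) = 0 \<and> g $$ (m - 1, a) = 0)}"

definition conj_set :: "complex mat \<Rightarrow> complex mat set \<Rightarrow> complex mat set" where
  "conj_set g b = {g * A * h | A h. A \<in> b \<and> inverts_mat g h \<and> inverts_mat h g}"

definition Qplus :: "nat \<Rightarrow> complex mat set set" where
  "Qplus m = {conj_set g (upper_borel m) | g. g \<in> Kgrp m}"

definition Qminus :: "nat \<Rightarrow> complex mat set set" where
  "Qminus m = {conj_set g (lower_borel m) | g. g \<in> Kgrp m}"

definition Seqs :: "nat \<Rightarrow> (nat \<Rightarrow> complex mat set set) set" where
  "Seqs n = {Q. (\<forall>i\<in>{1..n+1}. Q i = Qplus i \<or> Q i = Qminus i) \<and>
                (\<forall>i. i \<notin> {1..n+1} \<longrightarrow> Q i = {})}"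

definition bQ :: "nat \<Rightarrow> (nat \<Rightarrow> complex mat set set) \<Rightarrow> complex mat set" where
  "bQ n Q = (THE b. borel (n+1) b \<and>
      (\<forall>i\<in>{1..n+1}. borel i (corner i ` b) \<and> corner i ` b \<in> Q i))"

definition nQ :: "nat \<Rightarrow> (nat \<Rightarrow> complex mat set set) \<Rightarrow> complex mat set" where
  "nQ n Q = derived_alg (n+1) (bQ n Q)"

definition mlin_indep :: "nat \<Rightarrow> nat \<Rightarrow> (nat \<Rightarrow> complex mat) \<Rightarrow> bool" where
  "mlin_indep m r As \<longleftrightarrow> (\<forall>c :: nat \<Rightarrow> complex.
      (\<forall>a<m. \<forall>b<m. (\<Sum>k<r. c k * As k $$ (a,b)) = 0) \<longrightarrow> (\<forall>k<r. c k = 0))"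

definition mdim :: "nat \<Rightarrow> complex mat set \<Rightarrow> nat" where
  "mdim m V = (GREATEST r. \<exists>As. (\<forall>k<r. As k \<in> V) \<and> mlin_indep m r As)"

definition centralizer :: "nat \<Rightarrow> complex mat \<Rightarrow> complex mat set" where
  "centralizer m x = {y \<in> carrier_mat m m. x * y = y * x}"

definition regular :: "nat \<Rightarrow> complex mat \<Rightarrow> bool" where
  "regular m x \<longleftrightarrow> x \<in> carrier_mat m m \<and> mdim m (centralizer m x) = m"

definition nQreg :: "nat \<Rightarrow> (nat \<Rightarrow> complex mat set set) \<Rightarrow> complex mat set" where
  "nQreg n Q = {x \<in> nQ n Q. regular (n+1) x}"

inductive_set poly_fun :: "nat \<Rightarrow> (complex mat \<Rightarrow> complex) set" for m where
  pf_const: "(\<lambda>x. c) \<in> poly_fun m"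
| pf_coord: "a < m \<Longrightarrow> b < m \<Longrightarrow> (\<lambda>x. x $$ (a,b)) \<in> poly_fun m"
| pf_add: "f \<in> poly_fun m \<Longrightarrow> g \<in> poly_fun m \<Longrightarrow> (\<lambda>x. f x + g x) \<in> poly_fun m"
| pf_mult: "f \<in> poly_fun m \<Longrightarrow> g \<in> poly_fun m \<Longrightarrow> (\<lambda>x. f x * g x) \<in> poly_fun m"

definition zariski_closed :: "nat \<Rightarrow> complex mat set \<Rightarrow> bool" where
  "zariski_closed m Z \<longleftrightarrow> (\<exists>F \<subseteq> poly_fun m. Z = {x \<in> carrier_mat m m. \<forall>f\<in>F. f x = 0})"

(* Y is irreducible (in the Zariski topology of gl(m,C), equivalently of any subspace containing Y) *)
definition zariski_irreducible :: "nat \<Rightarrow> complex mat set \<Rightarrow> bool" where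
  "zariski_irreducible m Y \<longleftrightarrow> Y \<noteq> {} \<and> Y \<subseteq> carrier_mat m m \<and>
     (\<forall>Z1 Z2. zariski_closed m Z1 \<and> zariski_closed m Z2 \<and> Y \<subseteq> Z1 \<union> Z2
        \<longrightarrow> Y \<subseteq> Z1 \<or> Y \<subseteq> Z2)"

definition irr_component :: "nat \<Rightarrow> complex mat set \<Rightarrow> complex mat set \<Rightarrow> bool" where
  "irr_component m X Y \<longleftrightarrow> Y \<subseteq> X \<and> zariski_irreducible m Y \<and>
     (\<forall>Y'. Y \<subseteq> Y' \<and> Y' \<subseteq> X \<and> zariski_irreducible m Y' \<longrightarrow> Y' = Y)"

end

theory Submission
  imports Defs "Jordan_Normal_Form.Determinant"
begin

text \<open>
  A sign sequence \<open>s\<close> orders the indices: \<open>b\<close> comes after all smaller indices if \<open>s b\<close>, and before all of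
  them otherwise. The Borel subalgebra \<open>b_Q\<close> consists of the matrices that are triangular for this order, and
  \<open>n_Q\<close> of the strictly triangular ones.

  Since \<open>df_{i,j}(x)(y) = j Tr(x_i^(j-1) y_i)\<close>, strong regularity of \<open>x\<close> says that the powers \<open>x_i^j\<close>, \<open>j < i\<close>,
  placed in the upper left corner, are linearly independent for all \<open>i\<close> together. Write \<open>x_(i+1)\<close> as \<open>x_i = y\<close>
  bordered by a column \<open>v\<close> and a row \<open>w\<close>, where \<open>y\<close> is regular nilpotent by induction. If all the traces vanish, then
  \<open>w y^l v = 0\<close> for all \<open>l\<close>. If \<open>v\<close> and \<open>w\<close> were both nonzero, then neither would be cyclic for \<open>y\<close>, so
  \<open>y^(i-1)\<close> in the corner would annihilate \<open>x_(i+1)\<close> from both sides; it would be a polynomial in \<open>x_(i+1)\<close>, against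
  independence. So \<open>v = 0\<close> or \<open>w = 0\<close>, which gives the next sign. Conversely, if \<open>x\<close> is strictly triangular and regular,
  the border vector of each corner is cyclic for the previous corner, and independence follows.

  The pieces are disjoint, each is the intersection of \<open>\<Phi>\<^sup>-\<^sup>1(0)_sreg\<close> with a linear subspace, and each is a principal open
  subset of that subspace; hence they are the irreducible components.
\<close>

section \<open>Nilpotent matrices and cyclic vectors\<close>

text \<open>Regularity appears in three forms: through the centralizer in the statement, as
  nonvanishing of x^(N-1) in the induction on corners, and as a polynomial inequality for
  irreducibility. On strictly triangular matrices they agree: a nilpotent matrix with nonzero top
  power has a cyclic vector, so whatever commutes with it is a polynomial in it; and the entries
  between neighbours in the order multiply to the extreme entry of x^(N-1). The same fact on
  commuting matrices is what turns the corner matrix of the overview into a polynomial in x_(i+1).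
  Independence makes the top power of x_(i+1) nonzero, and nilpotency comes from w y^l v = 0.

  The triangular algebras are Borel because any larger algebra contains an sl(2). A K-orbit enters
  through the zero row or column that it imposes on the border of a corner; these zeros for all
  corners put a Borel subalgebra inside a triangular algebra, and its own maximality gives
  equality.\<close>

lemma mult_entry:
  fixes A B :: "complex mat"
  assumes "A \<in> carrier_mat m m" "B \<in> carrier_mat m m" "a < m" "b < m"
  shows "(A * B) $$ (a,b) = (\<Sum>c<m. A $$ (a,c) * B $$ (c,b))"
  using assms by (auto simp: scalar_prod_def atLeast0LessThan intro!: sum.cong)

lemma pow_add_mat:
  fixes A :: "complex mat"
  assumes "A \<in> carrier_mat m m"
  shows "A ^\<^sub>m (k + l) = A ^\<^sub>m k * A ^\<^sub>m l"
proof (induction l)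
  case 0
  have "A ^\<^sub>m k \<in> carrier_mat m m" using assms by simp
  then have "A ^\<^sub>m k * 1\<^sub>m m = A ^\<^sub>m k" by (rule right_mult_one_mat)
  with assms show ?case by auto
next
  case (Suc l)
  have "A ^\<^sub>m (k + Suc l) = (A ^\<^sub>m k * A ^\<^sub>m l) * A" using Suc by simp
  also have "\<dots> = A ^\<^sub>m k * (A ^\<^sub>m l * A)"
    using assms by (intro assoc_mult_mat[of _ m m _ m _ m]) auto
  finally show ?case by simp
qed

lemma transpose_pow_mat:
  fixes A :: "complex mat"
  assumes "A \<in> carrier_mat m m"
  shows "transpose_mat (A ^\<^sub>m k) = transpose_mat A ^\<^sub>m k"
proof (induction k)
  case 0
  then show ?case using assms by simp
next
  case (Suc k)
  have "transpose_mat (A ^\<^sub>m Suc k) = transpose_mat (A * A ^\<^sub>m k)"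
    using pow_add_mat[OF assms, of 1 k] assms by simp
  also have "\<dots> = transpose_mat A ^\<^sub>m k * transpose_mat A"
    using assms Suc by (subst transpose_mult[of _ m m _ m]) auto
  finally show ?case by simp
qed

lemma pow_eq_zero_mono:
  fixes A :: "complex mat"
  assumes "A \<in> carrier_mat m m" "A ^\<^sub>m k = 0\<^sub>m m m" "k \<le> l"
  shows "A ^\<^sub>m l = 0\<^sub>m m m"
proof -
  have "A ^\<^sub>m l = A ^\<^sub>m k * A ^\<^sub>m (l - k)" using pow_add_mat[OF assms(1), of k "l - k"] assms(3) by simp
  also have "\<dots> = 0\<^sub>m m m * A ^\<^sub>m (l - k)" using assms by simp
  also have "\<dots> = 0\<^sub>m m m" using pow_carrier_mat[OF assms(1)] by (rule left_mult_zero_mat)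
  finally show ?thesis .
qed

lemma mat_nonzero_entry:
  fixes A :: "complex mat"
  assumes "A \<in> carrier_mat m m" "A \<noteq> 0\<^sub>m m m"
  obtains a b where "a < m" "b < m" "A $$ (a,b) \<noteq> 0"
proof -
  have "\<exists>a<m. \<exists>b<m. A $$ (a,b) \<noteq> 0"
  proof (rule ccontr)
    assume *: "\<not> ?thesis"
    have "A = 0\<^sub>m m m" by (rule eq_matI) (use assms(1) * in auto)
    with assms(2) show False by simp
  qed
  with that show ?thesis by blast
qed

text \<open>Vectors are plain functions on \<open>nat\<close>, of which only the values below the dimension matter.\<close>

definition mv :: "complex mat \<Rightarrow> (nat \<Rightarrow> complex) \<Rightarrow> nat \<Rightarrow> complex" where
  "mv A v a = (\<Sum>b<dim_col A. A $$ (a,b) * v b)"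

definition vm :: "(nat \<Rightarrow> complex) \<Rightarrow> complex mat \<Rightarrow> nat \<Rightarrow> complex" where
  "vm w A b = (\<Sum>a<dim_row A. w a * A $$ (a,b))"

lemma mv_cong:
  assumes "A \<in> carrier_mat m m" "\<And>b. b < m \<Longrightarrow> v b = w b"
  shows "mv A v a = mv A w a"
  using assms unfolding mv_def by auto

lemma mv_mult:
  assumes "A \<in> carrier_mat m m" "B \<in> carrier_mat m m" "a < m"
  shows "mv (A * B) v a = mv A (mv B v) a"
proof -
  have "mv (A * B) v a = (\<Sum>b<m. (\<Sum>c<m. A $$ (a,c) * B $$ (c,b)) * v b)"
    unfolding mv_def using assms by (intro sum.cong) (auto simp del: index_mult_mat(1) simp: mult_entry)
  also have "\<dots> = (\<Sum>b<m. \<Sum>c<m. A $$ (a,c) * (B $$ (c,b) * v b))"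
    by (simp add: sum_distrib_right mult.assoc)
  also have "\<dots> = (\<Sum>c<m. \<Sum>b<m. A $$ (a,c) * (B $$ (c,b) * v b))" by (rule sum.swap)
  also have "\<dots> = mv A (mv B v) a" unfolding mv_def using assms by (simp add: sum_distrib_left)
  finally show ?thesis .
qed

lemma mv_pow_add:
  assumes "A \<in> carrier_mat m m" "a < m"
  shows "mv (A ^\<^sub>m (k + l)) v a = mv (A ^\<^sub>m k) (mv (A ^\<^sub>m l) v) a"
  using assms by (simp add: pow_add_mat mv_mult[of _ m])

lemma mv_sum: "mv A (\<lambda>b. \<Sum>k\<in>S. c k * v k b) a = (\<Sum>k\<in>S. c k * mv A (v k) a)"
  unfolding mv_def sum_distrib_left by (subst sum.swap) (simp add: ac_simps)

lemma mv_zero_vec: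
  assumes "A \<in> carrier_mat m m" "\<And>b. b < m \<Longrightarrow> v b = 0"
  shows "mv A v a = 0"
  using assms unfolding mv_def by auto

lemma mv_zero_mat: "a < m \<Longrightarrow> mv (0\<^sub>m m m) v a = 0"
  unfolding mv_def by simp

lemma mv_one_mat: "a < m \<Longrightarrow> mv (1\<^sub>m m) v a = v a"
  unfolding mv_def by (simp add: if_distrib[of "\<lambda>x. x * _"] sum.delta cong: if_cong)

lemma mv_unit:
  assumes "A \<in> carrier_mat m m" "b < m"
  shows "mv A (\<lambda>c. if c = b then 1 else 0) a = A $$ (a,b)"
  using assms unfolding mv_def by (simp add: if_distrib sum.delta' cong: if_cong)

lemma vm_transpose:
  assumes "A \<in> carrier_mat m m" "b < m"
  shows "vm w A b = mv (transpose_mat A) w b"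
  unfolding vm_def mv_def using assms by (auto intro!: sum.cong)

lemma vm_pow_transpose:
  assumes "A \<in> carrier_mat m m" "b < m"
  shows "vm w (A ^\<^sub>m k) b = mv (transpose_mat A ^\<^sub>m k) w b"
  using vm_transpose[of "A ^\<^sub>m k" m b w] assms transpose_pow_mat[of A m k] by simp

lemma sum_mv_eq_sum_vm:
  assumes "A \<in> carrier_mat m m"
  shows "(\<Sum>a<m. w a * mv A v a) = (\<Sum>b<m. vm w A b * v b)"
  using assms unfolding mv_def vm_def sum_distrib_left sum_distrib_right
  by simp (subst sum.swap, simp add: ac_simps)

section \<open>Square and underdetermined linear systems\<close>

lemma square_system:
  fixes C :: "nat \<Rightarrow> nat \<Rightarrow> complex"
  assumes "\<And>d. \<forall>k<r. (\<Sum>l<r. C k l * d l) = 0 \<Longrightarrow> \<forall>l<r. d l = 0"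
  shows "\<exists>d. \<forall>k<r. (\<Sum>l<r. C k l * d l) = u k"
proof -
  define M where "M = mat r r (\<lambda>(k,l). C k l)"
  have M: "M \<in> carrier_mat r r" by (simp add: M_def)
  \<comment> \<open>A trivial kernel forces a nonzero determinant, hence a right inverse
    \<open>B\<close>; the solution is then \<open>mv B u\<close>.\<close>
  have "det M \<noteq> 0"
  proof
    assume "det M = 0"
    then obtain v where v: "v \<in> carrier_vec r" "v \<noteq> 0\<^sub>v r" "M *\<^sub>v v = 0\<^sub>v r"
      using det_0_iff_vec_prod_zero_field[OF M] by auto
    have "(\<Sum>l<r. C k l * vec_index v l) = 0" if "k < r" for k
    proof -
      have "vec_index (M *\<^sub>v v) k = (\<Sum>l<r. C k l * vec_index v l)"
        using that v(1) by (auto simp: M_def scalar_prod_def atLeast0LessThan intro!: sum.cong)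
      with v(3) that show ?thesis by simp
    qed
    then have "\<forall>l<r. vec_index v l = 0" using assms[of "vec_index v"] by auto
    then have "v = 0\<^sub>v r" using v(1) by (intro eq_vecI) auto
    with v(2) show False by simp
  qed
  then obtain B where B: "B \<in> carrier_mat r r" "M * B = 1\<^sub>m r"
    using det_non_zero_imp_unit[OF M, of "()"] unfolding Units_def ring_mat_def by auto
  have "(\<Sum>l<r. C k l * mv B u l) = u k" if "k < r" for k
  proof -
    have "(\<Sum>l<r. C k l * mv B u l) = mv M (mv B u) k"
      using that unfolding mv_def[of M] by (auto simp: M_def intro!: sum.cong)
    also have "\<dots> = mv (1\<^sub>m r) u k" using mv_mult[OF M B(1) that, of u] B(2) by simp
    finally show ?thesis using mv_one_mat[OF that] by simp
  qed
  then show ?thesis by blast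
qed

text \<open>Padding \<open>C\<close> with zero rows makes the system square. If only
  \<open>d = 0\<close> solved it, \<open>square_system\<close> would solve the padded system for
  every right-hand side, yet its row \<open>N\<close> is zero and cannot produce the value
  1.\<close>

lemma wide_system:
  fixes C :: "nat \<Rightarrow> nat \<Rightarrow> complex"
  assumes "N < r"
  shows "\<exists>d. (\<exists>l<r. d l \<noteq> 0) \<and> (\<forall>k<N. (\<Sum>l<r. C k l * d l) = 0)"
proof (rule ccontr)
  assume no: "\<not> ?thesis"
  define C' where "C' k l = (if k < N then C k l else 0)" for k l
  have "\<exists>d. \<forall>k<r. (\<Sum>l<r. C' k l * d l) = (if k = N then 1 else 0)"
  proof (rule square_system)
    fix d assume "\<forall>k<r. (\<Sum>l<r. C' k l * d l) = 0"
    moreover have "(\<Sum>l<r. C k l * d l) = (\<Sum>l<r. C' k l * d l)" if "k < N" for k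
      using that by (simp add: C'_def)
    ultimately have "\<forall>k<N. (\<Sum>l<r. C k l * d l) = 0" using assms by auto
    with no show "\<forall>l<r. d l = 0" by blast
  qed
  then obtain d where "\<forall>k<r. (\<Sum>l<r. C' k l * d l) = (if k = N then 1 else 0)" ..
  with assms have "(\<Sum>l<r. C' N l * d l) = 1" by auto
  then show False by (simp add: C'_def)
qed

section \<open>Chains v, A v, A^2 v, ... of a nilpotent matrix\<close>

lemma nilpotent_chain_indep:
  assumes A: "A \<in> carrier_mat m m"
    and zero: "\<And>a. a < m \<Longrightarrow> mv (A ^\<^sub>m Suc r) v a = 0"
    and nz: "\<exists>a<m. mv (A ^\<^sub>m r) v a \<noteq> 0"
    and rel: "\<And>a. a < m \<Longrightarrow> (\<Sum>k\<le>r. c k * mv (A ^\<^sub>m k) v a) = 0"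
    and "k \<le> r"
  shows "c k = 0"
  using \<open>k \<le> r\<close>
proof (induction k rule: less_induct)
  case (less k)
  obtain a where a: "a < m" "mv (A ^\<^sub>m r) v a \<noteq> 0" using nz by auto
  have high: "mv (A ^\<^sub>m l) v b = 0" if "l > r" "b < m" for l b
  proof -
    have "mv (A ^\<^sub>m (l - Suc r + Suc r)) v b = mv (A ^\<^sub>m (l - Suc r)) (mv (A ^\<^sub>m Suc r) v) b"
      using A that by (intro mv_pow_add)
    also have "\<dots> = 0" by (rule mv_zero_vec[of _ m]) (simp_all add: A zero del: pow_mat.simps)
    finally show ?thesis using that by simp
  qed
  \<comment> \<open>Applying A^(r-k) to the relation isolates \<open>c k\<close>: the terms with
    \<open>l < k\<close> vanish by induction, those with \<open>l > k\<close> are pushed beyond the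
    power \<open>r\<close>, and A^r v is nonzero.\<close>
  have "0 = mv (A ^\<^sub>m (r - k)) (\<lambda>b. \<Sum>l\<le>r. c l * mv (A ^\<^sub>m l) v b) a"
    using A rel by (intro mv_zero_vec[symmetric, of _ m]) auto
  also have "\<dots> = (\<Sum>l\<le>r. c l * mv (A ^\<^sub>m (r - k)) (mv (A ^\<^sub>m l) v) a)" by (rule mv_sum)
  also have "\<dots> = (\<Sum>l\<le>r. c l * mv (A ^\<^sub>m (r - k + l)) v a)"
    using mv_pow_add[OF A a(1)] by simp
  also have "\<dots> = (\<Sum>l\<le>r. if l = k then c k * mv (A ^\<^sub>m r) v a else 0)"
  proof (rule sum.cong[OF refl])
    fix l assume "l \<in> {..r}"
    consider "l < k" | "l = k" | "l > k" by linarith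
    then show "c l * mv (A ^\<^sub>m (r - k + l)) v a = (if l = k then c k * mv (A ^\<^sub>m r) v a else 0)"
    proof cases
      case 1 then show ?thesis using less by auto
    next
      case 2 then show ?thesis using less.prems by simp
    next
      case 3 then show ?thesis using less.prems a(1) by (simp add: high)
    qed
  qed
  also have "\<dots> = c k * mv (A ^\<^sub>m r) v a" using less.prems by simp
  finally show ?case using a(2) by simp
qed

text \<open>A chain of full length \<open>m\<close> is independent, so the square matrix with
  columns A^k v has trivial kernel and every \<open>u\<close> is reached: \<open>v\<close> is a
  cyclic vector.\<close>

lemma nilpotent_chain_spans:
  assumes A: "A \<in> carrier_mat m m"
    and zero: "\<And>a. a < m \<Longrightarrow> mv (A ^\<^sub>m m) v a = 0"
    and nz: "\<exists>a<m. mv (A ^\<^sub>m (m - 1)) v a \<noteq> 0"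
  shows "\<exists>c. \<forall>a<m. u a = (\<Sum>k<m. c k * mv (A ^\<^sub>m k) v a)"
proof -
  have m: "m > 0" using nz by auto
  then have eq: "{..m-1} = {..<m}" by auto
  have "\<exists>d. \<forall>a<m. (\<Sum>k<m. mv (A ^\<^sub>m k) v a * d k) = u a"
  proof (rule square_system)
    fix d assume d: "\<forall>a<m. (\<Sum>k<m. mv (A ^\<^sub>m k) v a * d k) = 0"
    show "\<forall>k<m. d k = 0"
    proof (intro allI impI)
      fix k assume "k < m"
      then show "d k = 0"
        using nilpotent_chain_indep[OF A _ nz, of d k] zero d m unfolding eq
        by (fastforce simp: mult.commute)
    qed
  qed
  then show ?thesis by (metis (no_types, lifting) mult.commute sum.cong)
qed

text \<open>Each unit vector is a combination of the chain through the cyclic vector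
  \<open>v\<close>, and pairing \<open>w\<close> with it gives the coordinate \<open>w a\<close>. In
  this form one half of a border is shown to vanish when the other half is cyclic.\<close>

lemma nilpotent_chain_functional:
  assumes A: "A \<in> carrier_mat m m"
    and zero: "\<And>a. a < m \<Longrightarrow> mv (A ^\<^sub>m m) v a = 0"
    and nz: "\<exists>a<m. mv (A ^\<^sub>m (m - 1)) v a \<noteq> 0"
    and kill: "\<And>k. k < m \<Longrightarrow> (\<Sum>a<m. w a * mv (A ^\<^sub>m k) v a) = 0"
    and a: "a < m"
  shows "w a = 0"
proof -
  obtain c where c: "\<forall>b<m. (if b = a then 1 else 0) = (\<Sum>k<m. c k * mv (A ^\<^sub>m k) v b)"
    using nilpotent_chain_spans[OF A zero nz, of "\<lambda>b. if b = a then 1 else 0"] by blast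
  have "w a = (\<Sum>b<m. w b * (if b = a then 1 else 0))" using a by (simp add: if_distrib cong: if_cong)
  also have "\<dots> = (\<Sum>b<m. w b * (\<Sum>k<m. c k * mv (A ^\<^sub>m k) v b))" using c by auto
  also have "\<dots> = (\<Sum>k<m. c k * (\<Sum>b<m. w b * mv (A ^\<^sub>m k) v b))"
    unfolding sum_distrib_left by (subst sum.swap) (simp add: ac_simps)
  also have "\<dots> = 0" using kill by simp
  finally show ?thesis .
qed

lemma pow_nonzero_vec:
  fixes A :: "complex mat"
  assumes "A \<in> carrier_mat m m" "A ^\<^sub>m k \<noteq> 0\<^sub>m m m"
  shows "\<exists>u. \<exists>a<m. mv (A ^\<^sub>m k) u a \<noteq> 0"
proof -
  obtain a b where "a < m" "b < m" "(A ^\<^sub>m k) $$ (a,b) \<noteq> 0"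
    using mat_nonzero_entry[of "A ^\<^sub>m k" m] assms by auto
  then show ?thesis using mv_unit[of "A ^\<^sub>m k" m b a] assms by auto
qed

text \<open>Nilpotency is first obtained with some exponent that depends on the construction; this
  brings the exponent down to the size of the matrix.\<close>

lemma nilpotent_pow_dim:
  fixes A :: "complex mat"
  assumes A: "A \<in> carrier_mat m m" and nil: "A ^\<^sub>m K = 0\<^sub>m m m"
  shows "A ^\<^sub>m m = 0\<^sub>m m m"
proof -
  define M where "M = (LEAST k. A ^\<^sub>m k = 0\<^sub>m m m)"
  have M: "A ^\<^sub>m M = 0\<^sub>m m m" unfolding M_def using nil by (rule LeastI)
  have min: "A ^\<^sub>m k \<noteq> 0\<^sub>m m m" if "k < M" for k using that not_less_Least unfolding M_def by blast
  have "M \<le> m"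
  proof (rule ccontr)
    assume gt: "\<not> M \<le> m"
    obtain u where u: "\<exists>a<m. mv (A ^\<^sub>m (M - 1)) u a \<noteq> 0"
      using pow_nonzero_vec[OF A min[of "M - 1"]] gt by auto
    \<comment> \<open>If the least exponent \<open>M\<close> exceeded \<open>m\<close>, the chain
      through this \<open>v\<close> would have full length \<open>m\<close> and span, so
      \<open>u\<close> would be a combination of the vectors A^k v. Then A^(M-1) u would involve
      only powers of exponent at least \<open>M\<close> and vanish, against the choice of
      \<open>u\<close>.\<close>
    define v where "v = mv (A ^\<^sub>m (M - m)) u"
    have v: "mv (A ^\<^sub>m k) v a = mv (A ^\<^sub>m (k + (M - m))) u a" if "a < m" for k a
      unfolding v_def using mv_pow_add[OF A that] by simp
    have m: "m > 0" using u by auto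
    have big: "mv (A ^\<^sub>m k) u' a = 0" if "k \<ge> M" "a < m" for k a u'
      using pow_eq_zero_mono[OF A M that(1)] mv_zero_mat[OF that(2)] by simp
    have "mv (A ^\<^sub>m m) v a = 0" if "a < m" for a using v[OF that, of m] big gt that by simp
    moreover have "m - 1 + (M - m) = M - 1" using gt m by simp
    with u v have "\<exists>a<m. mv (A ^\<^sub>m (m - 1)) v a \<noteq> 0" by metis
    ultimately obtain c where c: "\<forall>a<m. u a = (\<Sum>k<m. c k * mv (A ^\<^sub>m k) v a)"
      using nilpotent_chain_spans[OF A, of v u] by blast
    have "mv (A ^\<^sub>m (M - 1)) u a = 0" if "a < m" for a
    proof -
      have "mv (A ^\<^sub>m (M - 1)) u a = mv (A ^\<^sub>m (M - 1)) (\<lambda>a. \<Sum>k<m. c k * mv (A ^\<^sub>m k) v a) a"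
        using c A by (intro mv_cong[of _ m]) auto
      also have "\<dots> = (\<Sum>k<m. c k * mv (A ^\<^sub>m (M - 1)) (mv (A ^\<^sub>m k) v) a)" by (rule mv_sum)
      also have "\<dots> = (\<Sum>k<m. c k * mv (A ^\<^sub>m (M - 1 + k)) v a)"
        using mv_pow_add[OF A that] by simp
      also have "\<dots> = 0" using gt v[OF that] big that by simp
      finally show ?thesis .
    qed
    with u show False by blast
  qed
  with pow_eq_zero_mono[OF A M] show ?thesis .
qed

text \<open>A matrix that commutes with \<open>A\<close> is determined by its value at a cyclic
  vector \<open>u\<close>. Expanding Z u in the chain gives the coefficients; \<open>Z\<close> and
  the resulting polynomial in \<open>A\<close> then agree on every A^l u, and these vectors
  span.\<close>

lemma commuting_polynomial:
  fixes A :: "complex mat"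
  assumes A: "A \<in> carrier_mat m m" and nil: "A ^\<^sub>m m = 0\<^sub>m m m" and nz: "A ^\<^sub>m (m - 1) \<noteq> 0\<^sub>m m m"
    and Z: "Z \<in> carrier_mat m m" and comm: "A * Z = Z * A"
  shows "\<exists>c. \<forall>a<m. \<forall>b<m. Z $$ (a,b) = (\<Sum>k<m. c k * (A ^\<^sub>m k) $$ (a,b))"
proof -
  obtain u where u: "\<exists>a<m. mv (A ^\<^sub>m (m - 1)) u a \<noteq> 0" using pow_nonzero_vec[OF A nz] by blast
  have zero: "mv (A ^\<^sub>m m) u a = 0" if "a < m" for a using nil mv_zero_mat[OF that] by simp
  obtain c where c: "\<forall>a<m. mv Z u a = (\<Sum>k<m. c k * mv (A ^\<^sub>m k) u a)"
    using nilpotent_chain_spans[OF A zero u, of "mv Z u"] by blast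
  have commk: "A ^\<^sub>m k * Z = Z * A ^\<^sub>m k" for k
  proof (induction k)
    case 0
    then show ?case using A Z by simp
  next
    case (Suc k)
    have "A ^\<^sub>m Suc k * Z = A ^\<^sub>m k * (A * Z)" using A Z by (simp add: assoc_mult_mat[of _ m m _ m _ m])
    also have "\<dots> = (A ^\<^sub>m k * Z) * A" using A Z comm by (simp add: assoc_mult_mat[of _ m m _ m _ m])
    also have "\<dots> = Z * A ^\<^sub>m Suc k" using A Z Suc by (simp add: assoc_mult_mat[of _ m m _ m _ m])
    finally show ?case .
  qed
  have "Z $$ (a,b) - (\<Sum>k<m. c k * (A ^\<^sub>m k) $$ (a,b)) = 0" if "a < m" "b < m" for a b
  proof (rule nilpotent_chain_functional[OF A zero u _ that(2)])
    fix l assume "l < m"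
    have "mv Z (mv (A ^\<^sub>m l) u) a = mv (A ^\<^sub>m l) (mv Z u) a"
      using mv_mult[of Z m "A ^\<^sub>m l" a u] mv_mult[of "A ^\<^sub>m l" m Z a u] commk[of l] A Z that by simp
    also have "\<dots> = mv (A ^\<^sub>m l) (\<lambda>b. \<Sum>k<m. c k * mv (A ^\<^sub>m k) u b) a"
      using c A by (intro mv_cong[of _ m]) auto
    also have "\<dots> = (\<Sum>k<m. c k * mv (A ^\<^sub>m l) (mv (A ^\<^sub>m k) u) a)" by (rule mv_sum)
    also have "\<dots> = (\<Sum>k<m. c k * mv (A ^\<^sub>m k) (mv (A ^\<^sub>m l) u) a)"
      using mv_pow_add[OF A that(1)] by (metis add.commute)
    also have "\<dots> = (\<Sum>b<m. (\<Sum>k<m. c k * (A ^\<^sub>m k) $$ (a,b)) * mv (A ^\<^sub>m l) u b)"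
      unfolding mv_def[of "A ^\<^sub>m _" "mv _ _"] pow_mat_dim_square(2)[OF A]
        sum_distrib_left sum_distrib_right
      by (subst sum.swap) (simp add: ac_simps)
    finally have "(\<Sum>b<m. Z $$ (a,b) * mv (A ^\<^sub>m l) u b) = (\<Sum>b<m. (\<Sum>k<m. c k * (A ^\<^sub>m k) $$ (a,b)) * mv (A ^\<^sub>m l) u b)"
      unfolding mv_def[of Z] using Z by simp
    then show "(\<Sum>b<m. (Z $$ (a,b) - (\<Sum>k<m. c k * (A ^\<^sub>m k) $$ (a,b))) * mv (A ^\<^sub>m l) u b) = 0"
      by (simp add: left_diff_distrib sum_subtractf)
  qed
  then show ?thesis by auto
qed

section \<open>Borel subalgebras attached to an order of the indices\<close>

text \<open>The order of the indices is carried by an integer-valued \<open>p\<close>: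
  \<open>int\<close> gives the upper triangular matrices, its negative the lower triangular ones.
  Functions that order the indices alike give the same set, see \<open>tri_cong\<close>.\<close>

definition tri :: "(nat \<Rightarrow> int) \<Rightarrow> nat \<Rightarrow> complex mat set" where
  "tri p m = {A \<in> carrier_mat m m. \<forall>a<m. \<forall>b<m. p b < p a \<longrightarrow> A $$ (a,b) = 0}"

definition strict_tri :: "(nat \<Rightarrow> int) \<Rightarrow> nat \<Rightarrow> complex mat set" where
  "strict_tri p m = {A \<in> carrier_mat m m. \<forall>a<m. \<forall>b<m. p b \<le> p a \<longrightarrow> A $$ (a,b) = 0}"

section \<open>Matrix units, brackets, linear subspaces and derived algebras\<close>

definition eu :: "nat \<Rightarrow> nat \<Rightarrow> nat \<Rightarrow> complex mat" where
  "eu m a b = mat m m (\<lambda>(i,j). if i = a \<and> j = b then 1 else 0)"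

lemma eu_carrier [simp]: "eu m a b \<in> carrier_mat m m"
  and dim_eu [simp]: "dim_row (eu m a b) = m" "dim_col (eu m a b) = m"
  and eu_entry [simp]: "i < m \<Longrightarrow> j < m \<Longrightarrow> eu m a b $$ (i,j) = (if i = a \<and> j = b then 1 else 0)"
  by (auto simp: eu_def)

lemma eu_mult_entry:
  assumes "A \<in> carrier_mat m m" "i < m" "j < m" "b < m"
  shows "(eu m a b * A) $$ (i,j) = (if i = a then A $$ (b,j) else 0)"
  using mult_entry[of "eu m a b" m A i j] assms
  by (auto simp: if_distrib[of "\<lambda>x. x * _"] sum.delta' cong: if_cong)

lemma mult_eu_entry:
  assumes "A \<in> carrier_mat m m" "i < m" "j < m" "a < m"
  shows "(A * eu m a b) $$ (i,j) = (if j = b then A $$ (i,a) else 0)"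
  using mult_entry[of A m "eu m a b" i j] assms
  by (auto simp: if_distrib[of "\<lambda>x. _ * x"] sum.delta' cong: if_cong)

lemma bracket_carrier [simp]:
  "A \<in> carrier_mat m m \<Longrightarrow> B \<in> carrier_mat m m \<Longrightarrow> bracket A B \<in> carrier_mat m m"
  unfolding bracket_def by (intro minus_carrier_mat mult_carrier_mat)

lemma bracket_eqI:
  assumes "A \<in> carrier_mat m m" "B \<in> carrier_mat m m" "C \<in> carrier_mat m m"
    and "\<And>a b. a < m \<Longrightarrow> b < m \<Longrightarrow> (A * B) $$ (a,b) - (B * A) $$ (a,b) = C $$ (a,b)"
  shows "bracket A B = C"
  by (rule eq_matI) (use assms in \<open>auto simp: bracket_def simp del: index_mult_mat(1)\<close>)

lemma bracket_entry:
  assumes "A \<in> carrier_mat m m" "B \<in> carrier_mat m m" "a < m" "b < m"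
  shows "bracket A B $$ (a,b) = (A * B) $$ (a,b) - (B * A) $$ (a,b)"
  using assms unfolding bracket_def by (subst index_minus_mat) auto

lemma msubspaceI:
  assumes "V \<subseteq> carrier_mat m m" "0\<^sub>m m m \<in> V"
    "\<And>A B. A \<in> V \<Longrightarrow> B \<in> V \<Longrightarrow> A + B \<in> V" "\<And>c A. A \<in> V \<Longrightarrow> c \<cdot>\<^sub>m A \<in> V"
  shows "msubspace m V"
  using assms unfolding msubspace_def by blast

lemma msubspace_add: "msubspace m V \<Longrightarrow> A \<in> V \<Longrightarrow> B \<in> V \<Longrightarrow> A + B \<in> V"
  and msubspace_smult: "msubspace m V \<Longrightarrow> A \<in> V \<Longrightarrow> c \<cdot>\<^sub>m A \<in> V"
  and msubspace_carrier: "msubspace m V \<Longrightarrow> A \<in> V \<Longrightarrow> A \<in> carrier_mat m m"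
  unfolding msubspace_def by auto

lemma msubspace_tri: "msubspace m (tri p m)"
  by (rule msubspaceI) (auto simp: tri_def)

lemma msubspace_strict_tri: "msubspace m (strict_tri p m)"
  by (rule msubspaceI) (auto simp: strict_tri_def)

lemma msubspace_sum:
  assumes V: "msubspace m V" and "finite S" "\<And>s. s \<in> S \<Longrightarrow> A s \<in> V"
  shows "mat m m (\<lambda>ij. \<Sum>s\<in>S. c s * A s $$ ij) \<in> V"
  using assms(2,3)
proof (induction S rule: finite_induct)
  case empty
  have "mat m m (\<lambda>ij. 0 :: complex) = 0\<^sub>m m m" by (rule eq_matI) auto
  then show ?case using V by (simp add: msubspace_def)
next
  case (insert s S)
  have As: "A s \<in> V" "A s \<in> carrier_mat m m" using insert V unfolding msubspace_def by auto
  have "mat m m (\<lambda>ij. \<Sum>s\<in>insert s S. c s * A s $$ ij) = c s \<cdot>\<^sub>m A s + mat m m (\<lambda>ij. \<Sum>s\<in>S. c s * A s $$ ij)"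
    by (rule eq_matI) (use insert.hyps As(2) in auto)
  also have "\<dots> \<in> V"
  proof -
    have "c s \<cdot>\<^sub>m A s \<in> V" using V As(1) unfolding msubspace_def by blast
    moreover have "mat m m (\<lambda>ij. \<Sum>s\<in>S. c s * A s $$ ij) \<in> V" using insert by blast
    ultimately show ?thesis using V unfolding msubspace_def by blast
  qed
  finally show ?case .
qed

lemma derived_alg_subset:
  "msubspace m V \<Longrightarrow> (\<And>A B. A \<in> S \<Longrightarrow> B \<in> S \<Longrightarrow> bracket A B \<in> V) \<Longrightarrow> derived_alg m S \<subseteq> V"
  unfolding derived_alg_def by blast

lemma bracket_in_derived_alg: "A \<in> S \<Longrightarrow> B \<in> S \<Longrightarrow> bracket A B \<in> derived_alg m S"
  unfolding derived_alg_def by blast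

lemma msubspace_full: "msubspace m (carrier_mat m m)"
  by (rule msubspaceI) auto

lemma msubspace_derived_alg:
  assumes "S \<subseteq> carrier_mat m m"
  shows "msubspace m (derived_alg m S)"
proof (rule msubspaceI)
  show "derived_alg m S \<subseteq> carrier_mat m m"
    using assms by (intro derived_alg_subset[OF msubspace_full] bracket_carrier) auto
qed (auto simp: derived_alg_def msubspace_def)

lemma msubspace_derived_series:
  assumes "msubspace m S"
  shows "msubspace m (derived_series m S k)"
proof (induction k)
  case (Suc k)
  then show ?case using msubspace_derived_alg[of "derived_series m S k" m] by (simp add: msubspace_def)
qed (use assms in simp)

text \<open>A filtration by the distance in \<open>p\<close> that a nonzero entry has to bridge.
  Level 0 is \<open>tri\<close>, level 1 is \<open>strict_tri\<close>, and levels add under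
  multiplication; solvability, nilpotency and the shape of powers are all read off from it.\<close>

definition gap_tri :: "(nat \<Rightarrow> int) \<Rightarrow> nat \<Rightarrow> nat \<Rightarrow> complex mat set" where
  "gap_tri p m k = {A \<in> carrier_mat m m. \<forall>a<m. \<forall>b<m. A $$ (a,b) \<noteq> 0 \<longrightarrow> p a + int k \<le> p b}"

lemma msubspace_gap_tri: "msubspace m (gap_tri p m k)"
proof (rule msubspaceI)
  fix A B assume "A \<in> gap_tri p m k" "B \<in> gap_tri p m k"
  then show "A + B \<in> gap_tri p m k"
    by (auto simp: gap_tri_def) (metis add.right_neutral add_0)
qed (auto simp: gap_tri_def)

lemma mult_gap_tri:
  assumes A: "A \<in> gap_tri p m k" and B: "B \<in> gap_tri p m l"
  shows "A * B \<in> gap_tri p m (k + l)"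
  unfolding gap_tri_def
proof (intro CollectI conjI allI impI)
  have AB: "A \<in> carrier_mat m m" "B \<in> carrier_mat m m" using A B by (auto simp: gap_tri_def)
  then show "A * B \<in> carrier_mat m m" by simp
  fix a b assume ab: "a < m" "b < m" "(A * B) $$ (a,b) \<noteq> 0"
  then have "(\<Sum>c<m. A $$ (a,c) * B $$ (c,b)) \<noteq> 0" using mult_entry[OF AB ab(1,2)] by simp
  then obtain c where c: "c < m" "A $$ (a,c) * B $$ (c,b) \<noteq> 0"
    by (metis (no_types, lifting) lessThan_iff sum.neutral)
  then have "p a + int k \<le> p c" "p c + int l \<le> p b" using A B ab unfolding gap_tri_def by auto
  then show "p a + int (k + l) \<le> p b" by simp
qed

lemma gap_tri_bracket:
  assumes "A \<in> gap_tri p m k" "B \<in> gap_tri p m k"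
  shows "bracket A B \<in> gap_tri p m (k + k)"
proof -
  note AB = mult_gap_tri[OF assms] mult_gap_tri[OF assms(2,1)]
  have "bracket A B = A * B + (-1) \<cdot>\<^sub>m (B * A)"
    unfolding bracket_def by (rule eq_matI) (use assms in \<open>auto simp: gap_tri_def\<close>)
  then show ?thesis using msubspace_gap_tri[of m p "k + k"] AB unfolding msubspace_def by metis
qed

lemma gap_tri_mono: "k \<le> l \<Longrightarrow> gap_tri p m l \<subseteq> gap_tri p m k"
  unfolding gap_tri_def by auto (smt (verit) of_nat_mono)

lemma tri_eq_gap_tri: "tri p m = gap_tri p m 0"
  unfolding tri_def gap_tri_def by (intro Collect_cong) (simp, metis leD leI)

lemma strict_tri_eq_gap_tri: "strict_tri p m = gap_tri p m 1"
  unfolding strict_tri_def gap_tri_def by (intro Collect_cong) (simp add: add1_zle_eq, metis leD leI)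

lemma tri_diag_mult:
  assumes p: "inj_on p {..<m}" and A: "A \<in> tri p m" and B: "B \<in> tri p m" and a: "a < m"
  shows "(A * B) $$ (a,a) = A $$ (a,a) * B $$ (a,a)"
proof -
  have AB: "A \<in> carrier_mat m m" "B \<in> carrier_mat m m" using A B by (auto simp: tri_def)
  have "(A * B) $$ (a,a) = (\<Sum>c<m. A $$ (a,c) * B $$ (c,a))" using mult_entry[OF AB a a] .
  also have "\<dots> = (\<Sum>c<m. if c = a then A $$ (a,a) * B $$ (a,a) else 0)"
  proof (rule sum.cong[OF refl])
    fix c assume c: "c \<in> {..<m}"
    then have "c = a \<or> p c < p a \<or> p a < p c" using p a by (metis inj_onD lessThan_iff linorder_neqE)
    then show "A $$ (a,c) * B $$ (c,a) = (if c = a then A $$ (a,a) * B $$ (a,a) else 0)"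
      using A B a c unfolding tri_def by auto
  qed
  finally show ?thesis using a by simp
qed

text \<open>On triangular matrices the diagonal is multiplicative, so A B and B A have the same
  diagonal. Injectivity of \<open>p\<close> makes the diagonal the only difference between
  \<open>tri\<close> and \<open>strict_tri\<close>.\<close>

lemma bracket_tri:
  assumes p: "inj_on p {..<m}" and A: "A \<in> tri p m" and B: "B \<in> tri p m"
  shows "bracket A B \<in> strict_tri p m"
proof -
  have AB: "A \<in> carrier_mat m m" "B \<in> carrier_mat m m" using A B by (auto simp: tri_def)
  have "bracket A B \<in> tri p m" using gap_tri_bracket[of A p m 0 B] A B by (simp add: tri_eq_gap_tri)
  moreover have "bracket A B $$ (a,a) = 0" if "a < m" for a
    using tri_diag_mult[OF p A B that] tri_diag_mult[OF p B A that] bracket_entry[OF AB that that] by simp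
  moreover have "a = b \<or> p b < p a" if "p b \<le> p a" "a < m" "b < m" for a b
    using p that by (metis inj_onD lessThan_iff order_le_less)
  ultimately show ?thesis unfolding tri_def strict_tri_def by blast
qed

lemma tri_decomp:
  assumes "A \<in> carrier_mat m m" "S \<subseteq> {..<m} \<times> {..<m}"
    and "\<And>a b. a < m \<Longrightarrow> b < m \<Longrightarrow> A $$ (a,b) \<noteq> 0 \<Longrightarrow> (a,b) \<in> S"
  shows "A = mat m m (\<lambda>ij. \<Sum>s\<in>S. A $$ s * eu m (fst s) (snd s) $$ ij)"
proof (rule eq_matI)
  have fin: "finite S" using assms(2) by (rule finite_subset) simp
  fix i j
  assume "i < dim_row (mat m m (\<lambda>ij. \<Sum>s\<in>S. A $$ s * eu m (fst s) (snd s) $$ ij))"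
    "j < dim_col (mat m m (\<lambda>ij. \<Sum>s\<in>S. A $$ s * eu m (fst s) (snd s) $$ ij))"
  then have ij: "i < m" "j < m" by auto
  have "(\<Sum>s\<in>S. A $$ s * eu m (fst s) (snd s) $$ (i,j)) = (\<Sum>s\<in>S. if s = (i,j) then A $$ (i,j) else 0)"
    using ij by (intro sum.cong) auto
  also have "\<dots> = A $$ (i,j)" using fin assms(3)[OF ij] by (auto simp: sum.delta)
  finally show "A $$ (i,j) = mat m m (\<lambda>ij. \<Sum>s\<in>S. A $$ s * eu m (fst s) (snd s) $$ ij) $$ (i,j)"
    using ij by simp
qed (use assms(1) in auto)

lemma eu_in_tri: "p a \<le> p b \<Longrightarrow> eu m a b \<in> tri p m"
  unfolding tri_def by auto

lemma bracket_eu_diag: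
  assumes "a < m" "b < m" "a \<noteq> b"
  shows "bracket (eu m a a) (eu m a b) = eu m a b"
  by (rule bracket_eqI[of _ m]) (use assms in \<open>simp_all del: index_mult_mat(1) add: mult_eu_entry[of _ m]\<close>)

text \<open>Every strictly triangular matrix unit is a bracket of triangular ones, [E_aa, E_ab] =
  E_ab, and these units span.\<close>

lemma derived_alg_tri:
  assumes p: "inj_on p {..<m}"
  shows "derived_alg m (tri p m) = strict_tri p m"
proof
  show "derived_alg m (tri p m) \<subseteq> strict_tri p m"
    by (intro derived_alg_subset msubspace_strict_tri bracket_tri[OF p])
  show "strict_tri p m \<subseteq> derived_alg m (tri p m)"
  proof
    fix A assume A: "A \<in> strict_tri p m"
    define S where "S = {(a,b). a < m \<and> b < m \<and> p a < p b}"
    have sub: "S \<subseteq> {..<m} \<times> {..<m}" by (auto simp: S_def)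
    have "A = mat m m (\<lambda>ij. \<Sum>s\<in>S. A $$ s * eu m (fst s) (snd s) $$ ij)"
      using A by (intro tri_decomp sub) (auto simp: strict_tri_def S_def not_less[symmetric])
    also have "\<dots> \<in> derived_alg m (tri p m)"
    proof (rule msubspace_sum)
      show "msubspace m (derived_alg m (tri p m))" by (rule msubspace_derived_alg) (auto simp: tri_def)
      show "finite S" using sub by (rule finite_subset) simp
      fix s assume "s \<in> S"
      then obtain a b where s: "s = (a,b)" "a < m" "b < m" "p a < p b" by (auto simp: S_def)
      have "bracket (eu m a a) (eu m a b) \<in> derived_alg m (tri p m)"
        using s by (intro bracket_in_derived_alg eu_in_tri) auto
      then show "eu m (fst s) (snd s) \<in> derived_alg m (tri p m)"
        using bracket_eu_diag[of a m b] s by fastforce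
    qed
    finally show "A \<in> derived_alg m (tri p m)" .
  qed
qed

lemma subalgebra_tri: "subalgebra m (tri p m)"
  using msubspace_tri gap_tri_bracket[of _ p m 0] unfolding subalgebra_def tri_eq_gap_tri by simp

lemma gap_tri_trivial: "\<exists>K. gap_tri p m (Suc K) \<subseteq> {0\<^sub>m m m}"
proof -
  \<comment> \<open>Every value of \<open>p\<close> on the indices lies between -K and K, so no
    entry can bridge a distance of 2K + 1.\<close>
  define K where "K = nat (\<Sum>a<m. \<bar>p a\<bar>)"
  have bound: "\<bar>p a\<bar> \<le> int K" if "a < m" for a
    unfolding K_def using member_le_sum[of a "{..<m}" "\<lambda>a. \<bar>p a\<bar>"] that
    by (simp add: sum_nonneg)
  have "gap_tri p m (Suc (2 * K)) \<subseteq> {0\<^sub>m m m}"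
  proof
    fix A assume A: "A \<in> gap_tri p m (Suc (2 * K))"
    have "A $$ (a,b) = 0" if "a < m" "b < m" for a b
    proof (rule ccontr)
      assume "A $$ (a,b) \<noteq> 0"
      then have "p a + int (Suc (2 * K)) \<le> p b" using A that unfolding gap_tri_def by blast
      then show False using bound[OF that(1)] bound[OF that(2)] by simp
    qed
    then have "A = 0\<^sub>m m m" using A by (intro eq_matI) (auto simp: gap_tri_def)
    then show "A \<in> {0\<^sub>m m m}" by simp
  qed
  then show ?thesis by blast
qed

lemma solvable_tri:
  assumes p: "inj_on p {..<m}"
  shows "solvable_alg m (tri p m)"
proof -
  have sub: "derived_series m (tri p m) (Suc k) \<subseteq> gap_tri p m (Suc k)" for k
  proof (induction k)
    case 0
    then show ?case using derived_alg_tri[OF p] by (simp add: strict_tri_eq_gap_tri)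
  next
    case (Suc k)
    \<comment> \<open>The bracket doubles the level, and 2(k+1) is at least k+2; a gain of one level
      per derived step suffices to reach zero.\<close>
    have "bracket A B \<in> gap_tri p m (Suc (Suc k))"
      if "A \<in> derived_series m (tri p m) (Suc k)" "B \<in> derived_series m (tri p m) (Suc k)" for A B
      using gap_tri_bracket[of A p m "Suc k" B] gap_tri_mono[of "Suc (Suc k)" "Suc k + Suc k" p m] Suc that by auto
    then show ?case unfolding derived_series.simps(2)[of _ _ "Suc k"]
      by (intro derived_alg_subset msubspace_gap_tri)
  qed
  obtain K where "gap_tri p m (Suc K) \<subseteq> {0\<^sub>m m m}" using gap_tri_trivial by blast
  moreover have "0\<^sub>m m m \<in> derived_series m (tri p m) (Suc (K))"
    using msubspace_derived_series[OF msubspace_tri, of m p "Suc (K)"] unfolding msubspace_def by blast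
  ultimately have "derived_series m (tri p m) (Suc (K)) = {0\<^sub>m m m}"
    using sub[of "K"] by blast
  then show ?thesis unfolding solvable_alg_def by blast
qed

text \<open>E = E_ab, F = E_ba and H = E_aa - E_bb satisfy [E,F] = H, [H,E] = 2E and [H,F] = -2F, so
  all three reappear in every term of the derived series.\<close>

lemma sl2_not_solvable:
  assumes ab: "a < m" "b < m" "a \<noteq> b"
    and c: "msubspace m c" "eu m a b \<in> c" "eu m b a \<in> c" "eu m a a - eu m b b \<in> c"
  shows "\<not> solvable_alg m c"
proof -
  let ?E = "eu m a b" and ?F = "eu m b a" and ?H = "eu m a a - eu m b b"
  have H: "?H \<in> carrier_mat m m" by (rule minus_carrier_mat) simp
  have Hij: "?H $$ (i,j) = (if i = j then if i = a then 1 else if i = b then -1 else 0 else 0)"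
    if "i < m" "j < m" for i j using that ab by auto
  have EF: "bracket ?E ?F = ?H"
    by (rule bracket_eqI[of _ m]) (use ab H in \<open>simp_all del: index_mult_mat(1) index_minus_mat add: mult_eu_entry[of _ m] Hij\<close>)
  have HE: "bracket ?H ?E = 2 \<cdot>\<^sub>m ?E"
    by (rule bracket_eqI[of _ m]) (use ab H in \<open>simp_all del: index_mult_mat(1) index_minus_mat add: mult_eu_entry[of _ m] eu_mult_entry[of _ m] Hij\<close>)
  have HF: "bracket ?H ?F = (-2) \<cdot>\<^sub>m ?F"
    by (rule bracket_eqI[of _ m]) (use ab H in \<open>simp_all del: index_mult_mat(1) index_minus_mat add: mult_eu_entry[of _ m] eu_mult_entry[of _ m] Hij\<close>)
  have "?E \<in> derived_series m c k \<and> ?F \<in> derived_series m c k \<and> ?H \<in> derived_series m c k" for k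
  proof (induction k)
    case 0
    then show ?case using c by simp
  next
    case (Suc k)
    let ?D = "derived_alg m (derived_series m c k)"
    have sp: "msubspace m ?D" using msubspace_derived_series[OF c(1), of "Suc k"] by simp
    have "?H \<in> ?D" using bracket_in_derived_alg[of ?E _ ?F m] Suc EF by metis
    moreover have "(1/2) \<cdot>\<^sub>m (2 \<cdot>\<^sub>m ?E) \<in> ?D"
      using bracket_in_derived_alg[of ?H _ ?E m] Suc HE sp unfolding msubspace_def by metis
    moreover have "(1/2) \<cdot>\<^sub>m (2 \<cdot>\<^sub>m ?E) = ?E" by (rule eq_matI) auto
    moreover have "(-1/2) \<cdot>\<^sub>m ((-2) \<cdot>\<^sub>m ?F) \<in> ?D"
      using bracket_in_derived_alg[of ?H _ ?F m] Suc HF sp unfolding msubspace_def by metis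
    moreover have "(-1/2) \<cdot>\<^sub>m ((-2) \<cdot>\<^sub>m ?F) = ?F" by (rule eq_matI) auto
    ultimately show ?case by simp
  qed
  moreover have "?E \<noteq> 0\<^sub>m m m"
  proof
    assume "?E = 0\<^sub>m m m"
    then have "?E $$ (a,b) = 0" using ab by simp
    then show False using ab by simp
  qed
  ultimately show ?thesis unfolding solvable_alg_def by blast
qed

lemma eu_in_subalgebra:
  assumes c: "subalgebra m c" and diag: "\<And>a. a < m \<Longrightarrow> eu m a a \<in> c"
    and A: "A \<in> c" "A $$ (a,b) \<noteq> 0" and ab: "a < m" "b < m" "a \<noteq> b"
  shows "eu m a b \<in> c"
proof -
  have sp: "msubspace m c" and br: "\<And>X Y. X \<in> c \<Longrightarrow> Y \<in> c \<Longrightarrow> bracket X Y \<in> c"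
    using c unfolding subalgebra_def by auto
  have car: "X \<in> carrier_mat m m" if "X \<in> c" for X using that sp unfolding msubspace_def by auto
  \<comment> \<open>The brackets with E_aa and E_bb keep only the entries (a,b) and (b,a) of
    \<open>A\<close>. One more bracket with E_aa reverses the sign at (b,a), so \<open>B + C\<close>
    is a multiple of E_ab, with factor twice the entry of \<open>A\<close>.\<close>
  define B where "B = bracket (bracket (eu m a a) A) (eu m b b)"
  define C where "C = bracket (eu m a a) B"
  have B: "B \<in> c" unfolding B_def using diag A ab by (intro br) auto
  have C: "C \<in> c" unfolding C_def using diag B ab by (intro br) auto
  have 1: "bracket (eu m a a) A \<in> carrier_mat m m" using diag A ab by (intro car br) auto
  have Bij: "B $$ (i,j) = (if i = a \<and> j = b then A $$ (a,b) else if i = b \<and> j = a then A $$ (b,a) else 0)"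
    if "i < m" "j < m" for i j
    unfolding B_def using that ab car[OF A(1)] 1
    by (auto simp: bracket_entry[of _ m] mult_eu_entry[of _ m] eu_mult_entry[of _ m] simp del: index_mult_mat(1))
  have Cij: "C $$ (i,j) = (if i = a \<and> j = b then A $$ (a,b) else if i = b \<and> j = a then - A $$ (b,a) else 0)"
    if "i < m" "j < m" for i j
    unfolding C_def using that ab car[OF B]
    by (auto simp: bracket_entry[of _ m] mult_eu_entry[of _ m] eu_mult_entry[of _ m] Bij simp del: index_mult_mat(1))
  have "eu m a b = (1 / (2 * A $$ (a,b))) \<cdot>\<^sub>m (B + C)"
  proof (rule eq_matI)
    fix i j assume "i < dim_row ((1 / (2 * A $$ (a,b))) \<cdot>\<^sub>m (B + C))"
      "j < dim_col ((1 / (2 * A $$ (a,b))) \<cdot>\<^sub>m (B + C))"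
    then have ij: "i < m" "j < m" using car[OF C] by auto
    then have "((1 / (2 * A $$ (a,b))) \<cdot>\<^sub>m (B + C)) $$ (i,j) = (1 / (2 * A $$ (a,b))) * (B $$ (i,j) + C $$ (i,j))"
      using car[OF B] car[OF C] by simp
    also have "\<dots> = eu m a b $$ (i,j)" unfolding Bij[OF ij] Cij[OF ij] using ij A(2) ab by auto
    finally show "eu m a b $$ (i,j) = ((1 / (2 * A $$ (a,b))) \<cdot>\<^sub>m (B + C)) $$ (i,j)" by simp
  qed (use car[OF C] in auto)
  also have "\<dots> \<in> c" by (intro msubspace_smult[OF sp] msubspace_add[OF sp] B C)
  finally show ?thesis .
qed

text \<open>For maximality, an element of a larger subalgebra has a nonzero entry on the wrong side
  of the order. The diagonal matrix units extract the corresponding matrix unit, its opposite lies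
  in \<open>tri p m\<close>, and the two span an sl(2) together with a diagonal element.\<close>

lemma borel_tri:
  assumes p: "inj_on p {..<m}"
  shows "borel m (tri p m)"
  unfolding borel_def
proof (intro conjI allI impI)
  show "subalgebra m (tri p m)" by (rule subalgebra_tri)
  show "solvable_alg m (tri p m)" by (rule solvable_tri[OF p])
  fix c assume c: "subalgebra m c \<and> solvable_alg m c \<and> tri p m \<subseteq> c"
  then have sp: "msubspace m c" unfolding subalgebra_def by auto
  have diag: "eu m a a \<in> c" if "a < m" for a using c eu_in_tri[of p a a m] by auto
  show "c = tri p m"
  proof (rule ccontr)
    assume "c \<noteq> tri p m"
    then obtain A where A: "A \<in> c" "A \<notin> tri p m" using c by blast
    then have "A \<in> carrier_mat m m" using sp unfolding msubspace_def by auto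
    with A obtain a b where ab: "a < m" "b < m" "p b < p a" "A $$ (a,b) \<noteq> 0" unfolding tri_def by auto
    then have "a \<noteq> b" by auto
    have "eu m a b \<in> c" using eu_in_subalgebra[of m c A a b] c diag A ab \<open>a \<noteq> b\<close> by auto
    moreover have "eu m b a \<in> c" using c eu_in_tri[of p b a m] ab by auto
    moreover have "eu m a a - eu m b b \<in> tri p m" unfolding tri_def by (auto intro!: minus_carrier_mat)
    ultimately show False using sl2_not_solvable[OF ab(1,2) \<open>a \<noteq> b\<close> sp] c by blast
  qed
qed

section \<open>Powers of bordered matrices\<close>

lemma pow_in_gap_tri:
  assumes "A \<in> strict_tri p m"
  shows "A ^\<^sub>m k \<in> gap_tri p m k"
proof (induction k)
  case 0
  then show ?case using assms by (auto simp: gap_tri_def strict_tri_def split: if_splits)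
next
  case (Suc k)
  then show ?case using mult_gap_tri[of "A ^\<^sub>m k" p m k A 1] assms by (simp add: strict_tri_eq_gap_tri)
qed

lemma strict_tri_nilpotent:
  assumes "A \<in> strict_tri p m"
  shows "A ^\<^sub>m m = 0\<^sub>m m m"
proof -
  obtain K where "gap_tri p m (Suc K) \<subseteq> {0\<^sub>m m m}" using gap_tri_trivial by blast
  then have "A ^\<^sub>m Suc K = 0\<^sub>m m m" using pow_in_gap_tri[OF assms, of "Suc K"] by blast
  moreover have "A \<in> carrier_mat m m" using assms by (simp add: strict_tri_def)
  ultimately show ?thesis by (rule nilpotent_pow_dim[rotated])
qed

lemma strict_tri_trace_pow:
  assumes "A \<in> strict_tri p m" "k \<ge> 1"
  shows "mtrace (A ^\<^sub>m k) = 0"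
proof -
  have A: "A \<in> carrier_mat m m" using assms by (simp add: strict_tri_def)
  have "(A ^\<^sub>m k) $$ (a,a) = 0" if "a < m" for a
    using pow_in_gap_tri[OF assms(1), of k] that assms(2) unfolding gap_tri_def by force
  then show ?thesis unfolding mtrace_def using A by simp
qed

text \<open>Since \<open>sgn_ord s b\<close> has absolute value \<open>b\<close>, the index
  \<open>b\<close> lies outside the range of all smaller ones, on the side chosen by
  \<open>s b\<close>. Index 0 has the value 0 under either sign, in accordance with the equality of
  the two orbits for i = 1.\<close>

definition sgn_ord :: "(nat \<Rightarrow> bool) \<Rightarrow> nat \<Rightarrow> int" where
  "sgn_ord s b = (if s b then int b else - int b)"

lemma sgn_ord_le:
  assumes "a < b"
  shows "sgn_ord s a \<le> sgn_ord s b \<longleftrightarrow> s b" "sgn_ord s b \<le> sgn_ord s a \<longleftrightarrow> \<not> s b"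
    "sgn_ord s a < sgn_ord s b \<longleftrightarrow> s b" "sgn_ord s b < sgn_ord s a \<longleftrightarrow> \<not> s b"
  using assms by (auto simp: sgn_ord_def)

lemma inj_sgn_ord: "inj_on (sgn_ord s) A"
  by (rule inj_onI) (metis linorder_neqE_nat order_less_irrefl sgn_ord_le(3,4))

section \<open>Corners, and powers of a corner bordered by one row and one column\<close>

lemma corner_carrier [simp]: "corner i x \<in> carrier_mat i i"
  and dim_corner [simp]: "dim_row (corner i x) = i" "dim_col (corner i x) = i"
  and corner_entry [simp]: "a < i \<Longrightarrow> b < i \<Longrightarrow> corner i x $$ (a,b) = x $$ (a,b)"
  by (auto simp: corner_def)

lemma corner_corner: "i \<le> m \<Longrightarrow> corner i (corner m x) = corner i x"
  by (rule eq_matI) auto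

lemma corner_self: "x \<in> carrier_mat m m \<Longrightarrow> corner m x = x"
  by (rule eq_matI) auto

lemma strict_tri_sgn_Suc:
  assumes "x \<in> carrier_mat (Suc m) (Suc m)"
  shows "x \<in> strict_tri (sgn_ord s) (Suc m) \<longleftrightarrow>
    corner m x \<in> strict_tri (sgn_ord s) m \<and> x $$ (m,m) = 0 \<and>
    (\<forall>a<m. if s m then x $$ (m,a) = 0 else x $$ (a,m) = 0)"
  using assms unfolding strict_tri_def by (auto simp: less_Suc_eq sgn_ord_le)

lemma vm_mult:
  assumes "A \<in> carrier_mat m m" "B \<in> carrier_mat m m" "b < m"
  shows "vm w (A * B) b = (\<Sum>c<m. vm w A c * B $$ (c,b))"
proof -
  have "vm w (A * B) b = (\<Sum>a<m. w a * (\<Sum>c<m. A $$ (a,c) * B $$ (c,b)))"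
    unfolding vm_def using assms by (intro sum.cong) (auto simp del: index_mult_mat(1) simp: mult_entry)
  also have "\<dots> = (\<Sum>c<m. vm w A c * B $$ (c,b))"
    unfolding vm_def using assms by (simp add: sum_distrib_left sum_distrib_right, subst sum.swap) (simp add: ac_simps)
  finally show ?thesis .
qed

text \<open>An entry of a power of \<open>x\<close> is a sum over paths in the indices, and a path
  that returns to \<open>m\<close> contributes a factor w y^l v. While these products vanish, only
  paths that visit \<open>m\<close> at most once survive. The range up to \<open>Suc r\<close> is
  chosen so that the entry (m,m) reaches w y^r v, the first product not assumed to be zero.\<close>

lemma bordered_pow:
  fixes x :: "complex mat" and m :: nat
  defines "y \<equiv> corner m x" and "v \<equiv> \<lambda>a. x $$ (a,m)" and "w \<equiv> \<lambda>b. x $$ (m,b)"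
  assumes x: "x \<in> carrier_mat (Suc m) (Suc m)" and xmm: "x $$ (m,m) = 0"
    and orth: "\<And>l. l < r \<Longrightarrow> (\<Sum>a<m. w a * mv (y ^\<^sub>m l) v a) = 0"
    and "j \<le> Suc r"
  shows "(\<forall>a<m. (x ^\<^sub>m Suc j) $$ (a,m) = mv (y ^\<^sub>m j) v a) \<and>
    (\<forall>b<m. (x ^\<^sub>m Suc j) $$ (m,b) = vm w (y ^\<^sub>m j) b) \<and>
    (x ^\<^sub>m Suc j) $$ (m,m) = (case j of 0 \<Rightarrow> 0 | Suc l \<Rightarrow> (\<Sum>a<m. w a * mv (y ^\<^sub>m l) v a)) \<and>
    (\<forall>a<m. \<forall>b<m. (x ^\<^sub>m Suc j) $$ (a,b) =
       (y ^\<^sub>m Suc j) $$ (a,b) + (\<Sum>p<j. mv (y ^\<^sub>m p) v a * vm w (y ^\<^sub>m (j - 1 - p)) b))"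
  using \<open>j \<le> Suc r\<close>
proof (induction j)
  case 0
  have "mv (1\<^sub>m m) v a = x $$ (a,m)" if "a < m" for a using mv_one_mat[OF that] by (simp add: v_def)
  moreover have "vm w (1\<^sub>m m) b = x $$ (m,b)" if "b < m" for b
    using vm_transpose[of "1\<^sub>m m" m b w] mv_one_mat[OF that] that by (simp add: w_def)
  ultimately show ?case using x xmm by (auto simp: y_def)
next
  case (Suc j)
  have y: "y \<in> carrier_mat m m" by (simp add: y_def)
  note IH = Suc.IH[OF Suc_leD[OF Suc.prems]]
  define X where "X = x ^\<^sub>m Suc j"
  have X: "X \<in> carrier_mat (Suc m) (Suc m)" unfolding X_def using x by (rule pow_carrier_mat)
  have am: "X $$ (a,m) = mv (y ^\<^sub>m j) v a" and mb: "X $$ (m,a) = vm w (y ^\<^sub>m j) a" if "a < m" for a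
    using IH that unfolding X_def by blast+
  have mm: "X $$ (m,m) = 0"
  proof -
    have "X $$ (m,m) = (case j of 0 \<Rightarrow> 0 | Suc l \<Rightarrow> (\<Sum>a<m. w a * mv (y ^\<^sub>m l) v a))"
      using IH unfolding X_def by blast
    also have "\<dots> = 0" using orth Suc.prems by (simp split: nat.split)
    finally show ?thesis .
  qed
  have ab: "X $$ (a,b) = (y ^\<^sub>m Suc j) $$ (a,b) + (\<Sum>p<j. mv (y ^\<^sub>m p) v a * vm w (y ^\<^sub>m (j - 1 - p)) b)"
    if "a < m" "b < m" for a b
    using IH that unfolding X_def by blast
  have step: "(x ^\<^sub>m Suc (Suc j)) $$ (a,b) = (\<Sum>c<m. X $$ (a,c) * x $$ (c,b)) + X $$ (a,m) * x $$ (m,b)"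
    if "a < Suc m" "b < Suc m" for a b
    using mult_entry[OF X x that] unfolding X_def by simp
  have orth': "(\<Sum>c<m. vm w (y ^\<^sub>m l) c * v c) = 0" if "l < r" for l
    using orth[OF that] sum_mv_eq_sum_vm[of "y ^\<^sub>m l" m w v] y by simp
  have "(x ^\<^sub>m Suc (Suc j)) $$ (a,m) = mv (y ^\<^sub>m Suc j) v a" if "a < m" for a
  proof -
    have "(x ^\<^sub>m Suc (Suc j)) $$ (a,m) = (\<Sum>c<m. X $$ (a,c) * v c)"
      using step[of a m] that xmm by (simp add: v_def)
    also have "\<dots> = (\<Sum>c<m. (y ^\<^sub>m Suc j) $$ (a,c) * v c)
        + (\<Sum>c<m. \<Sum>p<j. mv (y ^\<^sub>m p) v a * (vm w (y ^\<^sub>m (j - 1 - p)) c * v c))"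
      using ab[OF that] by (simp add: distrib_right sum.distrib sum_distrib_right mult.assoc del: pow_mat.simps)
    also have "(\<Sum>c<m. \<Sum>p<j. mv (y ^\<^sub>m p) v a * (vm w (y ^\<^sub>m (j - 1 - p)) c * v c))
        = (\<Sum>p<j. mv (y ^\<^sub>m p) v a * (\<Sum>c<m. vm w (y ^\<^sub>m (j - 1 - p)) c * v c))"
      by (subst sum.swap) (simp add: sum_distrib_left)
    also have "\<dots> = 0" using orth' Suc.prems by (intro sum.neutral ballI) auto
    finally show ?thesis unfolding mv_def using y by simp
  qed
  moreover have "(x ^\<^sub>m Suc (Suc j)) $$ (m,b) = vm w (y ^\<^sub>m Suc j) b" if "b < m" for b
  proof -
    have "(x ^\<^sub>m Suc (Suc j)) $$ (m,b) = (\<Sum>c<m. vm w (y ^\<^sub>m j) c * y $$ (c,b))"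
      using step[of m b] that mb mm by (simp add: y_def)
    also have "\<dots> = vm w (y ^\<^sub>m Suc j) b" using vm_mult[of "y ^\<^sub>m j" m y b w] y that by simp
    finally show ?thesis .
  qed
  moreover have "(x ^\<^sub>m Suc (Suc j)) $$ (m,m) = (\<Sum>a<m. w a * mv (y ^\<^sub>m j) v a)"
    using step[of m m] mb xmm sum_mv_eq_sum_vm[of "y ^\<^sub>m j" m w v] y by (simp add: v_def)
  moreover have "(x ^\<^sub>m Suc (Suc j)) $$ (a,b) =
       (y ^\<^sub>m Suc (Suc j)) $$ (a,b) + (\<Sum>p<Suc j. mv (y ^\<^sub>m p) v a * vm w (y ^\<^sub>m (Suc j - 1 - p)) b)"
    if "a < m" "b < m" for a b
  proof -
    have "(x ^\<^sub>m Suc (Suc j)) $$ (a,b) = (\<Sum>c<m. X $$ (a,c) * y $$ (c,b)) + mv (y ^\<^sub>m j) v a * w b"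
      using step[of a b] that am by (simp add: y_def w_def)
    also have "(\<Sum>c<m. X $$ (a,c) * y $$ (c,b)) = (\<Sum>c<m. (y ^\<^sub>m Suc j) $$ (a,c) * y $$ (c,b))
        + (\<Sum>c<m. \<Sum>p<j. mv (y ^\<^sub>m p) v a * (vm w (y ^\<^sub>m (j - 1 - p)) c * y $$ (c,b)))"
      using ab[OF that(1)] by (simp add: distrib_right sum.distrib sum_distrib_right mult.assoc del: pow_mat.simps)
    also have "(\<Sum>c<m. (y ^\<^sub>m Suc j) $$ (a,c) * y $$ (c,b)) = (y ^\<^sub>m Suc (Suc j)) $$ (a,b)"
      using mult_entry[OF pow_carrier_mat[OF y, of "Suc j"] y that] by (simp only: pow_mat.simps(2)[of y "Suc j"])
    also have "(\<Sum>c<m. \<Sum>p<j. mv (y ^\<^sub>m p) v a * (vm w (y ^\<^sub>m (j - 1 - p)) c * y $$ (c,b)))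
        = (\<Sum>p<j. mv (y ^\<^sub>m p) v a * (\<Sum>c<m. vm w (y ^\<^sub>m (j - 1 - p)) c * y $$ (c,b)))"
      by (subst sum.swap) (simp add: sum_distrib_left)
    also have "\<dots> = (\<Sum>p<j. mv (y ^\<^sub>m p) v a * vm w (y ^\<^sub>m (Suc j - 1 - p)) b)"
    proof (rule sum.cong[OF refl])
      fix p assume p: "p \<in> {..<j}"
      have "(\<Sum>c<m. vm w (y ^\<^sub>m (j - 1 - p)) c * y $$ (c,b)) = vm w (y ^\<^sub>m Suc (j - 1 - p)) b"
        using vm_mult[of "y ^\<^sub>m (j - 1 - p)" m y b w] y that by simp
      moreover have "Suc (j - 1 - p) = Suc j - 1 - p" using p by auto
      ultimately show "mv (y ^\<^sub>m p) v a * (\<Sum>c<m. vm w (y ^\<^sub>m (j - 1 - p)) c * y $$ (c,b))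
        = mv (y ^\<^sub>m p) v a * vm w (y ^\<^sub>m (Suc j - 1 - p)) b" by (simp only:)
    qed
    moreover have "w b = vm w (y ^\<^sub>m (Suc j - 1 - j)) b"
      using vm_transpose[of "1\<^sub>m m" m b w] mv_one_mat[OF that(2), of w] that y by simp
    ultimately show ?thesis by simp
  qed
  ultimately show ?case by (simp del: pow_mat.simps)
qed

text \<open>The factor \<open>r + 2\<close> counts equal contributions: each of the
  \<open>r + 1\<close> splittings y^p v times w y^(r-p) has trace w y^r v, and the entry (m,m)
  supplies the same number once more.\<close>

lemma bordered_trace:
  fixes x :: "complex mat" and m :: nat
  defines "y \<equiv> corner m x" and "v \<equiv> \<lambda>a. x $$ (a,m)" and "w \<equiv> \<lambda>b. x $$ (m,b)"
  assumes x: "x \<in> carrier_mat (Suc m) (Suc m)" and xmm: "x $$ (m,m) = 0"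
    and orth: "\<And>l. l < r \<Longrightarrow> (\<Sum>a<m. w a * mv (y ^\<^sub>m l) v a) = 0"
  shows "mtrace (x ^\<^sub>m Suc (Suc r)) = mtrace (y ^\<^sub>m Suc (Suc r)) + of_nat (r + 2) * (\<Sum>a<m. w a * mv (y ^\<^sub>m r) v a)"
proof -
  have y: "y \<in> carrier_mat m m" by (simp add: y_def)
  note B = bordered_pow[OF x xmm orth[unfolded y_def v_def w_def], of r "Suc r", folded y_def v_def w_def]
  have pq: "(\<Sum>a<m. mv (y ^\<^sub>m p) v a * vm w (y ^\<^sub>m (r - p)) a) = (\<Sum>a<m. w a * mv (y ^\<^sub>m r) v a)" if "p \<le> r" for p
  proof -
    have "(\<Sum>a<m. mv (y ^\<^sub>m p) v a * vm w (y ^\<^sub>m (r - p)) a) = (\<Sum>a<m. w a * mv (y ^\<^sub>m (r - p)) (mv (y ^\<^sub>m p) v) a)"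
      using sum_mv_eq_sum_vm[of "y ^\<^sub>m (r - p)" m w "mv (y ^\<^sub>m p) v"] y by (simp add: mult.commute)
    also have "\<dots> = (\<Sum>a<m. w a * mv (y ^\<^sub>m r) v a)"
      using mv_pow_add[OF y, of _ "r - p" p v] that by simp
    finally show ?thesis .
  qed
  have "mtrace (x ^\<^sub>m Suc (Suc r)) = (\<Sum>a<Suc m. (x ^\<^sub>m Suc (Suc r)) $$ (a,a))"
    unfolding mtrace_def using x by (simp del: pow_mat.simps)
  also have "\<dots> = (\<Sum>a<m. (y ^\<^sub>m Suc (Suc r)) $$ (a,a) + (\<Sum>p<Suc r. mv (y ^\<^sub>m p) v a * vm w (y ^\<^sub>m (r - p)) a))
      + (\<Sum>a<m. w a * mv (y ^\<^sub>m r) v a)"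
    using B by (simp add: w_def del: pow_mat.simps)
  also have "\<dots> = mtrace (y ^\<^sub>m Suc (Suc r)) + (\<Sum>p<Suc r. \<Sum>a<m. mv (y ^\<^sub>m p) v a * vm w (y ^\<^sub>m (r - p)) a)
      + (\<Sum>a<m. w a * mv (y ^\<^sub>m r) v a)"
    unfolding mtrace_def sum.distrib using y by (subst sum.swap) (simp del: pow_mat.simps sum.lessThan_Suc)
  also have "(\<Sum>p<Suc r. \<Sum>a<m. mv (y ^\<^sub>m p) v a * vm w (y ^\<^sub>m (r - p)) a)
      = of_nat (r + 1) * (\<Sum>a<m. w a * mv (y ^\<^sub>m r) v a)"
    using pq by (simp add: less_Suc_eq_le del: sum.lessThan_Suc)
  finally show ?thesis by (simp add: algebra_simps)
qed

text \<open>This takes the place of Newton's identities: \<open>Tr x\<^sup>k\<close> determines the products \<open>w y\<^sup>l v\<close> one after another.\<close>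

lemma bordered_orthogonal:
  fixes x :: "complex mat" and m :: nat
  defines "y \<equiv> corner m x" and "v \<equiv> \<lambda>a. x $$ (a,m)" and "w \<equiv> \<lambda>b. x $$ (m,b)"
  assumes x: "x \<in> carrier_mat (Suc m) (Suc m)" and xmm: "x $$ (m,m) = 0"
    and ym: "y ^\<^sub>m m = 0\<^sub>m m m"
    and tr: "\<And>k. k \<ge> 1 \<Longrightarrow> mtrace (y ^\<^sub>m k) = 0" "\<And>k. 1 \<le> k \<Longrightarrow> k \<le> Suc m \<Longrightarrow> mtrace (x ^\<^sub>m k) = 0"
  shows "(\<Sum>a<m. w a * mv (y ^\<^sub>m l) v a) = 0"
proof (induction l rule: less_induct)
  case (less l)
  have y: "y \<in> carrier_mat m m" by (simp add: y_def)
  show ?case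
  proof (cases "l < m")
    case True
    have "mtrace (x ^\<^sub>m Suc (Suc l)) = mtrace (y ^\<^sub>m Suc (Suc l)) + of_nat (l + 2) * (\<Sum>a<m. w a * mv (y ^\<^sub>m l) v a)"
      using bordered_trace[OF x xmm, of l] less unfolding y_def v_def w_def by blast
    then have "of_nat (l + 2) * (\<Sum>a<m. w a * mv (y ^\<^sub>m l) v a) = 0"
      using tr(1)[of "Suc (Suc l)"] tr(2)[of "Suc (Suc l)"] True by simp
    moreover have "of_nat (l + 2) \<noteq> (0 :: complex)" by (simp only: of_nat_eq_0_iff)
    ultimately show ?thesis by (simp only: mult_eq_0_iff simp_thms)
  next
    case False
    then show ?thesis using pow_eq_zero_mono[OF y ym, of l] mv_zero_mat[of _ m v] by simp
  qed
qed

section \<open>Independence of the powers of the corners\<close>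

text \<open>Linear independence of the matrices x_i^j, extended by zero, written entry by entry: the
  corner of size \<open>i\<close> reaches the entry (a,b) only if i > max a b. The powers run over
  \<open>j < i\<close> since differentiating the trace of a power lowers the exponent by
  one.\<close>

definition corner_indep :: "nat \<Rightarrow> complex mat \<Rightarrow> bool" where
  "corner_indep N x \<longleftrightarrow> (\<forall>c :: nat \<Rightarrow> nat \<Rightarrow> complex.
     (\<forall>a<N. \<forall>b<N. (\<Sum>i\<in>{Suc (max a b)..N}. \<Sum>j<i. c i j * (corner i x ^\<^sub>m j) $$ (a,b)) = 0)
     \<longrightarrow> (\<forall>i\<in>{1..N}. \<forall>j<i. c i j = 0))"

lemma corner_indepD:
  assumes "corner_indep N x"
    and "\<And>a b. a < N \<Longrightarrow> b < N \<Longrightarrow> (\<Sum>i\<in>{Suc (max a b)..N}. \<Sum>j<i. c i j * (corner i x ^\<^sub>m j) $$ (a,b)) = 0"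
    and "1 \<le> i" "i \<le> N" "j < i"
  shows "c i j = 0"
  using assms unfolding corner_indep_def by auto

lemma corner_indep_top:
  assumes "corner_indep N x" "N \<ge> 1" and x: "x \<in> carrier_mat N N"
  shows "x ^\<^sub>m (N - 1) \<noteq> 0\<^sub>m N N"
proof
  assume z: "x ^\<^sub>m (N - 1) = 0\<^sub>m N N"
  define c :: "nat \<Rightarrow> nat \<Rightarrow> complex" where "c i j = (if i = N \<and> j = N - 1 then 1 else 0)" for i j
  have "c N (N - 1) = 0"
  proof (rule corner_indepD[OF assms(1), of c])
    fix a b assume ab: "a < N" "b < N"
    show "(\<Sum>i\<in>{Suc (max a b)..N}. \<Sum>j<i. c i j * (corner i x ^\<^sub>m j) $$ (a,b)) = 0"
      using z ab by (intro sum.neutral ballI) (auto simp: c_def corner_self[OF x])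
  qed (use assms(2) in auto)
  then show False by (simp add: c_def)
qed

lemma corner_indep_corner:
  assumes "corner_indep (Suc m) x"
  shows "corner_indep m (corner m x)"
  unfolding corner_indep_def
proof (intro allI impI ballI)
  fix c i j
  assume c: "\<forall>a<m. \<forall>b<m. (\<Sum>i\<in>{Suc (max a b)..m}. \<Sum>j<i. c i j * (corner i (corner m x) ^\<^sub>m j) $$ (a,b)) = 0"
    and i: "i \<in> {1..m}" and j: "j < i"
  define d where "d i j = (if i \<le> m then c i j else 0)" for i j
  have "d i j = 0"
  proof (rule corner_indepD[OF assms, of d])
    fix a b assume "a < Suc m" "b < Suc m"
    then have "max a b \<le> m" by simp
    have "(\<Sum>i\<in>{Suc (max a b)..Suc m}. \<Sum>j<i. d i j * (corner i x ^\<^sub>m j) $$ (a,b))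
        = (\<Sum>i\<in>{Suc (max a b)..m}. \<Sum>j<i. d i j * (corner i x ^\<^sub>m j) $$ (a,b))"
      using \<open>max a b \<le> m\<close> by (subst sum.cl_ivl_Suc) (simp add: d_def)
    also have "\<dots> = (\<Sum>i\<in>{Suc (max a b)..m}. \<Sum>j<i. c i j * (corner i (corner m x) ^\<^sub>m j) $$ (a,b))"
      by (intro sum.cong refl) (auto simp: d_def corner_corner)
    also have "\<dots> = 0"
    proof (cases "max a b < m")
      case True
      then show ?thesis using c by simp
    next
      case False
      then have "{Suc (max a b)..m} = {}" by auto
      then show ?thesis by simp
    qed
    finally show "(\<Sum>i\<in>{Suc (max a b)..Suc m}. \<Sum>j<i. d i j * (corner i x ^\<^sub>m j) $$ (a,b)) = 0" .
  qed (use i j in auto)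
  then show "c i j = 0" using i by (simp add: d_def)
qed

text \<open>Only the full matrix reaches the last row and column. There a relation involves its
  powers alone, whose coefficients vanish by \<open>top\<close>; what is left is a relation for the
  corner of size \<open>m\<close>.\<close>

lemma corner_indep_Suc:
  assumes x: "x \<in> carrier_mat (Suc m) (Suc m)" and y: "corner_indep m (corner m x)"
    and top: "\<And>c. \<forall>a\<le>m. (\<Sum>j<Suc m. c j * (x ^\<^sub>m j) $$ (a,m)) = 0
        \<and> (\<Sum>j<Suc m. c j * (x ^\<^sub>m j) $$ (m,a)) = 0 \<Longrightarrow> \<forall>j<Suc m. c j = 0"
  shows "corner_indep (Suc m) x"
  unfolding corner_indep_def
proof (intro allI impI)
  fix c
  assume c: "\<forall>a<Suc m. \<forall>b<Suc m. (\<Sum>i\<in>{Suc (max a b)..Suc m}. \<Sum>j<i. c i j * (corner i x ^\<^sub>m j) $$ (a,b)) = 0"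
  have cab: "(\<Sum>i\<in>{Suc (max a b)..m}. \<Sum>j<i. c i j * (corner i x ^\<^sub>m j) $$ (a,b))
      + (\<Sum>j<Suc m. c (Suc m) j * (x ^\<^sub>m j) $$ (a,b)) = 0" if "a \<le> m" "b \<le> m" for a b
  proof -
    have "(\<Sum>i\<in>{Suc (max a b)..Suc m}. \<Sum>j<i. c i j * (corner i x ^\<^sub>m j) $$ (a,b)) = 0" using c that by auto
    moreover have "\<not> Suc m < Suc (max a b)" using that by simp
    ultimately show ?thesis by (subst (asm) sum.cl_ivl_Suc) (simp add: corner_self[OF x])
  qed
  have top0: "\<forall>j<Suc m. c (Suc m) j = 0"
  proof (rule top, intro allI impI conjI)
    fix a assume "a \<le> m"
    then show "(\<Sum>j<Suc m. c (Suc m) j * (x ^\<^sub>m j) $$ (a,m)) = 0" "(\<Sum>j<Suc m. c (Suc m) j * (x ^\<^sub>m j) $$ (m,a)) = 0"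
      using cab[of a m] cab[of m a] by auto
  qed
  have "c i j = 0" if "1 \<le> i" "i \<le> m" "j < i" for i j
  proof (rule corner_indepD[OF y _ that])
    fix a b assume ab: "a < m" "b < m"
    have "(\<Sum>i\<in>{Suc (max a b)..m}. \<Sum>j<i. c i j * (corner i (corner m x) ^\<^sub>m j) $$ (a,b))
        = (\<Sum>i\<in>{Suc (max a b)..m}. \<Sum>j<i. c i j * (corner i x ^\<^sub>m j) $$ (a,b))"
      by (intro sum.cong refl) (auto simp: corner_corner)
    also have "\<dots> = 0" using cab[of a b] ab top0 by simp
    finally show "(\<Sum>i\<in>{Suc (max a b)..m}. \<Sum>j<i. c i j * (corner i (corner m x) ^\<^sub>m j) $$ (a,b)) = 0" .
  qed
  with top0 show "\<forall>i\<in>{1..Suc m}. \<forall>j<i. c i j = 0" by (auto simp: le_Suc_eq)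
qed

text \<open>Triangularity makes the border column or the border row zero. All products w y^l v and
  all correction terms of \<open>bordered_pow\<close> then vanish, for every exponent.\<close>

lemma strict_tri_border_pow:
  assumes x: "x \<in> strict_tri (sgn_ord s) (Suc m)"
  shows "a < m \<Longrightarrow> (x ^\<^sub>m Suc j) $$ (a,m) = mv (corner m x ^\<^sub>m j) (\<lambda>a. x $$ (a,m)) a"
    and "b < m \<Longrightarrow> (x ^\<^sub>m Suc j) $$ (m,b) = vm (\<lambda>b. x $$ (m,b)) (corner m x ^\<^sub>m j) b"
    and "(x ^\<^sub>m Suc j) $$ (m,m) = 0"
    and "a < m \<Longrightarrow> b < m \<Longrightarrow> (x ^\<^sub>m Suc j) $$ (a,b) = (corner m x ^\<^sub>m Suc j) $$ (a,b)"
    and "\<not> s m \<Longrightarrow> a < m \<Longrightarrow> (x ^\<^sub>m Suc j) $$ (a,m) = 0"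
    and "s m \<Longrightarrow> b < m \<Longrightarrow> (x ^\<^sub>m Suc j) $$ (m,b) = 0"
proof -
  let ?y = "corner m x" and ?v = "\<lambda>a. x $$ (a,m)" and ?w = "\<lambda>b. x $$ (m,b)"
  have xc: "x \<in> carrier_mat (Suc m) (Suc m)" using x by (simp add: strict_tri_def)
  have xs: "x $$ (m,m) = 0" "\<forall>a<m. if s m then x $$ (m,a) = 0 else x $$ (a,m) = 0"
    using x unfolding strict_tri_sgn_Suc[OF xc] by auto
  have v: "mv (?y ^\<^sub>m k) ?v a = 0" if "\<not> s m" for k a
    using xs(2) that by (intro mv_zero_vec[of _ m]) auto
  have w: "vm ?w (?y ^\<^sub>m k) b = 0" if "s m" for k b
    using xs(2) that by (simp add: vm_def)
  have orth: "(\<Sum>a<m. ?w a * mv (?y ^\<^sub>m l) ?v a) = 0" for l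
    using v xs(2) by (cases "s m") auto
  have 4: "(\<Sum>p<j. mv (?y ^\<^sub>m p) ?v a * vm ?w (?y ^\<^sub>m (j - 1 - p)) b) = 0" for a b
    using v w by (cases "s m") auto
  have mm: "(case j of 0 \<Rightarrow> 0 | Suc l \<Rightarrow> (\<Sum>a<m. ?w a * mv (?y ^\<^sub>m l) ?v a)) = 0"
    using orth by (simp split: nat.split)
  note B = bordered_pow[OF xc xs(1) orth, of j j, unfolded 4 mm]
  show "a < m \<Longrightarrow> (x ^\<^sub>m Suc j) $$ (a,m) = mv (?y ^\<^sub>m j) ?v a" using B by (simp del: pow_mat.simps)
  show "b < m \<Longrightarrow> (x ^\<^sub>m Suc j) $$ (m,b) = vm ?w (?y ^\<^sub>m j) b" using B by (simp del: pow_mat.simps)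
  show "(x ^\<^sub>m Suc j) $$ (m,m) = 0" using B by (simp del: pow_mat.simps)
  show "a < m \<Longrightarrow> b < m \<Longrightarrow> (x ^\<^sub>m Suc j) $$ (a,b) = (?y ^\<^sub>m Suc j) $$ (a,b)" using B by (simp del: pow_mat.simps)
  show "\<not> s m \<Longrightarrow> a < m \<Longrightarrow> (x ^\<^sub>m Suc j) $$ (a,m) = 0" using B v by (simp del: pow_mat.simps)
  show "s m \<Longrightarrow> b < m \<Longrightarrow> (x ^\<^sub>m Suc j) $$ (m,b) = 0" using B w by (simp del: pow_mat.simps)
qed

text \<open>The corner satisfies y^m = 0, so a nonzero entry of x^m lies in the last row or column,
  where it is an entry of w y^(m-1) or y^(m-1) v. Hence the half of the border that may be nonzero
  is cyclic for the previous corner or its transpose.\<close>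

lemma regular_border:
  assumes x: "x \<in> strict_tri (sgn_ord s) (Suc m)" and m: "m \<ge> 1" and nz: "x ^\<^sub>m m \<noteq> 0\<^sub>m (Suc m) (Suc m)"
  shows "if s m then \<exists>a<m. mv (corner m x ^\<^sub>m (m - 1)) (\<lambda>a. x $$ (a,m)) a \<noteq> 0
    else \<exists>b<m. vm (\<lambda>b. x $$ (m,b)) (corner m x ^\<^sub>m (m - 1)) b \<noteq> 0"
proof -
  have xc: "x \<in> carrier_mat (Suc m) (Suc m)" using x by (simp add: strict_tri_def)
  have y: "corner m x \<in> strict_tri (sgn_ord s) m" using x strict_tri_sgn_Suc[OF xc] by simp
  obtain a b where ab: "a < Suc m" "b < Suc m" "(x ^\<^sub>m m) $$ (a,b) \<noteq> 0"
    using mat_nonzero_entry[of "x ^\<^sub>m m" "Suc m"] xc nz by auto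
  obtain k where k: "m = Suc k" using m by (cases m) auto
  note B = strict_tri_border_pow[OF x, where j = k, folded k]
  have "(corner m x ^\<^sub>m m) $$ (a,b) = 0" if "a < m" "b < m"
    using strict_tri_nilpotent[OF y] that by simp
  then consider "b = m" "a < m" "s m" | "a = m" "b < m" "\<not> s m"
    using ab B(3,4,5,6) by (metis less_Suc_eq)
  then show ?thesis
  proof cases
    case 1
    then show ?thesis using ab B(1)[of a] k by auto
  next
    case 2
    then show ?thesis using ab B(2)[of b] k by auto
  qed
qed

lemma regular_corner:
  assumes x: "x \<in> strict_tri (sgn_ord s) (Suc m)" and m: "m \<ge> 1" and nz: "x ^\<^sub>m m \<noteq> 0\<^sub>m (Suc m) (Suc m)"
  shows "corner m x ^\<^sub>m (m - 1) \<noteq> 0\<^sub>m m m"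
proof
  assume z: "corner m x ^\<^sub>m (m - 1) = 0\<^sub>m m m"
  have "mv (0\<^sub>m m m) v a = 0" "vm v (0\<^sub>m m m) a = 0" if "a < m" for v a
    using that by (auto simp: mv_def vm_def)
  then show False using regular_border[OF assms] unfolding z by (auto split: if_splits)
qed

lemma strict_tri_corner_indep:
  assumes "N \<ge> 1" "x \<in> strict_tri (sgn_ord s) N" "x ^\<^sub>m (N - 1) \<noteq> 0\<^sub>m N N"
  shows "corner_indep N x"
  using assms
proof (induction N arbitrary: x rule: nat_induct_at_least)
  case base
  then have x: "x \<in> carrier_mat 1 1" by (simp add: strict_tri_def)
  show ?case unfolding corner_indep_def
  proof (intro allI impI)
    fix c
    assume "\<forall>a<1. \<forall>b<1. (\<Sum>i\<in>{Suc (max a b)..1}. \<Sum>j<i. c i j * (corner i x ^\<^sub>m j) $$ (a,b)) = 0"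
    then have "c 1 0 = 0" by (auto simp: corner_self[OF x])
    then show "\<forall>i\<in>{1..1}. \<forall>j<i. c i j = 0" by auto
  qed
next
  case (Suc m)
  then have nz: "x ^\<^sub>m m \<noteq> 0\<^sub>m (Suc m) (Suc m)" by simp
  have x: "x \<in> carrier_mat (Suc m) (Suc m)" using Suc.prems by (simp add: strict_tri_def)
  let ?y = "corner m x" and ?v = "\<lambda>a. x $$ (a,m)" and ?w = "\<lambda>b. x $$ (m,b)"
  have ys: "?y \<in> strict_tri (sgn_ord s) m" using Suc.prems strict_tri_sgn_Suc[OF x] by simp
  have y0: "?y ^\<^sub>m m = 0\<^sub>m m m" by (rule strict_tri_nilpotent[OF ys])
  have yt0: "transpose_mat ?y ^\<^sub>m m = 0\<^sub>m m m"
  proof -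
    have "transpose_mat (0\<^sub>m m m) = (0\<^sub>m m m :: complex mat)" by (rule eq_matI) auto
    then show ?thesis using transpose_pow_mat[of ?y m m] y0 by simp
  qed
  have "corner_indep m ?y" using Suc.IH[OF ys regular_corner[OF Suc.prems(1) Suc.hyps nz]] .
  then show ?case
  proof (rule corner_indep_Suc[OF x])
    fix c assume c: "\<forall>a\<le>m. (\<Sum>j<Suc m. c j * (x ^\<^sub>m j) $$ (a,m)) = 0 \<and> (\<Sum>j<Suc m. c j * (x ^\<^sub>m j) $$ (m,a)) = 0"
    note B = strict_tri_border_pow[OF Suc.prems(1)]
    \<comment> \<open>At (m,m) only the power 0 has a nonzero entry, which disposes of
      \<open>c 0\<close>. The border of x^(j+1) is the j-th member of a chain, whence the shift to
      \<open>c (Suc j)\<close> below.\<close>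
    have "(\<Sum>j<Suc m. c j * (x ^\<^sub>m j) $$ (m,m)) = c 0"
      using B(3) x by (subst sum.lessThan_Suc_shift) (simp del: pow_mat.simps(2))
    then have c0: "c 0 = 0" using c by simp
    have m: "Suc (m - 1) = m" "{..m - 1} = {..<m}" using Suc.hyps by auto
    have "c (Suc j) = 0" if "j < m" for j
    proof (cases "s m")
      case True
      show ?thesis
      proof (rule nilpotent_chain_indep[of ?y m "m - 1" ?v "\<lambda>j. c (Suc j)"])
        show "mv (?y ^\<^sub>m Suc (m - 1)) ?v a = 0" if "a < m" for a
          unfolding m y0 using mv_zero_mat[OF that] .
        show "\<exists>a<m. mv (?y ^\<^sub>m (m - 1)) ?v a \<noteq> 0"
          using regular_border[OF Suc.prems(1) Suc.hyps nz] True by simp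
        show "(\<Sum>k\<le>m - 1. c (Suc k) * mv (?y ^\<^sub>m k) ?v a) = 0" if "a < m" for a
        proof -
          have "(\<Sum>j<Suc m. c j * (x ^\<^sub>m j) $$ (a,m)) = 0" using c that by auto
          then show ?thesis using B(1)[OF that] c0 unfolding m
            by (subst (asm) sum.lessThan_Suc_shift) (simp del: pow_mat.simps(2))
        qed
      qed (use that in auto)
    next
      case False
      show ?thesis
      proof (rule nilpotent_chain_indep[of "transpose_mat ?y" m "m - 1" ?w "\<lambda>j. c (Suc j)"])
        show "mv (transpose_mat ?y ^\<^sub>m Suc (m - 1)) ?w a = 0" if "a < m" for a
          unfolding m yt0 using mv_zero_mat[OF that] .
        show "\<exists>a<m. mv (transpose_mat ?y ^\<^sub>m (m - 1)) ?w a \<noteq> 0"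
          using regular_border[OF Suc.prems(1) Suc.hyps nz] False vm_pow_transpose[of ?y m] by auto
        show "(\<Sum>k\<le>m - 1. c (Suc k) * mv (transpose_mat ?y ^\<^sub>m k) ?w a) = 0" if "a < m" for a
        proof -
          have "(\<Sum>j<Suc m. c j * (x ^\<^sub>m j) $$ (m,a)) = 0" using c that by auto
          then show ?thesis using B(2)[OF that] c0 vm_pow_transpose[of ?y m a] that unfolding m
            by (subst (asm) sum.lessThan_Suc_shift) (simp del: pow_mat.simps(2))
        qed
      qed (use that in auto)
    qed
    with c0 show "\<forall>j<Suc m. c j = 0" by (metis Suc_less_eq not0_implies_Suc)
  qed
qed

lemma border_row_or_column_zero:
  fixes x :: "complex mat" and m :: nat
  defines "y \<equiv> corner m x"
  assumes x: "x \<in> carrier_mat (Suc m) (Suc m)" and m: "m \<ge> 1" and xmm: "x $$ (m,m) = 0"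
    and y0: "y ^\<^sub>m m = 0\<^sub>m m m" and ynz: "y ^\<^sub>m (m - 1) \<noteq> 0\<^sub>m m m"
    and orth: "\<And>l. (\<Sum>a<m. x $$ (m,a) * mv (y ^\<^sub>m l) (\<lambda>a. x $$ (a,m)) a) = 0"
    and indep: "corner_indep (Suc m) x"
  shows "(\<forall>a<m. x $$ (m,a) = 0) \<or> (\<forall>a<m. x $$ (a,m) = 0)"
proof (rule ccontr)
  let ?v = "\<lambda>a. x $$ (a,m)" and ?w = "\<lambda>b. x $$ (m,b)"
  assume neither: "\<not> ?thesis"
  have y: "y \<in> carrier_mat m m" and yt: "transpose_mat y \<in> carrier_mat m m" by (simp_all add: y_def)
  \<comment> \<open>If y^(m-1) v were nonzero, \<open>v\<close> would be cyclic, and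
    \<open>w\<close>, being orthogonal to all y^l v, would vanish. The argument for
    \<open>wy\<close> is the same with the transpose.\<close>
  have yv: "mv (y ^\<^sub>m (m - 1)) ?v a = 0" if "a < m" for a
  proof (rule ccontr)
    assume "mv (y ^\<^sub>m (m - 1)) ?v a \<noteq> 0"
    then have "\<exists>a<m. mv (y ^\<^sub>m (m - 1)) ?v a \<noteq> 0" using that by blast
    moreover have "mv (y ^\<^sub>m m) ?v a = 0" if "a < m" for a
      unfolding y0 using mv_zero_mat[OF that] .
    ultimately have "?w a = 0" if "a < m" for a
      using nilpotent_chain_functional[OF y, of ?v ?w a] orth that by blast
    with neither show False by blast
  qed
  have wy: "vm ?w (y ^\<^sub>m (m - 1)) b = 0" if "b < m" for b
  proof (rule ccontr)
    assume "vm ?w (y ^\<^sub>m (m - 1)) b \<noteq> 0"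
    then have nz: "\<exists>a<m. mv (transpose_mat y ^\<^sub>m (m - 1)) ?w a \<noteq> 0"
      using that vm_pow_transpose[OF y that, of ?w "m - 1"] by auto
    have "transpose_mat (0\<^sub>m m m) = (0\<^sub>m m m :: complex mat)" by (rule eq_matI) auto
    then have yt0: "transpose_mat y ^\<^sub>m m = 0\<^sub>m m m" using transpose_pow_mat[OF y, of m] y0 by simp
    have "(\<Sum>a<m. ?v a * mv (transpose_mat y ^\<^sub>m l) ?w a) = 0" for l
    proof -
      have "(\<Sum>a<m. ?v a * mv (transpose_mat y ^\<^sub>m l) ?w a) = (\<Sum>a<m. vm ?w (y ^\<^sub>m l) a * ?v a)"
        using vm_pow_transpose[OF y, of _ ?w l] by (simp add: mult.commute)
      also have "\<dots> = 0" using orth[of l] sum_mv_eq_sum_vm[OF pow_carrier_mat[OF y], of ?w l ?v] by simp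
      finally show ?thesis .
    qed
    moreover have "mv (transpose_mat y ^\<^sub>m m) ?w a = 0" if "a < m" for a
      unfolding yt0 using mv_zero_mat[OF that] .
    ultimately have "?v a = 0" if "a < m" for a
      using nilpotent_chain_functional[OF yt _ nz, of ?v a] that by blast
    with neither show False by blast
  qed
  have xnil: "x ^\<^sub>m Suc m = 0\<^sub>m (Suc m) (Suc m)"
  proof (rule nilpotent_pow_dim[OF x])
    have big: "y ^\<^sub>m k = 0\<^sub>m m m" if "m \<le> k" for k using pow_eq_zero_mono[OF y y0 that] .
    have mv0: "mv (y ^\<^sub>m k) ?v a = 0" "vm ?w (y ^\<^sub>m k) a = 0" if "m \<le> k" "a < m" for k a
      using big[OF that(1)] that(2) by (auto simp: mv_def vm_def)
    \<comment> \<open>In x^(2m+1) every correction term contains y^p v and w y^(2m-1-p), and one of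
      these exponents is at least \<open>m\<close>; so the power vanishes entry by entry.\<close>
    note B = bordered_pow[OF x xmm orth[unfolded y_def], of "2 * m" "2 * m", folded y_def]
    have "(case 2 * m of 0 \<Rightarrow> 0 | Suc l \<Rightarrow> (\<Sum>a<m. ?w a * mv (y ^\<^sub>m l) ?v a)) = 0"
      using orth by (simp split: nat.split)
    moreover have "(\<Sum>p<2 * m. mv (y ^\<^sub>m p) ?v a * vm ?w (y ^\<^sub>m (2 * m - 1 - p)) b) = 0" if "a < m" "b < m" for a b
    proof (rule sum.neutral, intro ballI)
      fix p assume "p \<in> {..<2 * m}"
      then have "m \<le> p \<or> m \<le> 2 * m - 1 - p" by auto
      then show "mv (y ^\<^sub>m p) ?v a * vm ?w (y ^\<^sub>m (2 * m - 1 - p)) b = 0" using mv0 that by auto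
    qed
    moreover have "y ^\<^sub>m Suc (2 * m) = 0\<^sub>m m m" by (rule big) simp
    ultimately have "(x ^\<^sub>m Suc (2 * m)) $$ (a,b) = 0" if "a < Suc m" "b < Suc m" for a b
      using B mv0[of "2 * m"] that by (auto simp: less_Suc_eq simp del: pow_mat.simps)
    then show "x ^\<^sub>m Suc (2 * m) = 0\<^sub>m (Suc m) (Suc m)"
      using x by (intro eq_matI) (auto simp del: pow_mat.simps)
  qed
  \<comment> \<open>\<open>Z\<close> is y^(m-1) with a zero border. Both x Z and Z x vanish: inside
    the corner because y^m = 0, on the border by \<open>wy\<close> and \<open>yv\<close>.\<close>
  define Z where "Z = mat (Suc m) (Suc m) (\<lambda>(a,b). if a < m \<and> b < m then (y ^\<^sub>m (m - 1)) $$ (a,b) else 0)"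
  have Z: "Z \<in> carrier_mat (Suc m) (Suc m)" by (simp add: Z_def)
  have ym: "y * y ^\<^sub>m (m - 1) = 0\<^sub>m m m" "y ^\<^sub>m (m - 1) * y = 0\<^sub>m m m"
    using pow_add_mat[OF y, of 1 "m - 1"] pow_add_mat[OF y, of "m - 1" 1] y0 y m by auto
  have xZ: "(x * Z) $$ (a,b) = 0" if "a < Suc m" "b < Suc m" for a b
  proof -
    have "(x * Z) $$ (a,b) = (if b < m then \<Sum>c<m. x $$ (a,c) * (y ^\<^sub>m (m - 1)) $$ (c,b) else 0)"
      using mult_entry[OF x Z that] that by (simp add: Z_def)
    also have "\<dots> = 0"
    proof (cases "b < m")
      case b: True
      show ?thesis
      proof (cases "a < m")
        case True
        then have "(\<Sum>c<m. x $$ (a,c) * (y ^\<^sub>m (m - 1)) $$ (c,b)) = (y * y ^\<^sub>m (m - 1)) $$ (a,b)"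
          using mult_entry[OF y pow_carrier_mat[OF y] True b] by (simp add: y_def)
        then show ?thesis using ym True b by simp
      next
        case False
        then have "a = m" using that by simp
        then show ?thesis using wy[OF b] y by (simp add: vm_def)
      qed
    qed simp
    finally show ?thesis .
  qed
  have Zx: "(Z * x) $$ (a,b) = 0" if "a < Suc m" "b < Suc m" for a b
  proof -
    have "(Z * x) $$ (a,b) = (if a < m then \<Sum>c<m. (y ^\<^sub>m (m - 1)) $$ (a,c) * x $$ (c,b) else 0)"
      using mult_entry[OF Z x that] that by (simp add: Z_def)
    also have "\<dots> = 0"
    proof (cases "a < m")
      case a: True
      show ?thesis
      proof (cases "b < m")
        case True
        then have "(\<Sum>c<m. (y ^\<^sub>m (m - 1)) $$ (a,c) * x $$ (c,b)) = (y ^\<^sub>m (m - 1) * y) $$ (a,b)"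
          using mult_entry[OF pow_carrier_mat[OF y] y a True] by (simp add: y_def)
        then show ?thesis using ym True a by simp
      next
        case False
        then have "b = m" using that by simp
        then show ?thesis using yv[OF a] unfolding mv_def pow_mat_dim_square(2)[OF y] by simp
      qed
    qed simp
    finally show ?thesis .
  qed
  have "x * Z = Z * x" using xZ Zx x Z by (intro eq_matI) (auto simp del: index_mult_mat(1))
  moreover have "x ^\<^sub>m (Suc m - 1) \<noteq> 0\<^sub>m (Suc m) (Suc m)" using corner_indep_top[OF indep _ x] by simp
  ultimately obtain c where c: "\<forall>a<Suc m. \<forall>b<Suc m. Z $$ (a,b) = (\<Sum>k<Suc m. c k * (x ^\<^sub>m k) $$ (a,b))"
    using commuting_polynomial[OF x xnil _ Z] by blast
  \<comment> \<open>\<open>Z\<close> is at once a polynomial in \<open>x\<close> and the power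
    \<open>m - 1\<close> of the corner of size \<open>m\<close>. Their difference is a relation
    among corner powers whose coefficient at (m, m-1) is -1.\<close>
  define d where "d i j = (if i = Suc m then c j else if i = m \<and> j = m - 1 then -1 else 0)" for i j
  have "d m (m - 1) = 0"
  proof (rule corner_indepD[OF indep, of d])
    fix a b assume ab: "a < Suc m" "b < Suc m"
    let ?F = "\<lambda>i. \<Sum>j<i. d i j * (corner i x ^\<^sub>m j) $$ (a,b)"
    have "\<not> Suc m < Suc (max a b)" using ab by simp
    then have "(\<Sum>i\<in>{Suc (max a b)..Suc m}. ?F i) = (\<Sum>i\<in>{Suc (max a b)..m}. ?F i) + ?F (Suc m)"
      by (simp only: sum.cl_ivl_Suc if_False)
    also have "?F (Suc m) = Z $$ (a,b)" using c ab by (simp add: d_def corner_self[OF x])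
    also have "(\<Sum>i\<in>{Suc (max a b)..m}. ?F i) = (\<Sum>i\<in>{Suc (max a b)..m}. if i = m then - (y ^\<^sub>m (m - 1)) $$ (a,b) else 0)"
    proof (rule sum.cong[OF refl])
      fix i assume i: "i \<in> {Suc (max a b)..m}"
      show "?F i = (if i = m then - (y ^\<^sub>m (m - 1)) $$ (a,b) else 0)"
      proof (cases "i = m")
        case True
        have "?F i = (\<Sum>j<m. if j = m - 1 then - (y ^\<^sub>m (m - 1)) $$ (a,b) else 0)"
          using True by (intro sum.cong) (auto simp: d_def y_def)
        then show ?thesis using True m by simp
      next
        case False
        then show ?thesis using i by (simp add: d_def)
      qed
    qed
    also have "\<dots> = - Z $$ (a,b)" using ab by (auto simp: Z_def)
    finally show "(\<Sum>i\<in>{Suc (max a b)..Suc m}. ?F i) = 0" by simp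
  qed (use m in auto)
  then show False by (simp add: d_def)
qed

lemma corner_indep_imp_strict_tri:
  assumes "N \<ge> 1" "x \<in> carrier_mat N N" "corner_indep N x"
    and "\<And>i k. 1 \<le> k \<Longrightarrow> k \<le> i \<Longrightarrow> i \<le> N \<Longrightarrow> mtrace (corner i x ^\<^sub>m k) = 0"
  shows "\<exists>s. x \<in> strict_tri (sgn_ord s) N"
  using assms
proof (induction N arbitrary: x rule: nat_induct_at_least)
  case base
  have "mtrace (corner 1 x ^\<^sub>m 1) = 0" by (rule base) auto
  then have "x $$ (0,0) = 0" using base(1) by (simp add: corner_self mtrace_def)
  then show ?case using base(1) by (auto simp: strict_tri_def)
next
  case (Suc m)
  note x = Suc.prems(1)
  let ?y = "corner m x"
  have yi: "corner_indep m ?y" by (rule corner_indep_corner[OF Suc.prems(2)])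
  obtain s where s: "?y \<in> strict_tri (sgn_ord s) m"
  proof (atomize_elim, rule Suc.IH[OF _ yi])
    show "mtrace (corner i ?y ^\<^sub>m k) = 0" if "1 \<le> k" "k \<le> i" "i \<le> m" for i k
      using Suc.prems(3)[of k i] that by (simp add: corner_corner)
  qed simp
  have xtr: "mtrace (x ^\<^sub>m k) = 0" if "1 \<le> k" "k \<le> Suc m" for k
    using Suc.prems(3)[of k "Suc m"] that by (simp add: corner_self[OF x])
  have "mtrace x = mtrace ?y + x $$ (m,m)" using x by (simp add: mtrace_def)
  moreover have "mtrace x = 0" "mtrace ?y = 0"
    using xtr[of 1] strict_tri_trace_pow[OF s, of 1] x by auto
  ultimately have xmm: "x $$ (m,m) = 0" by simp
  have y0: "?y ^\<^sub>m m = 0\<^sub>m m m" by (rule strict_tri_nilpotent[OF s])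
  have "(\<forall>a<m. x $$ (m,a) = 0) \<or> (\<forall>a<m. x $$ (a,m) = 0)"
    using bordered_orthogonal[OF x xmm y0 strict_tri_trace_pow[OF s] xtr]
      corner_indep_top[OF yi Suc.hyps] Suc.prems(2)
    by (intro border_row_or_column_zero[OF x Suc.hyps xmm y0]) auto
  \<comment> \<open>The sign at \<open>m\<close> records which half of the border is zero. Signs of
    smaller indices are kept, so the corner remains strictly triangular for the new order.\<close>
  moreover define s' where "s' = s(m := (\<forall>a<m. x $$ (m,a) = 0))"
  ultimately have "\<forall>a<m. if s' m then x $$ (m,a) = 0 else x $$ (a,m) = 0" by auto
  moreover have "?y \<in> strict_tri (sgn_ord s') m"
    using s unfolding strict_tri_def sgn_ord_def s'_def by auto
  ultimately have "x \<in> strict_tri (sgn_ord s') (Suc m)" using xmm strict_tri_sgn_Suc[OF x] by blast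
  then show ?case by blast
qed

section \<open>Differentials of the trace functions\<close>

lemma mtrace_mult:
  assumes "A \<in> carrier_mat m m" "B \<in> carrier_mat m m"
  shows "mtrace (A * B) = (\<Sum>a<m. \<Sum>b<m. A $$ (a,b) * B $$ (b,a))"
  unfolding mtrace_def using assms by (auto simp: mult_entry simp del: index_mult_mat(1))

lemma mtrace_mult_comm:
  assumes "A \<in> carrier_mat m m" "B \<in> carrier_mat m m"
  shows "mtrace (A * B) = mtrace (B * A)"
  unfolding mtrace_mult[OF assms] mtrace_mult[OF assms(2,1)] by (subst sum.swap) (simp add: mult.commute)

lemma mtrace_add:
  assumes "A \<in> carrier_mat m m" "B \<in> carrier_mat m m"
  shows "mtrace (A + B) = mtrace A + mtrace B"
  using assms by (simp add: mtrace_def sum.distrib)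

text \<open>The derivative of X^j in the direction Y, that is, the sum of X^p Y X^(j-1-p) over p <
  j, in the recursive form given by the product rule.\<close>

primrec pow_deriv :: "complex mat \<Rightarrow> complex mat \<Rightarrow> nat \<Rightarrow> complex mat" where
  "pow_deriv X Y 0 = 0\<^sub>m (dim_row X) (dim_row X)"
| "pow_deriv X Y (Suc j) = pow_deriv X Y j * X + X ^\<^sub>m j * Y"

lemma pow_deriv_carrier [simp]:
  assumes "X \<in> carrier_mat m m" "Y \<in> carrier_mat m m"
  shows "pow_deriv X Y j \<in> carrier_mat m m"
  using assms by (cases j) (auto intro!: add_carrier_mat)

lemma has_field_derivative_pow_mat:
  assumes X: "X \<in> carrier_mat m m" and Y: "Y \<in> carrier_mat m m" and "a < m" "b < m"
  shows "((\<lambda>t. ((X + t \<cdot>\<^sub>m Y) ^\<^sub>m j) $$ (a,b)) has_field_derivative pow_deriv X Y j $$ (a,b)) (at 0)"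
  using \<open>b < m\<close>
proof (induction j arbitrary: b)
  case 0
  then show ?case using X Y \<open>a < m\<close> by simp
next
  case (Suc j)
  have XY: "X + t \<cdot>\<^sub>m Y \<in> carrier_mat m m" for t using X Y by simp
  have "X + 0 \<cdot>\<^sub>m Y = X" using X Y by (intro eq_matI) auto
  then have at0: "((X + 0 \<cdot>\<^sub>m Y) ^\<^sub>m j) $$ (a,c) = (X ^\<^sub>m j) $$ (a,c)" for c by simp
  have "((X + t \<cdot>\<^sub>m Y) ^\<^sub>m Suc j) $$ (a,b)
      = (\<Sum>c<m. ((X + t \<cdot>\<^sub>m Y) ^\<^sub>m j) $$ (a,c) * (X $$ (c,b) + t * Y $$ (c,b)))" for t
    using mult_entry[OF pow_carrier_mat[OF XY, of t j] XY \<open>a < m\<close> Suc.prems] X Y Suc.prems by simp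
  moreover have "pow_deriv X Y (Suc j) $$ (a,b)
      = (\<Sum>c<m. pow_deriv X Y j $$ (a,c) * X $$ (c,b) + Y $$ (c,b) * (X ^\<^sub>m j) $$ (a,c))"
    using mult_entry[of "pow_deriv X Y j" m X a b] mult_entry[of "X ^\<^sub>m j" m Y a b] X Y \<open>a < m\<close> Suc.prems
    by (simp add: sum.distrib mult.commute del: index_mult_mat(1))
  moreover have "((\<lambda>t. \<Sum>c<m. ((X + t \<cdot>\<^sub>m Y) ^\<^sub>m j) $$ (a,c) * (X $$ (c,b) + t * Y $$ (c,b)))
      has_field_derivative (\<Sum>c<m. pow_deriv X Y j $$ (a,c) * X $$ (c,b) + Y $$ (c,b) * (X ^\<^sub>m j) $$ (a,c))) (at 0)"
  proof (rule DERIV_sum)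
    fix c assume "c \<in> {..<m}"
    then have 1: "((\<lambda>t. ((X + t \<cdot>\<^sub>m Y) ^\<^sub>m j) $$ (a,c)) has_field_derivative pow_deriv X Y j $$ (a,c)) (at 0)"
      using Suc.IH by simp
    have 2: "((\<lambda>t. X $$ (c,b) + t * Y $$ (c,b)) has_field_derivative Y $$ (c,b)) (at 0)"
      by (auto intro!: derivative_eq_intros)
    show "((\<lambda>t. ((X + t \<cdot>\<^sub>m Y) ^\<^sub>m j) $$ (a,c) * (X $$ (c,b) + t * Y $$ (c,b)))
      has_field_derivative pow_deriv X Y j $$ (a,c) * X $$ (c,b) + Y $$ (c,b) * (X ^\<^sub>m j) $$ (a,c)) (at 0)"
      using DERIV_mult'[OF 1 2] at0[of c] by (simp add: algebra_simps)
  qed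
  ultimately show ?case by simp
qed

text \<open>The factor X^k makes the induction work, since unfolding the derivative moves one X into
  it; cyclicity of the trace then collects the powers. For \<open>j = 0\<close> the possibly
  truncated exponent comes with the coefficient 0.\<close>

lemma mtrace_pow_deriv:
  assumes X: "X \<in> carrier_mat m m" and Y: "Y \<in> carrier_mat m m"
  shows "mtrace (pow_deriv X Y j * X ^\<^sub>m k) = of_nat j * mtrace (X ^\<^sub>m (j + k - 1) * Y)"
proof (induction j arbitrary: k)
  case 0
  have "0\<^sub>m m m * X ^\<^sub>m k = 0\<^sub>m m m" using X by (intro left_mult_zero_mat pow_carrier_mat)
  then show ?case using X by (simp add: mtrace_def)
next
  case (Suc j)
  note c = pow_carrier_mat[OF X] pow_deriv_carrier[OF X Y]
  have "pow_deriv X Y (Suc j) * X ^\<^sub>m k = pow_deriv X Y j * X * X ^\<^sub>m k + X ^\<^sub>m j * Y * X ^\<^sub>m k"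
    unfolding pow_deriv.simps by (rule add_mult_distrib_mat[of _ m m _ _ m])
      (use X Y in \<open>auto intro!: mult_carrier_mat[of _ m m] pow_deriv_carrier\<close>)
  moreover have "pow_deriv X Y j * X * X ^\<^sub>m k = pow_deriv X Y j * X ^\<^sub>m Suc k"
    using pow_add_mat[OF X, of 1 k] c X by (simp add: assoc_mult_mat[of _ m m _ m _ m])
  moreover have "mtrace (X ^\<^sub>m j * Y * X ^\<^sub>m k) = mtrace (X ^\<^sub>m (k + j) * Y)"
    using mtrace_mult_comm[OF mult_carrier_mat[OF c(1) Y, of j] c(1), of k] c X Y pow_add_mat[OF X, of k j]
    by (simp add: assoc_mult_mat[of _ m m _ m _ m])
  moreover have "mtrace (pow_deriv X Y j * X * X ^\<^sub>m k + X ^\<^sub>m j * Y * X ^\<^sub>m k)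
      = mtrace (pow_deriv X Y j * X * X ^\<^sub>m k) + mtrace (X ^\<^sub>m j * Y * X ^\<^sub>m k)"
    by (rule mtrace_add[of _ m]; intro mult_carrier_mat[of _ m m] c X Y)
  ultimately show ?case using Suc.IH[of "Suc k"] by (simp add: algebra_simps)
qed

lemma dfij_eq:
  assumes x: "x \<in> carrier_mat N N" and y: "y \<in> carrier_mat N N" and i: "i \<le> N"
  shows "dfij i (Suc j) x y = of_nat (Suc j) * mtrace (corner i x ^\<^sub>m j * corner i y)"
proof -
  let ?X = "corner i x" and ?Y = "corner i y"
  have "corner i (x + t \<cdot>\<^sub>m y) = ?X + t \<cdot>\<^sub>m ?Y" for t
    using x y i by (intro eq_matI) (auto simp: corner_def)
  then have "(\<lambda>t. fij i (Suc j) (x + t \<cdot>\<^sub>m y)) = (\<lambda>t. \<Sum>a<i. ((?X + t \<cdot>\<^sub>m ?Y) ^\<^sub>m Suc j) $$ (a,a))"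
    unfolding fij_def mtrace_def by (simp del: pow_mat.simps)
  moreover have "((\<lambda>t. \<Sum>a<i. ((?X + t \<cdot>\<^sub>m ?Y) ^\<^sub>m Suc j) $$ (a,a))
      has_field_derivative (\<Sum>a<i. pow_deriv ?X ?Y (Suc j) $$ (a,a))) (at 0)"
    by (intro DERIV_sum has_field_derivative_pow_mat) auto
  ultimately have "dfij i (Suc j) x y = (\<Sum>a<i. pow_deriv ?X ?Y (Suc j) $$ (a,a))"
    unfolding dfij_def by (simp add: DERIV_imp_deriv)
  also have "\<dots> = mtrace (pow_deriv ?X ?Y (Suc j) * ?X ^\<^sub>m 0)"
  proof -
    have c: "pow_deriv ?X ?Y (Suc j) \<in> carrier_mat i i" by (rule pow_deriv_carrier) auto
    then have "pow_deriv ?X ?Y (Suc j) * ?X ^\<^sub>m 0 = pow_deriv ?X ?Y (Suc j)"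
      using right_mult_one_mat[OF c] by simp
    with c show ?thesis unfolding mtrace_def by simp
  qed
  also have "\<dots> = of_nat (Suc j) * mtrace (?X ^\<^sub>m j * ?Y)"
    using mtrace_pow_deriv[of ?X i ?Y "Suc j" 0] by simp
  finally show ?thesis .
qed

lemma GZidx_Sigma: "GZidx N = (SIGMA i:{1..N}. {1..i})"
  unfolding GZidx_def by auto

text \<open>Regrouping by the entries of \<open>y\<close> turns a combination of differentials into
  the combination of corner powers in \<open>corner_indep\<close>. The trace pairing transposes the
  indices, and differentiation scales the coefficients by the exponent.\<close>

lemma sum_dfij:
  assumes x: "x \<in> carrier_mat N N" and y: "y \<in> carrier_mat N N"
  shows "(\<Sum>p\<in>GZidx N. c p * dfij (fst p) (snd p) x y) =
    (\<Sum>a<N. \<Sum>b<N. y $$ (b,a) *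
      (\<Sum>i\<in>{Suc (max a b)..N}. \<Sum>j<i. c (i, Suc j) * of_nat (Suc j) * (corner i x ^\<^sub>m j) $$ (a,b)))"
proof -
  let ?d = "\<lambda>i j. c (i, Suc j) * of_nat (Suc j)"
  let ?e = "\<lambda>i a b. \<Sum>j<i. ?d i j * (corner i x ^\<^sub>m j) $$ (a,b)"
  have "(\<Sum>p\<in>GZidx N. c p * dfij (fst p) (snd p) x y) = (\<Sum>i\<in>{1..N}. \<Sum>j\<in>{1..i}. c (i,j) * dfij i j x y)"
    unfolding GZidx_Sigma by (subst sum.Sigma) (auto simp: split_def)
  also have "\<dots> = (\<Sum>i\<in>{1..N}. \<Sum>j<i. c (i, Suc j) * dfij i (Suc j) x y)"
    by (simp add: sum.atLeast1_atMost_eq)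
  also have "\<dots> = (\<Sum>i\<in>{1..N}. \<Sum>a<N. \<Sum>b<N. if a < i \<and> b < i then y $$ (b,a) * ?e i a b else 0)"
  proof (rule sum.cong[OF refl])
    fix i assume i: "i \<in> {1..N}"
    have "(\<Sum>j<i. c (i, Suc j) * dfij i (Suc j) x y)
        = (\<Sum>j<i. \<Sum>a<i. \<Sum>b<i. y $$ (b,a) * (?d i j * (corner i x ^\<^sub>m j) $$ (a,b)))"
    proof (rule sum.cong[OF refl])
      fix j
      have "mtrace (corner i x ^\<^sub>m j * corner i y) = (\<Sum>a<i. \<Sum>b<i. (corner i x ^\<^sub>m j) $$ (a,b) * y $$ (b,a))"
        by (subst mtrace_mult[of _ i]) auto
      then have "c (i, Suc j) * dfij i (Suc j) x y = ?d i j * (\<Sum>a<i. \<Sum>b<i. (corner i x ^\<^sub>m j) $$ (a,b) * y $$ (b,a))"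
        using dfij_eq[OF x y, of i j] i by simp
      then show "c (i, Suc j) * dfij i (Suc j) x y = (\<Sum>a<i. \<Sum>b<i. y $$ (b,a) * (?d i j * (corner i x ^\<^sub>m j) $$ (a,b)))"
        unfolding sum_distrib_left by (simp only: mult.assoc mult.commute mult.left_commute)
    qed
    also have "\<dots> = (\<Sum>a<i. \<Sum>b<i. y $$ (b,a) * ?e i a b)"
      unfolding sum_distrib_left by (subst sum.swap, rule sum.cong[OF refl], subst sum.swap) simp
    also have "\<dots> = (\<Sum>a<N. \<Sum>b<i. if a < i then y $$ (b,a) * ?e i a b else 0)"
      using i by (intro sum.mono_neutral_cong_left) auto
    also have "\<dots> = (\<Sum>a<N. \<Sum>b<N. if a < i \<and> b < i then y $$ (b,a) * ?e i a b else 0)"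
      using i by (intro sum.cong[OF refl] sum.mono_neutral_cong_left) auto
    finally show "(\<Sum>j<i. c (i, Suc j) * dfij i (Suc j) x y)
      = (\<Sum>a<N. \<Sum>b<N. if a < i \<and> b < i then y $$ (b,a) * ?e i a b else 0)" .
  qed
  also have "\<dots> = (\<Sum>a<N. \<Sum>b<N. \<Sum>i\<in>{1..N}. if a < i \<and> b < i then y $$ (b,a) * ?e i a b else 0)"
    by (subst sum.swap, rule sum.cong[OF refl], rule sum.swap)
  also have "\<dots> = (\<Sum>a<N. \<Sum>b<N. \<Sum>i\<in>{Suc (max a b)..N}. y $$ (b,a) * ?e i a b)"
    by (intro sum.cong[OF refl] sum.mono_neutral_cong_right) auto
  finally show ?thesis by (simp only: sum_distrib_left)
qed

lemma strongly_regular_iff: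
  "strongly_regular N x \<longleftrightarrow> x \<in> carrier_mat N N \<and> corner_indep N x"
proof (cases "x \<in> carrier_mat N N")
  case x: True
  let ?R = "\<lambda>d a b. \<Sum>i\<in>{Suc (max a b)..N}. \<Sum>j<i. d i j * (corner i x ^\<^sub>m j) $$ (a,b)"
  have rel: "(\<forall>y\<in>carrier_mat N N. (\<Sum>p\<in>GZidx N. c p * dfij (fst p) (snd p) x y) = 0)
      \<longleftrightarrow> (\<forall>a<N. \<forall>b<N. ?R (\<lambda>i j. c (i, Suc j) * of_nat (Suc j)) a b = 0)" for c
  proof (intro iffI ballI allI impI)
    fix a b assume ab: "a < N" "b < N"
      and 0: "\<forall>y\<in>carrier_mat N N. (\<Sum>p\<in>GZidx N. c p * dfij (fst p) (snd p) x y) = 0"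
    let ?S = "?R (\<lambda>i j. c (i, Suc j) * of_nat (Suc j))"
    \<comment> \<open>The matrix unit E_ba picks out the coefficient at (a,b).\<close>
    have "0 = (\<Sum>a'<N. \<Sum>b'<N. eu N b a $$ (b',a') * ?S a' b')"
      using 0 sum_dfij[OF x, of "eu N b a" c] by simp
    also have "\<dots> = (\<Sum>a'<N. if a' = a then ?S a b else 0)"
    proof (rule sum.cong[OF refl])
      fix a' assume "a' \<in> {..<N}"
      then have "(\<Sum>b'<N. eu N b a $$ (b',a') * ?S a' b') = (\<Sum>b'<N. if b' = b then (if a' = a then ?S a b else 0) else 0)"
        by (intro sum.cong) auto
      then show "(\<Sum>b'<N. eu N b a $$ (b',a') * ?S a' b') = (if a' = a then ?S a b else 0)"
        using ab by simp
    qed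
    finally show "?S a b = 0" using ab by simp
  qed (simp add: sum_dfij[OF x] del: of_nat_Suc)
  show ?thesis
  proof
    assume sr: "strongly_regular N x"
    have "corner_indep N x" unfolding corner_indep_def
    proof (intro allI impI ballI)
      fix d i j assume d: "\<forall>a<N. \<forall>b<N. ?R d a b = 0" and ij: "i \<in> {1..N}" "j < i"
      \<comment> \<open>Dividing by the exponent, which is nonzero in characteristic 0, undoes the
        factor from differentiation.\<close>
      define c where "c p = d (fst p) (snd p - 1) / of_nat (snd p)" for p
      have cd: "c (i, Suc j) * of_nat (Suc j) = d i j" for i j by (simp add: c_def del: of_nat_Suc)
      have "\<forall>p\<in>GZidx N. c p = 0" using sr d rel[of c] unfolding strongly_regular_def cd by blast
      moreover have "(i, Suc j) \<in> GZidx N" using ij by (auto simp: GZidx_def)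
      ultimately show "d i j = 0" using cd[of i j] by simp
    qed
    with x show "x \<in> carrier_mat N N \<and> corner_indep N x" by simp
  next
    assume ci: "x \<in> carrier_mat N N \<and> corner_indep N x"
    show "strongly_regular N x" unfolding strongly_regular_def
    proof (intro conjI allI impI ballI)
      fix c p
      assume 0: "\<forall>y\<in>carrier_mat N N. (\<Sum>p\<in>GZidx N. c p * dfij (fst p) (snd p) x y) = 0"
        and "p \<in> GZidx N"
      then obtain i j where p: "p = (i, Suc j)" "1 \<le> i" "i \<le> N" "j < i"
        unfolding GZidx_def by (cases p, cases "snd p") auto
      have "c (i, Suc j) * of_nat (Suc j) = 0"
        using corner_indepD[of N x "\<lambda>i j. c (i, Suc j) * of_nat (Suc j)" i j] ci 0 rel[of c] p by blast
      then show "c p = 0" using p by (simp del: of_nat_Suc)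
    qed (use x in simp)
  qed
qed (simp add: strongly_regular_def)

lemma PhiZeroSreg_iff:
  "x \<in> PhiZeroSreg n \<longleftrightarrow> (\<exists>s. x \<in> strict_tri (sgn_ord s) (n+1) \<and> x ^\<^sub>m n \<noteq> 0\<^sub>m (n+1) (n+1))"
proof
  assume x: "x \<in> PhiZeroSreg n"
  then have xc: "x \<in> carrier_mat (n+1) (n+1)" and ci: "corner_indep (n+1) x"
    unfolding PhiZeroSreg_def strongly_regular_iff by auto
  have tr: "fij i k x = 0" if "1 \<le> k" "k \<le> i" "i \<le> n+1" for i k
    using x that unfolding PhiZeroSreg_def GZidx_def by auto
  have "\<exists>s. x \<in> strict_tri (sgn_ord s) (n+1)"
    using tr unfolding fij_def by (intro corner_indep_imp_strict_tri xc ci) auto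
  with corner_indep_top[OF ci _ xc] show "\<exists>s. x \<in> strict_tri (sgn_ord s) (n+1) \<and> x ^\<^sub>m n \<noteq> 0\<^sub>m (n+1) (n+1)"
    by simp
next
  assume "\<exists>s. x \<in> strict_tri (sgn_ord s) (n+1) \<and> x ^\<^sub>m n \<noteq> 0\<^sub>m (n+1) (n+1)"
  then obtain s where s: "x \<in> strict_tri (sgn_ord s) (n+1)" "x ^\<^sub>m n \<noteq> 0\<^sub>m (n+1) (n+1)" by blast
  have xc: "x \<in> carrier_mat (n+1) (n+1)" using s by (simp add: strict_tri_def)
  have "fij i k x = 0" if "1 \<le> k" "k \<le> i" "i \<le> n+1" for i k
  proof -
    have "corner i x \<in> strict_tri (sgn_ord s) i" using s(1) that by (auto simp: strict_tri_def)
    then show ?thesis unfolding fij_def using that by (intro strict_tri_trace_pow)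
  qed
  moreover have "corner_indep (n+1) x" using s by (intro strict_tri_corner_indep) auto
  ultimately show "x \<in> PhiZeroSreg n" unfolding PhiZeroSreg_def strongly_regular_iff GZidx_def using xc by auto
qed

section \<open>Regular elements of the nilradical\<close>

text \<open>The position of \<open>a\<close> in the order. The values of \<open>p\<close> may leave
  gaps, as those of \<open>sgn_ord\<close> do, whereas neighbours and permutations call for the
  consecutive positions 0, ..., m-1.\<close>

definition ord_rank :: "(nat \<Rightarrow> int) \<Rightarrow> nat \<Rightarrow> nat \<Rightarrow> nat" where
  "ord_rank p m a = card {b. b < m \<and> p b < p a}"

lemma ord_rank_mono:
  assumes "a < m" "p a < p b"
  shows "ord_rank p m a < ord_rank p m b"
  unfolding ord_rank_def using assms by (intro psubset_card_mono) auto

lemma ord_rank_less_iff: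
  assumes "inj_on p {..<m}" "a < m" "b < m"
  shows "ord_rank p m a < ord_rank p m b \<longleftrightarrow> p a < p b"
proof
  assume *: "ord_rank p m a < ord_rank p m b"
  show "p a < p b"
  proof (rule ccontr)
    assume "\<not> p a < p b"
    then have "a = b \<or> p b < p a" using assms by (metis inj_onD lessThan_iff linorder_neqE)
    then show False using * ord_rank_mono[of b m p a] assms by auto
  qed
qed (use ord_rank_mono assms in blast)

lemma ord_rank_bij:
  assumes "inj_on p {..<m}"
  shows "bij_betw (ord_rank p m) {..<m} {..<m}"
proof -
  have "inj_on (ord_rank p m) {..<m}"
  proof (rule inj_onI)
    fix a b assume ab: "a \<in> {..<m}" "b \<in> {..<m}" "ord_rank p m a = ord_rank p m b"
    then have "p a = p b" using ord_rank_mono[of a m p b] ord_rank_mono[of b m p a] by force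
    then show "a = b" using assms ab by (auto dest: inj_onD)
  qed
  moreover have "ord_rank p m ` {..<m} \<subseteq> {..<m}"
  proof
    fix k assume "k \<in> ord_rank p m ` {..<m}"
    then obtain a where a: "a < m" "k = ord_rank p m a" by auto
    have "card {b. b < m \<and> p b < p a} < card {..<m}" using a by (intro psubset_card_mono) auto
    then show "k \<in> {..<m}" using a by (simp add: ord_rank_def)
  qed
  ultimately show ?thesis using endo_inj_surj[of "{..<m}" "ord_rank p m"] by (simp only: bij_betw_def finite_lessThan)
qed

lemma tri_cong:
  assumes "\<And>a b. a < m \<Longrightarrow> b < m \<Longrightarrow> q a < q b \<longleftrightarrow> p a < p b"
  shows "tri q m = tri p m"
  unfolding tri_def by (intro Collect_cong) (use assms in blast)

lemma strict_tri_cong: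
  assumes "\<And>a b. a < m \<Longrightarrow> b < m \<Longrightarrow> q a < q b \<longleftrightarrow> p a < p b"
  shows "strict_tri q m = strict_tri p m"
proof -
  have "q b \<le> q a \<longleftrightarrow> p b \<le> p a" if "a < m" "b < m" for a b using assms[OF that] by linarith
  then show ?thesis unfolding strict_tri_def by (intro Collect_cong) blast
qed

lemma strict_tri_ord_rank: "inj_on p {..<m} \<Longrightarrow> strict_tri (\<lambda>a. int (ord_rank p m a)) m = strict_tri p m"
  by (rule strict_tri_cong) (simp add: ord_rank_less_iff)

text \<open>Neighbours in the order: the simple roots of the Borel subalgebra
  \<open>tri p m\<close>.\<close>

definition simple_pairs :: "(nat \<Rightarrow> int) \<Rightarrow> nat \<Rightarrow> (nat \<times> nat) set" where
  "simple_pairs p m = {(a,b). a < m \<and> b < m \<and> ord_rank p m b = Suc (ord_rank p m a)}"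

text \<open>An entry of x^k that joins two positions at distance k comes from a single path, the one
  through all positions in between, and is thus a product of simple entries. For k = m-1 the path
  runs from the first position to the last.\<close>

lemma simple_nonzero_pow:
  assumes p: "inj_on p {..<m}" and m: "m \<ge> 1" and x: "x \<in> strict_tri p m"
    and nz: "\<And>a b. (a,b) \<in> simple_pairs p m \<Longrightarrow> x $$ (a,b) \<noteq> 0"
  shows "x ^\<^sub>m (m - 1) \<noteq> 0\<^sub>m m m"
proof -
  let ?r = "ord_rank p m"
  let ?q = "\<lambda>a. int (?r a)"
  have xq: "x \<in> strict_tri ?q m" using x strict_tri_ord_rank[OF p] by simp
  have xc: "x \<in> carrier_mat m m" using x by (simp add: strict_tri_def)
  have surj: "\<exists>a<m. ?r a = k" if "k < m" for k
    using ord_rank_bij[OF p] that unfolding bij_betw_def by (metis (no_types, lifting) imageE lessThan_iff)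
  have lt: "?r a < m" if "a < m" for a using ord_rank_bij[OF p] that by (auto dest: bij_betwE)
  have inj: "a = b" if "?r a = ?r b" "a < m" "b < m" for a b
    using ord_rank_bij[OF p] that unfolding bij_betw_def by (auto dest: inj_onD)
  have "(x ^\<^sub>m k) $$ (a,b) \<noteq> 0" if "a < m" "b < m" "?r b = ?r a + k" for k a b
    using that
  proof (induction k arbitrary: b)
    case 0
    then have "a = b" using inj by simp
    then show ?case using 0 xc by simp
  next
    case (Suc k)
    obtain c where c: "c < m" "?r c = ?r a + k" using surj[of "?r a + k"] Suc.prems lt[of b] by auto
    have "(x ^\<^sub>m Suc k) $$ (a,b) = (\<Sum>d<m. (x ^\<^sub>m k) $$ (a,d) * x $$ (d,b))"
      using mult_entry[OF pow_carrier_mat[OF xc] xc] Suc.prems by simp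
    also have "\<dots> = (\<Sum>d<m. if d = c then (x ^\<^sub>m k) $$ (a,c) * x $$ (c,b) else 0)"
    proof (rule sum.cong[OF refl])
      fix d assume d: "d \<in> {..<m}"
      show "(x ^\<^sub>m k) $$ (a,d) * x $$ (d,b) = (if d = c then (x ^\<^sub>m k) $$ (a,c) * x $$ (c,b) else 0)"
      proof (cases "(x ^\<^sub>m k) $$ (a,d) * x $$ (d,b) = 0")
        case False
        then have nzs: "(x ^\<^sub>m k) $$ (a,d) \<noteq> 0" "x $$ (d,b) \<noteq> 0" and dm: "d < m" using d by auto
        then have "?q a + int k \<le> ?q d"
          using pow_in_gap_tri[OF xq, of k] Suc.prems(1) unfolding gap_tri_def by blast
        moreover have "?q d + int 1 \<le> ?q b"
          using xq nzs dm Suc.prems(2) unfolding strict_tri_eq_gap_tri gap_tri_def by blast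
        ultimately have "?r d = ?r c" using c Suc.prems by linarith
        then have "d = c" using inj dm c(1) by blast
        then show ?thesis by simp
      qed (use c in auto)
    qed
    also have "\<dots> = (x ^\<^sub>m k) $$ (a,c) * x $$ (c,b)" using c by simp
    finally show ?case using Suc.IH[of c] Suc.prems c nz[of c b] by (auto simp: simple_pairs_def)
  qed
  moreover obtain a b where "a < m" "b < m" "?r a = 0" "?r b = m - 1"
    using surj[of 0] surj[of "m - 1"] m by auto
  ultimately have "(x ^\<^sub>m (m - 1)) $$ (a,b) \<noteq> 0" by simp
  then show ?thesis using \<open>a < m\<close> \<open>b < m\<close> by auto
qed

lemma pow_mlin_indep:
  assumes A: "A \<in> carrier_mat m m" and nil: "A ^\<^sub>m m = 0\<^sub>m m m" and nz: "A ^\<^sub>m (m - 1) \<noteq> 0\<^sub>m m m"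
  shows "mlin_indep m m (\<lambda>k. A ^\<^sub>m k)"
  unfolding mlin_indep_def
proof (intro allI impI)
  fix c k assume c: "\<forall>a<m. \<forall>b<m. (\<Sum>k<m. c k * (A ^\<^sub>m k) $$ (a,b)) = 0" and k: "k < m"
  obtain u where u: "\<exists>a<m. mv (A ^\<^sub>m (m - 1)) u a \<noteq> 0" using pow_nonzero_vec[OF A nz] by blast
  have m: "Suc (m - 1) = m" "{..m - 1} = {..<m}" using k by auto
  show "c k = 0"
  proof (rule nilpotent_chain_indep[OF A _ u])
    show "mv (A ^\<^sub>m Suc (m - 1)) u a = 0" if "a < m" for a unfolding m nil using mv_zero_mat[OF that] .
    show "(\<Sum>k\<le>m - 1. c k * mv (A ^\<^sub>m k) u a) = 0" if "a < m" for a
    proof -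
      have "(\<Sum>k<m. c k * mv (A ^\<^sub>m k) u a) = (\<Sum>b<m. (\<Sum>k<m. c k * (A ^\<^sub>m k) $$ (a,b)) * u b)"
        unfolding mv_def pow_mat_dim_square(2)[OF A] sum_distrib_left sum_distrib_right
        by (subst sum.swap) (simp add: mult.assoc)
      also have "\<dots> = 0" using c that by simp
      finally show ?thesis unfolding m .
    qed
  qed (use k in simp)
qed

text \<open>The powers of \<open>x\<close> below \<open>m\<close> are independent and commute with
  \<open>x\<close>, and by \<open>commuting_polynomial\<close> they span the centralizer.\<close>

lemma regular_if_pow_nonzero:
  assumes x: "x \<in> carrier_mat m m" and nil: "x ^\<^sub>m m = 0\<^sub>m m m" and nz: "x ^\<^sub>m (m - 1) \<noteq> 0\<^sub>m m m"
  shows "regular m x"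
proof -
  have "mdim m (centralizer m x) = m" unfolding mdim_def
  proof (rule Greatest_equality)
    have "x ^\<^sub>m k \<in> centralizer m x" for k
      using pow_add_mat[OF x, of 1 k] x by (simp add: centralizer_def)
    then show "\<exists>As. (\<forall>k<m. As k \<in> centralizer m x) \<and> mlin_indep m m As"
      using pow_mlin_indep[OF assms] by blast
  next
    fix r assume "\<exists>As. (\<forall>k<r. As k \<in> centralizer m x) \<and> mlin_indep m r As"
    then obtain As where As: "\<And>k. k < r \<Longrightarrow> As k \<in> centralizer m x" and ind: "mlin_indep m r As" by blast
    show "r \<le> m"
    proof (rule ccontr)
      assume "\<not> r \<le> m"
      have "\<exists>c. \<forall>a<m. \<forall>b<m. As l $$ (a,b) = (\<Sum>k<m. c k * (x ^\<^sub>m k) $$ (a,b))" if "l < r" for l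
        using commuting_polynomial[OF x nil nz, of "As l"] As[OF that] by (auto simp: centralizer_def)
      then obtain C where C: "\<And>l a b. l < r \<Longrightarrow> a < m \<Longrightarrow> b < m \<Longrightarrow>
          As l $$ (a,b) = (\<Sum>k<m. C l k * (x ^\<^sub>m k) $$ (a,b))" by metis
      obtain d where d: "\<exists>l<r. d l \<noteq> 0" "\<forall>k<m. (\<Sum>l<r. C l k * d l) = 0"
        using wide_system[of m r "\<lambda>k l. C l k"] \<open>\<not> r \<le> m\<close> by auto
      have "(\<Sum>l<r. d l * As l $$ (a,b)) = 0" if "a < m" "b < m" for a b
      proof -
        have "(\<Sum>l<r. d l * As l $$ (a,b)) = (\<Sum>l<r. \<Sum>k<m. (C l k * d l) * (x ^\<^sub>m k) $$ (a,b))"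
          using C that by (simp add: sum_distrib_left ac_simps)
        also have "\<dots> = (\<Sum>k<m. (\<Sum>l<r. C l k * d l) * (x ^\<^sub>m k) $$ (a,b))"
          by (subst sum.swap) (simp add: sum_distrib_right)
        also have "\<dots> = 0" using d by simp
        finally show ?thesis .
      qed
      then show False using ind d(1) unfolding mlin_indep_def by blast
    qed
  qed
  with x show ?thesis by (simp add: regular_def)
qed

text \<open>\<open>mdim\<close> is a \<open>GREATEST\<close>, so comparing it with the size of a
  given family requires a bound on independent families; counting entries gives one.\<close>

lemma mlin_indep_bound:
  assumes "mlin_indep m r As"
  shows "r \<le> m * m"
proof (rule ccontr)
  assume "\<not> r \<le> m * m"
  then obtain d where d: "\<exists>l<r. d l \<noteq> 0" "\<forall>k<m * m. (\<Sum>l<r. As l $$ (k div m, k mod m) * d l) = 0"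
    using wide_system[of "m * m" r "\<lambda>k l. As l $$ (k div m, k mod m)"] by auto
  have "(\<Sum>l<r. d l * As l $$ (a,b)) = 0" if "a < m" "b < m" for a b
  proof -
    have "a * m + b < Suc a * m" using that by simp
    also have "\<dots> \<le> m * m" using that by (intro mult_le_mono1) simp
    finally have "a * m + b < m * m" .
    moreover have "(a * m + b) div m = a" "(a * m + b) mod m = b" using that by auto
    ultimately show ?thesis using d(2) by (metis (no_types, lifting) mult.commute sum.cong)
  qed
  then show False using assms d(1) unfolding mlin_indep_def by blast
qed

section \<open>Independent families in the common kernel of linear functionals\<close>

lemma mlin_indep_permute:
  assumes ind: "mlin_indep m r As" and bij: "bij_betw t {..<r} {..<r}"
  shows "mlin_indep m r (\<lambda>k. As (t k))"
  unfolding mlin_indep_def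
proof (intro allI impI)
  fix c k assume c: "\<forall>a<m. \<forall>b<m. (\<Sum>k<r. c k * As (t k) $$ (a,b)) = 0" and k: "k < r"
  let ?i = "inv_into {..<r} t"
  have it: "?i (t k) = k" if "k < r" for k using bij that unfolding bij_betw_def by (simp add: inv_into_f_f)
  have "(\<Sum>l<r. c (?i l) * As l $$ (a,b)) = 0" if "a < m" "b < m" for a b
  proof -
    have "(\<Sum>l<r. c (?i l) * As l $$ (a,b)) = (\<Sum>k<r. c (?i (t k)) * As (t k) $$ (a,b))"
      by (rule sum.reindex_bij_betw[OF bij, symmetric])
    also have "\<dots> = 0" using c that it by simp
    finally show ?thesis .
  qed
  moreover have "t k < r" using bij k by (auto dest: bij_betwE)
  ultimately have "c (?i (t k)) = 0"
    using ind[unfolded mlin_indep_def, rule_format, of "\<lambda>l. c (?i l)" "t k"] by blast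
  then show "c k = 0" using it[OF k] by simp
qed

lemma mlin_indep_prefix:
  assumes "mlin_indep m (Suc r) As"
  shows "mlin_indep m r As"
  unfolding mlin_indep_def
proof (intro allI impI)
  fix c k assume "\<forall>a<m. \<forall>b<m. (\<Sum>k<r. c k * As k $$ (a,b)) = 0" "k < r"
  then have "(if k < r then c k else 0) = 0"
    using assms[unfolded mlin_indep_def, rule_format, of "\<lambda>k. if k < r then c k else 0" k] by simp
  then show "c k = 0" using \<open>k < r\<close> by simp
qed

text \<open>Each functional costs at most one dimension. If it is nonzero on some member of the
  family, that member is swapped into the last place and serves as a pivot: suitable multiples of it
  are added to the others, and it is dropped.\<close>

lemma mlin_indep_kernel:
  assumes V: "msubspace m V" and lin: "\<And>l A B c. A \<in> V \<Longrightarrow> B \<in> V \<Longrightarrow> \<phi> l (A + c \<cdot>\<^sub>m B) = \<phi> l A + c * \<phi> l B"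
    and "\<forall>k<r + q. As k \<in> V" "mlin_indep m (r + q) As"
  shows "\<exists>Bs. (\<forall>k<r. Bs k \<in> V \<and> (\<forall>l<q. \<phi> l (Bs k) = (0::complex))) \<and> mlin_indep m r Bs"
  using assms(3,4)
proof (induction q arbitrary: r)
  case 0
  then show ?case by auto
next
  case (Suc q)
  obtain Bs where Bs: "\<And>k. k < Suc r \<Longrightarrow> Bs k \<in> V" "\<And>k l. k < Suc r \<Longrightarrow> l < q \<Longrightarrow> \<phi> l (Bs k) = 0"
    and ind: "mlin_indep m (Suc r) Bs" using Suc.IH[of "Suc r"] Suc.prems by auto
  show ?case
  proof (cases "\<forall>k<Suc r. \<phi> q (Bs k) = 0")
    case True
    then show ?thesis using Bs mlin_indep_prefix[OF ind] by (intro exI[of _ Bs]) (auto simp: less_Suc_eq)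
  next
    case False
    then obtain k0 where k0: "k0 < Suc r" "\<phi> q (Bs k0) \<noteq> 0" by blast
    define t where "t k = (if k = r then k0 else if k = k0 then r else k)" for k
    have tb: "bij_betw t {..<Suc r} {..<Suc r}"
      using k0 by (intro bij_betw_byWitness[of _ t]) (auto simp: t_def)
    define B where "B k = Bs (t k)" for k
    have tlt: "t k < Suc r" if "k < Suc r" for k using tb that by (auto dest: bij_betwE)
    have B: "B k \<in> V" "\<And>l. l < q \<Longrightarrow> \<phi> l (B k) = 0" if "k < Suc r" for k
      using Bs tlt[OF that] by (auto simp: B_def)
    have Bc: "B k \<in> carrier_mat m m" if "k < Suc r" for k using msubspace_carrier[OF V B(1)[OF that]] .
    have Bind: "mlin_indep m (Suc r) B" unfolding B_def by (rule mlin_indep_permute[OF ind tb])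
    have Br: "\<phi> q (B r) \<noteq> 0" using k0 by (simp add: B_def t_def)
    define e where "e k = - \<phi> q (B k) / \<phi> q (B r)" for k
    define C where "C k = B k + e k \<cdot>\<^sub>m B r" for k
    have "C k \<in> V" if "k < r" for k
      unfolding C_def using that B by (intro msubspace_add[OF V] msubspace_smult[OF V]) auto
    moreover have "\<phi> l (C k) = 0" if "k < r" "l < Suc q" for k l
    proof -
      have "\<phi> l (C k) = \<phi> l (B k) + e k * \<phi> l (B r)" unfolding C_def using that B by (intro lin) auto
      then show ?thesis using that B Br by (cases "l = q") (auto simp: e_def)
    qed
    moreover have "mlin_indep m r C" unfolding mlin_indep_def
    proof (intro allI impI)
      fix c k assume c: "\<forall>a<m. \<forall>b<m. (\<Sum>k<r. c k * C k $$ (a,b)) = 0" and k: "k < r"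
      define d where "d k = (if k = r then (\<Sum>k<r. c k * e k) else c k)" for k
      have "(\<Sum>k<Suc r. d k * B k $$ (a,b)) = 0" if "a < m" "b < m" for a b
      proof -
        have "(\<Sum>k<r. c k * C k $$ (a,b)) = (\<Sum>k<r. c k * B k $$ (a,b) + c k * e k * B r $$ (a,b))"
          using Bc[of r] that by (intro sum.cong) (auto simp: C_def algebra_simps)
        then have "(\<Sum>k<r. c k * B k $$ (a,b)) + (\<Sum>k<r. c k * e k) * B r $$ (a,b) = 0"
          using c that by (simp add: sum.distrib sum_distrib_right)
        then show ?thesis by (simp add: d_def)
      qed
      then have "d k = 0" using Bind[unfolded mlin_indep_def, rule_format, of d k] k by simp
      then show "c k = 0" using k by (simp add: d_def)
    qed
    ultimately show ?thesis by blast
  qed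
qed

text \<open>If a simple entry of \<open>x\<close> vanishes, then \<open>[x, b]\<close> lies in a hyperplane of \<open>n\<close>,
  so the kernel of \<open>ad x\<close> on \<open>b\<close> has dimension greater than \<open>dim b - dim n = m\<close>.\<close>

lemma simple_nonzero_if_regular:
  assumes p: "inj_on p {..<m}" and x: "x \<in> strict_tri p m" and reg: "regular m x"
    and s: "(a0,b0) \<in> simple_pairs p m"
  shows "x $$ (a0,b0) \<noteq> 0"
proof
  assume zero: "x $$ (a0,b0) = 0"
  have xc: "x \<in> carrier_mat m m" using x by (simp add: strict_tri_def)
  have ab0: "a0 < m" "b0 < m" and r: "ord_rank p m b0 = Suc (ord_rank p m a0)"
    using s by (auto simp: simple_pairs_def)
  have pab: "p a0 < p b0" using ord_rank_less_iff[OF p ab0] r by simp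
  have gap: "\<not> (p a0 < p c \<and> p c < p b0)" if "c < m" for c
    using ord_rank_less_iff[OF p ab0(1) that] ord_rank_less_iff[OF p that ab0(2)] r by linarith
  define T where "T = {(a,b). a < m \<and> b < m \<and> p a \<le> p b}"
  define S where "S = {(a,b). a < m \<and> b < m \<and> p a < p b}"
  have fin: "finite T" "finite S"
    by (rule finite_subset[of _ "{..<m} \<times> {..<m}"]; force simp: T_def S_def)+
  \<comment> \<open>\<open>T\<close> indexes a basis of b and \<open>S\<close> one of n, so they
    differ by the \<open>m\<close> diagonal positions. Leaving out (a0,b0) saves one functional, and
    the kernel keeps m + 1 independent elements.\<close>
  have "T = S \<union> (\<lambda>a. (a,a)) ` {..<m}"
    using p by (auto simp: T_def S_def inj_on_def order_le_less)
  moreover have "S \<inter> (\<lambda>a. (a,a)) ` {..<m} = {}" by (auto simp: S_def)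
  ultimately have "card T = card S + m"
    using fin by (simp add: card_Un_disjoint card_image inj_on_def)
  moreover have "card S = Suc (card (S - {(a0,b0)}))"
    using fin ab0 pab by (intro card.remove) (auto simp: S_def)
  ultimately have cardT: "card T = Suc m + card (S - {(a0,b0)})" by simp
  obtain h where h: "bij_betw h {..<card T} T" using ex_bij_betw_nat_finite[OF fin(1)] by (auto simp: atLeast0LessThan)
  obtain g where g: "bij_betw g {..<card (S - {(a0,b0)})} (S - {(a0,b0)})"
    using ex_bij_betw_nat_finite[of "S - {(a0,b0)}"] fin(2) by (auto simp: atLeast0LessThan)
  define As where "As k = eu m (fst (h k)) (snd (h k))" for k
  have hT: "h k \<in> T" if "k < card T" for k using h that by (auto dest: bij_betwE)
  have "As k \<in> tri p m" if "k < card T" for k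
    using hT[OF that] unfolding As_def T_def by (intro eu_in_tri) auto
  moreover have "mlin_indep m (card T) As" unfolding mlin_indep_def
  proof (intro allI impI)
    fix c k assume c: "\<forall>a<m. \<forall>b<m. (\<Sum>k<card T. c k * As k $$ (a,b)) = 0" and k: "k < card T"
    obtain a b where ab: "h k = (a,b)" "a < m" "b < m" using hT[OF k] by (auto simp: T_def)
    have "(\<Sum>l<card T. c l * As l $$ (a,b)) = (\<Sum>l<card T. if l = k then c k else 0)"
    proof (rule sum.cong[OF refl])
      fix l assume l: "l \<in> {..<card T}"
      have "h l = h k \<longleftrightarrow> l = k" using h l k unfolding bij_betw_def by (auto dest: inj_onD)
      then have "(a = fst (h l) \<and> b = snd (h l)) \<longleftrightarrow> l = k" using ab by (metis fst_conv prod.collapse snd_conv)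
      then show "c l * As l $$ (a,b) = (if l = k then c k else 0)" using ab by (simp add: As_def)
    qed
    then show "c k = 0" using c ab k by simp
  qed
  \<comment> \<open>The functionals are the entries of [x, A] at the strict positions other than
    (a0,b0), enumerated by \<open>g\<close>.\<close>
  moreover define \<phi> where "\<phi> l A = (if l < card (S - {(a0,b0)}) then bracket x A $$ g l else 0)" for l A
  have "\<phi> l (A + c \<cdot>\<^sub>m B) = \<phi> l A + c * \<phi> l B" if "A \<in> tri p m" "B \<in> tri p m" for l A B c
  proof (cases "l < card (S - {(a0,b0)})")
    case True
    obtain a b where ab: "g l = (a,b)" "a < m" "b < m" using bij_betwE[OF g] True by (force simp: S_def)
    have AB: "A \<in> carrier_mat m m" "B \<in> carrier_mat m m" using that by (auto simp: tri_def)
    have "bracket x X $$ (a,b) = (\<Sum>c<m. x $$ (a,c) * X $$ (c,b) - X $$ (a,c) * x $$ (c,b))"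
      if "X \<in> carrier_mat m m" for X
      using bracket_entry[OF xc that ab(2,3)] mult_entry[OF xc that ab(2,3)] mult_entry[OF that xc ab(2,3)]
      by (simp add: sum_subtractf)
    then show ?thesis using AB ab True
      by (simp add: \<phi>_def sum_distrib_left sum.distrib[symmetric] algebra_simps)
  qed (simp add: \<phi>_def)
  ultimately obtain Bs where Bs: "\<And>k. k < Suc m \<Longrightarrow> Bs k \<in> tri p m"
      "\<And>k l. k < Suc m \<Longrightarrow> l < card (S - {(a0,b0)}) \<Longrightarrow> \<phi> l (Bs k) = 0"
    and ind: "mlin_indep m (Suc m) Bs"
    using mlin_indep_kernel[OF msubspace_tri[of m p], of \<phi> "Suc m" "card (S - {(a0,b0)})" As]
    unfolding cardT by blast
  have "Bs k \<in> centralizer m x" if k: "k < Suc m" for k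
  proof -
    let ?B = "Bs k"
    have B: "?B \<in> tri p m" and Bc: "?B \<in> carrier_mat m m" using Bs(1)[OF k] by (auto simp: tri_def)
    have xt: "x \<in> tri p m" using x by (auto simp: tri_def strict_tri_def)
    have "bracket x ?B $$ (a,b) = 0" if ab: "a < m" "b < m" for a b
    proof -
      consider "(a,b) = (a0,b0)" | "(a,b) \<in> S - {(a0,b0)}" | "(a,b) \<notin> S" by blast
      then show ?thesis
      proof cases
        case 1
        \<comment> \<open>No index lies strictly between two neighbours, so a term of the bracket at
          (a0,b0) that survives triangularity has c = a0 or c = b0. It then contains a diagonal
          entry of \<open>x\<close> or the entry (a0,b0), and all of these are zero.\<close>
        have z: "x $$ (a0,c) * ?B $$ (c,b0) = 0" "?B $$ (a0,c) * x $$ (c,b0) = 0" if "c < m" for c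
        proof -
          have "c = a0 \<or> c = b0 \<or> p c < p a0 \<or> p b0 < p c"
            using gap[OF that] p that ab0 by (metis inj_onD lessThan_iff linorder_neqE)
          then show "x $$ (a0,c) * ?B $$ (c,b0) = 0" "?B $$ (a0,c) * x $$ (c,b0) = 0"
            using x B zero that ab0 unfolding strict_tri_def tri_def by auto
        qed
        have "(\<Sum>c<m. x $$ (a0,c) * ?B $$ (c,b0)) = 0" "(\<Sum>c<m. ?B $$ (a0,c) * x $$ (c,b0)) = 0"
          by (rule sum.neutral; use z in blast)+
        then show ?thesis using bracket_entry[OF xc Bc ab] mult_entry[OF xc Bc ab] mult_entry[OF Bc xc ab] 1 by simp
      next
        case 2
        then obtain l where "l < card (S - {(a0,b0)})" "g l = (a,b)"
          using g unfolding bij_betw_def by (metis (no_types, lifting) imageE lessThan_iff)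
        then show ?thesis using Bs(2)[OF k, of l] by (simp add: \<phi>_def)
      next
        case 3
        then show ?thesis using bracket_tri[OF p xt B] ab unfolding S_def strict_tri_def by auto
      qed
    qed
    then have "x * ?B = ?B * x"
      using bracket_entry[OF xc Bc] xc Bc by (intro eq_matI) (auto simp del: index_mult_mat(1))
    then show ?thesis using Bc by (simp add: centralizer_def)
  qed
  then have "Suc m \<le> mdim m (centralizer m x)"
    unfolding mdim_def using ind mlin_indep_bound
    by (intro Greatest_le_nat[of _ _ "m * m"]) auto
  with reg show False by (simp add: regular_def)
qed

lemma strict_tri_regular_iff:
  assumes "inj_on p {..<m}" "m \<ge> 1" "x \<in> strict_tri p m"
  shows "regular m x \<longleftrightarrow> x ^\<^sub>m (m - 1) \<noteq> 0\<^sub>m m m"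
    and "regular m x \<longleftrightarrow> (\<forall>(a,b)\<in>simple_pairs p m. x $$ (a,b) \<noteq> 0)"
proof -
  have "x \<in> carrier_mat m m" using assms by (simp add: strict_tri_def)
  then have 1: "x ^\<^sub>m (m - 1) \<noteq> 0\<^sub>m m m \<Longrightarrow> regular m x"
    using regular_if_pow_nonzero strict_tri_nilpotent[OF assms(3)] by blast
  moreover have 2: "regular m x \<Longrightarrow> \<forall>(a,b)\<in>simple_pairs p m. x $$ (a,b) \<noteq> 0"
    using simple_nonzero_if_regular[OF assms(1,3)] by blast
  moreover have 3: "\<forall>(a,b)\<in>simple_pairs p m. x $$ (a,b) \<noteq> 0 \<Longrightarrow> x ^\<^sub>m (m - 1) \<noteq> 0\<^sub>m m m"
    using simple_nonzero_pow[OF assms] by blast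
  ultimately show "regular m x \<longleftrightarrow> x ^\<^sub>m (m - 1) \<noteq> 0\<^sub>m m m"
    "regular m x \<longleftrightarrow> (\<forall>(a,b)\<in>simple_pairs p m. x $$ (a,b) \<noteq> 0)" by blast+
qed

section \<open>The Borel subalgebra of a sequence of orbits\<close>

text \<open>In \<open>conj_set\<close> the matrix \<open>h\<close> ranges over everything that
  inverts \<open>g\<close> on both sides; the inverse laws fix its dimensions and then
  \<open>h\<close> itself.\<close>

lemma conj_set_eq:
  assumes g: "g \<in> carrier_mat m m" and h: "h \<in> carrier_mat m m" and inv: "g * h = 1\<^sub>m m" "h * g = 1\<^sub>m m"
  shows "conj_set g b = {g * A * h | A. A \<in> b}"
proof -
  have "k = h" if "inverts_mat g k" "inverts_mat k g" for k
  proof -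
    have gk: "g * k = 1\<^sub>m m" and kg: "k * g = 1\<^sub>m (dim_row k)" using that g by (auto simp: inverts_mat_def)
    have "dim_col k = m" using arg_cong[OF gk, of dim_col] by simp
    moreover have "dim_row k = m" using arg_cong[OF kg, of dim_col] g by simp
    ultimately have k: "k \<in> carrier_mat m m" by auto
    have "k = (h * g) * k" using inv k by simp
    also have "\<dots> = h * (g * k)" using g h k by (simp add: assoc_mult_mat[of _ m m _ m _ m])
    finally show ?thesis using gk h by simp
  qed
  moreover have "inverts_mat g h" "inverts_mat h g" using inv g h by (auto simp: inverts_mat_def)
  ultimately show ?thesis unfolding conj_set_def by blast
qed

definition perm_mat :: "(nat \<Rightarrow> nat) \<Rightarrow> nat \<Rightarrow> complex mat" where
  "perm_mat \<sigma> m = mat m m (\<lambda>(i,j). if \<sigma> i = j then 1 else 0)"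

context
  fixes \<sigma> :: "nat \<Rightarrow> nat" and m :: nat
  assumes \<sigma>: "bij_betw \<sigma> {..<m} {..<m}"
begin

lemma perm_lt: "i < m \<Longrightarrow> \<sigma> i < m"
  using \<sigma> by (auto dest: bij_betwE)

lemma perm_inj: "i < m \<Longrightarrow> j < m \<Longrightarrow> \<sigma> i = \<sigma> j \<Longrightarrow> i = j"
  using \<sigma> unfolding bij_betw_def by (auto dest: inj_onD)

lemma perm_mat_carrier: "perm_mat \<sigma> m \<in> carrier_mat m m" "transpose_mat (perm_mat \<sigma> m) \<in> carrier_mat m m"
  by (auto simp: perm_mat_def)

lemma perm_mat_mult_entry:
  assumes "A \<in> carrier_mat m m" "i < m" "j < m"
  shows "(perm_mat \<sigma> m * A) $$ (i,j) = A $$ (\<sigma> i, j)"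
    and "(A * transpose_mat (perm_mat \<sigma> m)) $$ (i,j) = A $$ (i, \<sigma> j)"
proof -
  have "(perm_mat \<sigma> m * A) $$ (i,j) = (\<Sum>c<m. if c = \<sigma> i then A $$ (\<sigma> i, j) else 0)"
    unfolding mult_entry[OF perm_mat_carrier(1) assms] using assms by (intro sum.cong) (auto simp: perm_mat_def)
  then show "(perm_mat \<sigma> m * A) $$ (i,j) = A $$ (\<sigma> i, j)" using perm_lt assms by simp
  have "(A * transpose_mat (perm_mat \<sigma> m)) $$ (i,j) = (\<Sum>c<m. if c = \<sigma> j then A $$ (i, \<sigma> j) else 0)"
    unfolding mult_entry[OF assms(1) perm_mat_carrier(2) assms(2,3)]
    using assms by (intro sum.cong) (auto simp: perm_mat_def)
  then show "(A * transpose_mat (perm_mat \<sigma> m)) $$ (i,j) = A $$ (i, \<sigma> j)" using perm_lt assms by simp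
qed

lemma perm_mat_inverse:
  "perm_mat \<sigma> m * transpose_mat (perm_mat \<sigma> m) = 1\<^sub>m m"
  "transpose_mat (perm_mat \<sigma> m) * perm_mat \<sigma> m = 1\<^sub>m m"
proof -
  have "(perm_mat \<sigma> m * transpose_mat (perm_mat \<sigma> m)) $$ (i,j) = 1\<^sub>m m $$ (i,j)" if "i < m" "j < m" for i j
    using perm_mat_mult_entry(2)[OF perm_mat_carrier(1) that] that perm_inj[of i j] perm_lt
    by (auto simp: perm_mat_def)
  then show 1: "perm_mat \<sigma> m * transpose_mat (perm_mat \<sigma> m) = 1\<^sub>m m"
    using perm_mat_carrier by (intro eq_matI) (auto simp del: index_mult_mat(1))
  show "transpose_mat (perm_mat \<sigma> m) * perm_mat \<sigma> m = 1\<^sub>m m"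
    by (rule mat_mult_left_right_inverse[OF perm_mat_carrier 1])
qed

text \<open>Conjugation by the permutation matrix moves the entry at (\<sigma> i, \<sigma> j) to (i,
  j), so the order is pulled back along \<sigma>.\<close>

lemma conj_set_perm_mat: "conj_set (perm_mat \<sigma> m) (tri q m) = tri (\<lambda>a. q (\<sigma> a)) m"
proof -
  let ?P = "perm_mat \<sigma> m"
  note c = perm_mat_carrier
  have entry: "(?P * A * transpose_mat ?P) $$ (i,j) = A $$ (\<sigma> i, \<sigma> j)"
    if "A \<in> carrier_mat m m" "i < m" "j < m" for A i j
    using perm_mat_mult_entry(2)[of "?P * A" i j] perm_mat_mult_entry(1)[of A i "\<sigma> j"] that c perm_lt
    by (simp del: index_mult_mat(1))
  have "conj_set ?P (tri q m) = {?P * A * transpose_mat ?P | A. A \<in> tri q m}"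
    by (rule conj_set_eq[OF c perm_mat_inverse])
  also have "\<dots> = tri (\<lambda>a. q (\<sigma> a)) m"
  proof (intro Set.set_eqI iffI)
    fix B assume "B \<in> {?P * A * transpose_mat ?P | A. A \<in> tri q m}"
    then obtain A where A: "A \<in> tri q m" "B = ?P * A * transpose_mat ?P" by blast
    then have "A \<in> carrier_mat m m" by (simp add: tri_def)
    then have "B \<in> carrier_mat m m" "\<And>i j. i < m \<Longrightarrow> j < m \<Longrightarrow> B $$ (i,j) = A $$ (\<sigma> i, \<sigma> j)"
      using A c entry by (auto intro!: mult_carrier_mat[of _ m m] simp del: index_mult_mat(1))
    then show "B \<in> tri (\<lambda>a. q (\<sigma> a)) m" using A(1) perm_lt unfolding tri_def by auto
  next
    fix B assume B: "B \<in> tri (\<lambda>a. q (\<sigma> a)) m"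
    define A where "A = transpose_mat ?P * B * ?P"
    have Bc: "B \<in> carrier_mat m m" using B by (simp add: tri_def)
    have Ac: "A \<in> carrier_mat m m" unfolding A_def using c Bc by (auto intro!: mult_carrier_mat[of _ m m])
    have "?P * A * transpose_mat ?P = (?P * transpose_mat ?P) * B * (?P * transpose_mat ?P)"
      unfolding A_def using c Bc by (simp add: assoc_mult_mat[of _ m m _ m _ m])
    also have "\<dots> = B" using perm_mat_inverse(1) Bc by simp
    finally have eq: "?P * A * transpose_mat ?P = B" .
    have "A \<in> tri q m" unfolding tri_def
    proof (intro CollectI conjI allI impI Ac)
      fix a b assume ab: "a < m" "b < m" "q b < q a"
      have "a \<in> \<sigma> ` {..<m}" "b \<in> \<sigma> ` {..<m}" using \<sigma> ab unfolding bij_betw_def by auto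
      then obtain i j where ij: "i < m" "j < m" "a = \<sigma> i" "b = \<sigma> j" by auto
      then have "A $$ (a,b) = B $$ (i,j)" using entry[OF Ac ij(1,2)] eq by simp
      then show "A $$ (a,b) = 0" using B ij ab(3) unfolding tri_def by auto
    qed
    with eq show "B \<in> {?P * A * transpose_mat ?P | A. A \<in> tri q m}" by blast
  qed
  finally show ?thesis .
qed

lemma perm_mat_Kgrp:
  assumes "m \<ge> 1" "\<sigma> (m - 1) = m - 1"
  shows "perm_mat \<sigma> m \<in> Kgrp m"
proof -
  have "inverts_mat (perm_mat \<sigma> m) (transpose_mat (perm_mat \<sigma> m))"
    "inverts_mat (transpose_mat (perm_mat \<sigma> m)) (perm_mat \<sigma> m)"
    using perm_mat_inverse by (auto simp: inverts_mat_def perm_mat_def)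
  then have "invertible_mat (perm_mat \<sigma> m)"
    unfolding invertible_mat_def using perm_mat_carrier(1) by (auto simp: square_mat.simps)
  moreover have "perm_mat \<sigma> m $$ (a, m - 1) = 0 \<and> perm_mat \<sigma> m $$ (m - 1, a) = 0" if "a < m - 1" for a
  proof -
    have "a < m" using that by simp
    then show ?thesis using that assms perm_inj[of a "m - 1"] by (auto simp: perm_mat_def)
  qed
  ultimately show ?thesis unfolding Kgrp_def using perm_mat_carrier(1) by blast
qed

end

section \<open>The orbits of the upper and lower triangular Borel subalgebras\<close>

lemma upper_borel_eq_tri: "upper_borel m = tri int m"
  unfolding upper_borel_def tri_def by (intro Collect_cong) (auto dest: less_trans)

lemma lower_borel_eq_tri: "lower_borel m = tri (\<lambda>a. - int a) m"
  unfolding lower_borel_def tri_def by (intro Collect_cong) (auto dest: less_trans)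

text \<open>Sorting the indices by rank carries a standard triangular algebra to the given one. For
  the plus sign the last index also has the last position, so the permutation fixes it and its
  matrix lies in K_i. For the minus sign the order is reversed to achieve the same, and the lower
  triangular algebra takes the place of the upper one.\<close>

lemma tri_in_orbit:
  assumes i: "i \<ge> 1"
  shows "s (i - 1) \<Longrightarrow> tri (sgn_ord s) i \<in> Qplus i" and "\<not> s (i - 1) \<Longrightarrow> tri (sgn_ord s) i \<in> Qminus i"
proof -
  let ?p = "sgn_ord s" and ?p' = "\<lambda>a. - sgn_ord s a"
  have inj: "inj_on ?p {..<i}" "inj_on ?p' {..<i}" using inj_sgn_ord[of s "{..<i}"] by (auto simp: inj_on_def)
  have last: "ord_rank q i (i - 1) = i - 1" if "\<And>b. b < i - 1 \<Longrightarrow> q b < q (i - 1)" for q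
  proof -
    have "{b. b < i \<and> q b < q (i - 1)} = {..<i - 1}"
    proof (intro Set.set_eqI iffI)
      fix b assume "b \<in> {b. b < i \<and> q b < q (i - 1)}"
      then have "b < i" "b \<noteq> i - 1" by auto
      then show "b \<in> {..<i - 1}" by simp
    qed (use that in auto)
    then show ?thesis by (simp add: ord_rank_def)
  qed
  {
    assume s: "s (i - 1)"
    let ?\<sigma> = "ord_rank ?p i"
    have "conj_set (perm_mat ?\<sigma> i) (upper_borel i) = tri (\<lambda>a. int (?\<sigma> a)) i"
      unfolding upper_borel_eq_tri by (rule conj_set_perm_mat[OF ord_rank_bij[OF inj(1)]])
    also have "\<dots> = tri ?p i" by (rule tri_cong) (simp add: ord_rank_less_iff[OF inj(1)])
    finally have "conj_set (perm_mat ?\<sigma> i) (upper_borel i) = tri ?p i" .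
    moreover have "perm_mat ?\<sigma> i \<in> Kgrp i"
      using s by (intro perm_mat_Kgrp[OF ord_rank_bij[OF inj(1)] i] last) (simp add: sgn_ord_le)
    ultimately show "tri ?p i \<in> Qplus i" unfolding Qplus_def by blast
  }
  {
    assume s: "\<not> s (i - 1)"
    let ?\<sigma> = "ord_rank ?p' i"
    have "conj_set (perm_mat ?\<sigma> i) (lower_borel i) = tri (\<lambda>a. - int (?\<sigma> a)) i"
      unfolding lower_borel_eq_tri by (rule conj_set_perm_mat[OF ord_rank_bij[OF inj(2)]])
    also have "\<dots> = tri ?p i" by (rule tri_cong) (simp add: ord_rank_less_iff[OF inj(2)])
    finally have "conj_set (perm_mat ?\<sigma> i) (lower_borel i) = tri ?p i" .
    moreover have "perm_mat ?\<sigma> i \<in> Kgrp i"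
      using s by (intro perm_mat_Kgrp[OF ord_rank_bij[OF inj(2)] i] last) (simp add: sgn_ord_le)
    ultimately show "tri ?p i \<in> Qminus i" unfolding Qminus_def by blast
  }
qed

lemma Kgrp_inverse_border:
  assumes g: "g \<in> Kgrp m" and gh: "inverts_mat g h" "inverts_mat h g" and a: "a < m - 1"
  shows "h \<in> carrier_mat m m" "h $$ (m - 1, a) = 0" "h $$ (a, m - 1) = 0"
proof -
  have gc: "g \<in> carrier_mat m m" using g by (simp add: Kgrp_def)
  have gk: "g * h = 1\<^sub>m m" and kg: "h * g = 1\<^sub>m (dim_row h)" using gh gc by (auto simp: inverts_mat_def)
  have "dim_col h = m" using arg_cong[OF gk, of dim_col] by simp
  moreover have "dim_row h = m" using arg_cong[OF kg, of dim_col] gc by simp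
  ultimately show h: "h \<in> carrier_mat m m" by auto
  then have hg: "h * g = 1\<^sub>m m" using kg by auto
  have m: "m - 1 < m" "a < m" using a by auto
  have border: "g $$ (m - 1, c) = 0" "g $$ (c, m - 1) = 0" if "c < m" "c \<noteq> m - 1" for c
  proof -
    have "c < m - 1" using that by simp
    then show "g $$ (m - 1, c) = 0" "g $$ (c, m - 1) = 0" using g unfolding Kgrp_def by auto
  qed
  have row: "(g * X) $$ (m - 1, c) = g $$ (m - 1, m - 1) * X $$ (m - 1, c)" if "X \<in> carrier_mat m m" "c < m" for X c
  proof -
    have "(g * X) $$ (m - 1, c) = (\<Sum>d<m. if d = m - 1 then g $$ (m - 1, m - 1) * X $$ (m - 1, c) else 0)"
      unfolding mult_entry[OF gc that(1) m(1) that(2)] using border by (intro sum.cong) auto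
    then show ?thesis using m by simp
  qed
  have col: "(X * g) $$ (c, m - 1) = X $$ (c, m - 1) * g $$ (m - 1, m - 1)" if "X \<in> carrier_mat m m" "c < m" for X c
  proof -
    have "(X * g) $$ (c, m - 1) = (\<Sum>d<m. if d = m - 1 then X $$ (c, m - 1) * g $$ (m - 1, m - 1) else 0)"
      unfolding mult_entry[OF that(1) gc that(2) m(1)] using border by (intro sum.cong) auto
    then show ?thesis using m by simp
  qed
  have "g $$ (m - 1, m - 1) * h $$ (m - 1, m - 1) = 1" using row[OF h m(1)] gk m by simp
  then have nz: "g $$ (m - 1, m - 1) \<noteq> 0" by auto
  show "h $$ (m - 1, a) = 0" using row[OF h m(2)] gk m a nz by simp
  show "h $$ (a, m - 1) = 0" using col[OF h m(2)] hg m a nz by simp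
qed

text \<open>Elements of K_m and their inverses have zero off-diagonal border, so conjugation by them
  preserves the vanishing of the off-diagonal part of the last row, or of the last column.\<close>

lemma orbit_border_zero:
  assumes a: "a < m - 1" and A: "A \<in> b"
  shows "b \<in> Qplus m \<Longrightarrow> A $$ (m - 1, a) = 0" and "b \<in> Qminus m \<Longrightarrow> A $$ (a, m - 1) = 0"
proof -
  have m: "m - 1 < m" "a < m" using a by auto
  have exp: "(g * B * h) $$ (i,j) = (\<Sum>c<m. \<Sum>d<m. g $$ (i,d) * B $$ (d,c) * h $$ (c,j))"
    if "g \<in> carrier_mat m m" "B \<in> carrier_mat m m" "h \<in> carrier_mat m m" "i < m" "j < m"
    for g B h :: "complex mat" and i j
    using that mult_entry[of "g * B" m h i j] mult_entry[of g m B i] mult_carrier_mat[of g m m B m]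
    by (simp add: sum_distrib_right del: index_mult_mat(1))
  {
    assume "b \<in> Qplus m"
    then obtain g B h where gh: "g \<in> Kgrp m" "B \<in> upper_borel m" "inverts_mat g h" "inverts_mat h g" "A = g * B * h"
      using A unfolding Qplus_def conj_set_def by blast
    note h = Kgrp_inverse_border[OF gh(1,3,4) a]
    have c: "g \<in> carrier_mat m m" "B \<in> carrier_mat m m" using gh by (auto simp: Kgrp_def upper_borel_def)
    have z: "g $$ (m - 1, d) * B $$ (d,c) * h $$ (c,a) = 0" if "c < m" "d < m" for c d
    proof (cases "d = m - 1 \<and> c < m - 1")
      case True
      then show ?thesis using gh(2) m by (auto simp: upper_borel_def)
    next
      case False
      then have "d < m - 1 \<or> c = m - 1" using that by auto
      then show ?thesis using gh(1) h(2) by (auto simp: Kgrp_def)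
    qed
    show "A $$ (m - 1, a) = 0" unfolding gh(5) exp[OF c h(1) m]
      by (intro sum.neutral ballI) (use z in blast)
  }
  {
    assume "b \<in> Qminus m"
    then obtain g B h where gh: "g \<in> Kgrp m" "B \<in> lower_borel m" "inverts_mat g h" "inverts_mat h g" "A = g * B * h"
      using A unfolding Qminus_def conj_set_def by blast
    note h = Kgrp_inverse_border[OF gh(1,3,4) a]
    have c: "g \<in> carrier_mat m m" "B \<in> carrier_mat m m" using gh by (auto simp: Kgrp_def lower_borel_def)
    have z: "g $$ (a, d) * B $$ (d,c) * h $$ (c,m - 1) = 0" if cd: "c < m" "d < m" for c d
    proof (cases "c = m - 1 \<and> d < m - 1")
      case True
      then show ?thesis using gh(2) m by (auto simp: lower_borel_def)
    next
      case False
      then have "c < m - 1 \<or> d = m - 1" using cd by auto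
      then show ?thesis using gh(1) a Kgrp_inverse_border(3)[OF gh(1,3,4)] by (auto simp: Kgrp_def)
    qed
    show "A $$ (a, m - 1) = 0" unfolding gh(5) exp[OF c h(1) m(2,1)]
      by (intro sum.neutral ballI) (use z in blast)
  }
qed

section \<open>Sequences of orbits and their parametrization by signs\<close>

lemma Qplus_ne_Qminus:
  assumes "m \<ge> 2"
  shows "Qplus m \<noteq> Qminus m"
proof
  assume eq: "Qplus m = Qminus m"
  have "tri (sgn_ord (\<lambda>_. True)) m \<in> Qminus m" using tri_in_orbit(1)[of m "\<lambda>_. True"] assms eq by simp
  \<comment> \<open>A matrix unit in the last column separates the orbits; it is off the diagonal
    because \<open>m\<close> is at least 2.\<close>
  moreover have "eu m 0 (m - 1) \<in> tri (sgn_ord (\<lambda>_. True)) m" using assms by (intro eu_in_tri) (simp add: sgn_ord_def)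
  ultimately have "eu m 0 (m - 1) $$ (0, m - 1) = 0" using assms by (intro orbit_border_zero(2)) auto
  then show False using assms by simp
qed

lemma Qplus_eq_Qminus_1: "Qplus 1 = Qminus 1"
proof -
  have "upper_borel 1 = lower_borel 1" by (auto simp: upper_borel_def lower_borel_def)
  then show ?thesis by (simp add: Qplus_def Qminus_def)
qed

text \<open>The sign of the index \<open>b\<close> decides the orbit in the corner of size
  \<open>b + 1\<close>, where \<open>b\<close> is the last index. The value \<open>{}\<close>
  outside the range is the one prescribed by \<open>Seqs\<close>.\<close>

definition Qseq :: "nat \<Rightarrow> (nat \<Rightarrow> bool) \<Rightarrow> nat \<Rightarrow> complex mat set set" where
  "Qseq n s i = (if i \<in> {1..n+1} then if s (i - 1) then Qplus i else Qminus i else {})"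

lemma Seqs_eq: "Seqs n = range (Qseq n)"
proof (intro Set.set_eqI iffI)
  fix Q assume Q: "Q \<in> Seqs n"
  have "Q = Qseq n (\<lambda>b. Q (Suc b) = Qplus (Suc b))"
    using Q by (auto simp: Seqs_def Qseq_def fun_eq_iff)
  then show "Q \<in> range (Qseq n)" by blast
next
  fix Q assume "Q \<in> range (Qseq n)"
  then obtain s where "Q = Qseq n s" by blast
  then show "Q \<in> Seqs n" by (simp add: Seqs_def Qseq_def)
qed

lemma Qseq_eq_iff: "Qseq n s = Qseq n t \<longleftrightarrow> (\<forall>b\<in>{1..n}. s b = t b)"
proof
  assume eq: "Qseq n s = Qseq n t"
  show "\<forall>b\<in>{1..n}. s b = t b"
  proof
    fix b assume "b \<in> {1..n}"
    then show "s b = t b" using fun_cong[OF eq, of "Suc b"] Qplus_ne_Qminus[of "Suc b"]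
      by (auto simp: Qseq_def split: if_splits)
  qed
next
  assume st: "\<forall>b\<in>{1..n}. s b = t b"
  show "Qseq n s = Qseq n t"
  proof
    fix i show "Qseq n s i = Qseq n t i"
    proof (cases "i \<in> {2..n+1}")
      case True
      then have "i - 1 \<in> {1..n}" by auto
      then have "s (i - 1) = t (i - 1)" using st by blast
      then show ?thesis by (simp add: Qseq_def)
    next
      case False
      then have "i = 1 \<or> i \<notin> {1..n+1}" by auto
      then show ?thesis using Qplus_eq_Qminus_1 by (auto simp: Qseq_def)
    qed
  qed
qed

lemma card_Seqs: "card (Seqs n) = 2 ^ n"
proof -
  have "bij_betw (\<lambda>S. Qseq n (\<lambda>b. b \<in> S)) (Pow {1..n}) (Seqs n)"
  proof (rule bij_betwI')
    fix S T assume "S \<in> Pow {1..n}" "T \<in> Pow {1..n}"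
    then show "(Qseq n (\<lambda>b. b \<in> S) = Qseq n (\<lambda>b. b \<in> T)) = (S = T)" unfolding Qseq_eq_iff by blast
  next
    fix Q assume "Q \<in> Seqs n"
    then obtain s where s: "Q = Qseq n s" by (auto simp: Seqs_eq)
    have "Q = Qseq n (\<lambda>b. b \<in> {b \<in> {1..n}. s b})" unfolding s Qseq_eq_iff by auto
    then show "\<exists>S\<in>Pow {1..n}. Q = Qseq n (\<lambda>b. b \<in> S)" by blast
  qed (simp add: Seqs_eq)
  then show ?thesis using bij_betw_same_card[of _ "Pow {1..n}" "Seqs n"] by (simp add: card_Pow)
qed

lemma corner_image_tri:
  assumes "i \<le> m"
  shows "corner i ` tri p m = tri p i"
proof
  show "corner i ` tri p m \<subseteq> tri p i" using assms by (auto simp: tri_def)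
  show "tri p i \<subseteq> corner i ` tri p m"
  proof
    fix A assume A: "A \<in> tri p i"
    define B where "B = mat m m (\<lambda>(a,b). if a < i \<and> b < i then A $$ (a,b) else 0)"
    have "B \<in> tri p m" using A by (auto simp: B_def tri_def)
    moreover have "corner i B = A" using A assms by (intro eq_matI) (auto simp: B_def tri_def)
    ultimately show "A \<in> corner i ` tri p m" by blast
  qed
qed

lemma bQ_Qseq: "bQ n (Qseq n s) = tri (sgn_ord s) (n+1)"
  unfolding bQ_def
proof (rule the_equality)
  let ?T = "tri (sgn_ord s)"
  have "borel i (corner i ` ?T (n+1)) \<and> corner i ` ?T (n+1) \<in> Qseq n s i" if "i \<in> {1..n+1}" for i
    using that tri_in_orbit[of i s] by (auto simp: corner_image_tri Qseq_def intro: borel_tri inj_sgn_ord)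
  then show "borel (n+1) (?T (n+1)) \<and> (\<forall>i\<in>{1..n+1}. borel i (corner i ` ?T (n+1)) \<and> corner i ` ?T (n+1) \<in> Qseq n s i)"
    using borel_tri[OF inj_sgn_ord, of "n+1" s] by blast
  fix b assume b: "borel (n+1) b \<and> (\<forall>i\<in>{1..n+1}. borel i (corner i ` b) \<and> corner i ` b \<in> Qseq n s i)"
  \<comment> \<open>For a position forbidden by the order, the larger of its two indices is the last
    one of some corner, and the orbit prescribed for that corner forces a zero there.\<close>
  have "b \<subseteq> ?T (n+1)"
  proof
    fix A assume A: "A \<in> b"
    then have Ac: "A \<in> carrier_mat (n+1) (n+1)" using b unfolding borel_def subalgebra_def msubspace_def by blast
    have "A $$ (c,d) = 0" if cd: "c < n+1" "d < n+1" "sgn_ord s d < sgn_ord s c" for c d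
    proof -
      have "c \<noteq> d" using cd by auto
      then consider "d < c" "s c" | "c < d" "\<not> s d" using cd(3) sgn_ord_le by (metis linorder_neqE_nat)
      then show ?thesis
      proof cases
        case 1
        have "corner (Suc c) ` b \<in> Qseq n s (Suc c)" using b cd(1) by simp
        then have "corner (Suc c) ` b \<in> Qplus (Suc c)" using 1 cd(1) by (simp add: Qseq_def)
        then have "corner (Suc c) A $$ (Suc c - 1, d) = 0"
          by (intro orbit_border_zero(1)[OF _ imageI[OF A]]) (use 1 in simp_all)
        then show ?thesis using 1 by simp
      next
        case 2
        have "corner (Suc d) ` b \<in> Qseq n s (Suc d)" using b cd(2) by simp
        then have "corner (Suc d) ` b \<in> Qminus (Suc d)" using 2 cd(2) by (simp add: Qseq_def)
        then have "corner (Suc d) A $$ (c, Suc d - 1) = 0"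
          by (intro orbit_border_zero(2)[OF _ imageI[OF A]]) (use 2 in simp_all)
        then show ?thesis using 2 by simp
      qed
    qed
    with Ac show "A \<in> ?T (n+1)" by (simp add: tri_def)
  qed
  \<comment> \<open>\<open>b\<close> is itself maximal among the solvable subalgebras, so its
    inclusion in the solvable triangular algebra is an equality.\<close>
  moreover have "\<forall>c. subalgebra (n+1) c \<and> solvable_alg (n+1) c \<and> b \<subseteq> c \<longrightarrow> c = b"
    using b unfolding borel_def by (elim conjE)
  ultimately have "?T (n+1) = b" using subalgebra_tri[of "n+1" "sgn_ord s"] solvable_tri[OF inj_sgn_ord, of "n+1" s] by metis
  then show "b = ?T (n+1)" by simp
qed

lemma nQ_Qseq: "nQ n (Qseq n s) = strict_tri (sgn_ord s) (n+1)"
  unfolding nQ_def bQ_Qseq by (rule derived_alg_tri[OF inj_sgn_ord])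

section \<open>Irreducible components\<close>

lemma corner_regular:
  assumes x: "x \<in> strict_tri (sgn_ord s) N" and nz: "x ^\<^sub>m (N - 1) \<noteq> 0\<^sub>m N N" and "1 \<le> i" "i \<le> N"
  shows "corner i x \<in> strict_tri (sgn_ord s) i \<and> corner i x ^\<^sub>m (i - 1) \<noteq> 0\<^sub>m i i"
  using \<open>i \<le> N\<close> \<open>1 \<le> i\<close>
proof (induction rule: inc_induct)
  case base
  have "x \<in> carrier_mat N N" using x by (simp add: strict_tri_def)
  then show ?case using x nz by (simp add: corner_self)
next
  case (step i)
  then have IH: "corner (Suc i) x \<in> strict_tri (sgn_ord s) (Suc i)" "corner (Suc i) x ^\<^sub>m i \<noteq> 0\<^sub>m (Suc i) (Suc i)" by auto
  then show ?case
    using regular_corner[OF IH(1) step.prems IH(2)] strict_tri_sgn_Suc[of "corner (Suc i) x" i s]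
    by (simp add: corner_corner)
qed

text \<open>If the signs differed at \<open>b\<close>, the border column of the corner of size
  \<open>b + 1\<close> would be cyclic for one order and zero for the other.\<close>

lemma regular_sign_unique:
  assumes x: "x \<in> strict_tri (sgn_ord s) (n+1)" "x \<in> strict_tri (sgn_ord t) (n+1)"
    and nz: "x ^\<^sub>m n \<noteq> 0\<^sub>m (n+1) (n+1)" and b: "b \<in> {1..n}"
  shows "s b = t b"
proof -
  define z where "z = corner (Suc b) x"
  have z: "z \<in> strict_tri (sgn_ord s) (Suc b)" "z \<in> strict_tri (sgn_ord t) (Suc b)"
    "z ^\<^sub>m b \<noteq> 0\<^sub>m (Suc b) (Suc b)"
    using corner_regular[OF x(1), of "Suc b"] corner_regular[OF x(2), of "Suc b"] nz b by (auto simp: z_def)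
  have zc: "z \<in> carrier_mat (Suc b) (Suc b)" by (simp add: z_def)
  have b1: "b \<ge> 1" using b by simp
  have False if uv: "z \<in> strict_tri (sgn_ord u) (Suc b)" "z \<in> strict_tri (sgn_ord v) (Suc b)" "u b" "\<not> v b" for u v
  proof -
    have "\<exists>a<b. mv (corner b z ^\<^sub>m (b - 1)) (\<lambda>a. z $$ (a,b)) a \<noteq> 0"
      using regular_border[OF uv(1) b1 z(3)] uv(3) by simp
    moreover have "z $$ (a,b) = 0" if "a < b" for a
      using strict_tri_sgn_Suc[OF zc, of v] uv(2,4) that by auto
    ultimately show False using mv_zero_vec[of "corner b z ^\<^sub>m (b - 1)" b] by force
  qed
  from this[OF z(1,2)] this[OF z(2,1)] show ?thesis by blast
qed

section \<open>Polynomial functions, closed sets and irreducibility\<close>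

lemma poly_fun_on_line:
  assumes "f \<in> poly_fun m" and A: "A \<in> carrier_mat m m" and B: "B \<in> carrier_mat m m"
  shows "\<exists>p. \<forall>t. f (A + t \<cdot>\<^sub>m B) = poly p t"
  using assms(1)
proof (induction rule: poly_fun.induct)
  case (pf_const c)
  show ?case by (intro exI[of _ "[:c:]"]) simp
next
  case (pf_coord a b)
  then show ?case using A B by (intro exI[of _ "[:A $$ (a,b), B $$ (a,b):]"]) simp
next
  case (pf_add f g)
  then obtain p q where "\<forall>t. f (A + t \<cdot>\<^sub>m B) = poly p t" "\<forall>t. g (A + t \<cdot>\<^sub>m B) = poly q t" by blast
  then show ?case by (intro exI[of _ "p + q"]) simp
next
  case (pf_mult f g)
  then obtain p q where "\<forall>t. f (A + t \<cdot>\<^sub>m B) = poly p t" "\<forall>t. g (A + t \<cdot>\<^sub>m B) = poly q t" by blast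
  then show ?case by (intro exI[of _ "p * q"]) simp
qed

lemma poly_fun_prod:
  assumes "finite E" "\<And>e. e \<in> E \<Longrightarrow> f e \<in> poly_fun m"
  shows "(\<lambda>x. \<Prod>e\<in>E. f e x) \<in> poly_fun m"
  using assms
proof (induction E rule: finite_induct)
  case empty
  show ?case using poly_fun.pf_const[of 1] by simp
next
  case (insert e E)
  then show ?case using poly_fun.pf_mult[of "f e" m "\<lambda>x. \<Prod>e\<in>E. f e x"] by simp
qed

text \<open>A point outside \<open>Z1\<close> and a point outside \<open>Z2\<close> are joined by a
  line in \<open>V\<close>. On it the two separating functions and \<open>h\<close> are nonzero
  polynomials in one variable; at a parameter where their product is nonzero, the line meets the
  open set outside both closed sets.\<close>

lemma zariski_irreducible_open_subspace:
  assumes V: "msubspace m V" and h: "h \<in> poly_fun m" and ne: "{x \<in> V. h x \<noteq> 0} \<noteq> {}"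
  shows "zariski_irreducible m {x \<in> V. h x \<noteq> 0}"
  unfolding zariski_irreducible_def
proof (intro conjI allI impI ne)
  show "{x \<in> V. h x \<noteq> 0} \<subseteq> carrier_mat m m" using V by (auto simp: msubspace_def)
  fix Z1 Z2
  assume "zariski_closed m Z1 \<and> zariski_closed m Z2 \<and> {x \<in> V. h x \<noteq> 0} \<subseteq> Z1 \<union> Z2"
  then obtain F1 F2 where F: "F1 \<subseteq> poly_fun m" "Z1 = {x \<in> carrier_mat m m. \<forall>f\<in>F1. f x = 0}"
      "F2 \<subseteq> poly_fun m" "Z2 = {x \<in> carrier_mat m m. \<forall>f\<in>F2. f x = 0}"
    and cover: "{x \<in> V. h x \<noteq> 0} \<subseteq> Z1 \<union> Z2" unfolding zariski_closed_def by blast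
  show "{x \<in> V. h x \<noteq> 0} \<subseteq> Z1 \<or> {x \<in> V. h x \<noteq> 0} \<subseteq> Z2"
  proof (rule ccontr)
    assume "\<not> ?thesis"
    then obtain x1 x2 where x: "x1 \<in> V" "h x1 \<noteq> 0" "x1 \<notin> Z1" "x2 \<in> V" "h x2 \<noteq> 0" "x2 \<notin> Z2" by blast
    have xc: "x1 \<in> carrier_mat m m" "x2 \<in> carrier_mat m m" using x msubspace_carrier[OF V] by auto
    obtain f1 f2 where f: "f1 \<in> F1" "f1 x1 \<noteq> 0" "f2 \<in> F2" "f2 x2 \<noteq> 0" using F x xc by blast
    define B where "B = x2 + (-1) \<cdot>\<^sub>m x1"
    have BV: "B \<in> V" unfolding B_def by (intro msubspace_add[OF V] msubspace_smult[OF V] x)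
    have Bc: "B \<in> carrier_mat m m" using BV msubspace_carrier[OF V] by blast
    have L0: "x1 + 0 \<cdot>\<^sub>m B = x1" using xc Bc by (intro eq_matI) auto
    have L1: "x1 + 1 \<cdot>\<^sub>m B = x2" unfolding B_def using xc by (intro eq_matI) auto
    obtain p1 p2 q where p: "\<And>t. f1 (x1 + t \<cdot>\<^sub>m B) = poly p1 t" "\<And>t. f2 (x1 + t \<cdot>\<^sub>m B) = poly p2 t"
      "\<And>t. h (x1 + t \<cdot>\<^sub>m B) = poly q t"
      using poly_fun_on_line[OF _ xc(1) Bc] f F h by (metis subsetD)
    have "p1 \<noteq> 0" "p2 \<noteq> 0" "q \<noteq> 0" using p[of 0] p[of 1] L0 L1 f x by auto
    then have "p1 * p2 * q \<noteq> 0" by simp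
    then obtain t where t: "poly (p1 * p2 * q) t \<noteq> 0" using poly_all_0_iff_0 by blast
    let ?y = "x1 + t \<cdot>\<^sub>m B"
    have "?y \<in> V" by (intro msubspace_add[OF V] msubspace_smult[OF V] x BV)
    moreover have "h ?y \<noteq> 0" "f1 ?y \<noteq> 0" "f2 ?y \<noteq> 0" using t p by auto
    ultimately show False using cover f F by blast
  qed
qed

lemma zariski_closed_Un:
  assumes "zariski_closed m Z1" "zariski_closed m Z2"
  shows "zariski_closed m (Z1 \<union> Z2)"
proof -
  obtain F1 F2 where F: "F1 \<subseteq> poly_fun m" "Z1 = {x \<in> carrier_mat m m. \<forall>f\<in>F1. f x = 0}"
      "F2 \<subseteq> poly_fun m" "Z2 = {x \<in> carrier_mat m m. \<forall>f\<in>F2. f x = 0}"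
    using assms unfolding zariski_closed_def by blast
  let ?F = "{(\<lambda>x. f x * g x) | f g. f \<in> F1 \<and> g \<in> F2}"
  have "?F \<subseteq> poly_fun m" using F by (auto intro!: poly_fun.pf_mult)
  moreover have "Z1 \<union> Z2 = {x \<in> carrier_mat m m. \<forall>h\<in>?F. h x = 0}"
  proof (intro Set.set_eqI iffI)
    fix x assume x: "x \<in> {x \<in> carrier_mat m m. \<forall>h\<in>?F. h x = 0}"
    show "x \<in> Z1 \<union> Z2"
    proof (rule ccontr)
      assume "x \<notin> Z1 \<union> Z2"
      then obtain f g where fg: "f \<in> F1" "f x \<noteq> 0" "g \<in> F2" "g x \<noteq> 0" using F x by blast
      then have "(\<lambda>x. f x * g x) \<in> ?F" by blast
      moreover have "\<forall>h\<in>?F. h x = 0" by (rule conjunct2[OF CollectD[OF x]])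
      ultimately have "f x * g x = 0" by (rule bspec[rotated])
      with fg show False by simp
    qed
  next
    fix x assume "x \<in> Z1 \<union> Z2"
    then show "x \<in> {x \<in> carrier_mat m m. \<forall>h\<in>?F. h x = 0}" unfolding F(2,4) by auto
  qed
  ultimately show ?thesis unfolding zariski_closed_def by blast
qed

lemma zariski_closed_UN:
  assumes "finite S" "\<And>s. s \<in> S \<Longrightarrow> zariski_closed m (Z s)"
  shows "zariski_closed m (\<Union>s\<in>S. Z s)"
  using assms
proof (induction S rule: finite_induct)
  case empty
  have "{} = {x \<in> carrier_mat m m. \<forall>f\<in>{\<lambda>_. 1 :: complex}. f x = 0}" by simp
  then show ?case unfolding zariski_closed_def using poly_fun.pf_const[of 1 m]
    by (intro exI[of _ "{\<lambda>_. 1}"]) simp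
next
  case (insert s S)
  then show ?case using zariski_closed_Un[of m "Z s" "\<Union>s\<in>S. Z s"] by simp
qed

lemma zariski_irreducible_finite_cover:
  assumes "finite S" "zariski_irreducible m Y" "\<And>s. s \<in> S \<Longrightarrow> zariski_closed m (Z s)" "Y \<subseteq> (\<Union>s\<in>S. Z s)"
  shows "\<exists>s\<in>S. Y \<subseteq> Z s"
  using assms(1,3,4)
proof (induction S rule: finite_induct)
  case empty
  then show ?case using assms(2) by (auto simp: zariski_irreducible_def)
next
  case (insert s S)
  have "zariski_closed m (Z s)" "zariski_closed m (\<Union>s\<in>S. Z s)" "Y \<subseteq> Z s \<union> (\<Union>s\<in>S. Z s)"
    using insert.prems insert.hyps(1) by (auto intro: zariski_closed_UN)
  then have "Y \<subseteq> Z s \<or> Y \<subseteq> (\<Union>s\<in>S. Z s)" using assms(2) unfolding zariski_irreducible_def by blast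
  then show ?case using insert.IH insert.prems(1) by blast
qed

lemma zariski_closed_strict_tri: "zariski_closed m (strict_tri p m)"
proof -
  let ?F = "(\<lambda>(a,b) x. x $$ (a,b)) ` {(a,b). a < m \<and> b < m \<and> p b \<le> p a}"
  have "?F \<subseteq> poly_fun m" by (auto intro: poly_fun.pf_coord)
  moreover have "strict_tri p m = {x \<in> carrier_mat m m. \<forall>f\<in>?F. f x = 0}" by (auto simp: strict_tri_def)
  ultimately show ?thesis unfolding zariski_closed_def by blast
qed

lemma nQreg_Qseq: "nQreg n (Qseq n s) = {x \<in> strict_tri (sgn_ord s) (n+1). x ^\<^sub>m n \<noteq> 0\<^sub>m (n+1) (n+1)}"
  unfolding nQreg_def nQ_Qseq using strict_tri_regular_iff(1)[OF inj_sgn_ord, of "n+1" _ s] by auto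

lemma zariski_irreducible_nQreg: "zariski_irreducible (n+1) (nQreg n (Qseq n s))"
proof -
  let ?p = "sgn_ord s" and ?m = "n+1"
  let ?E = "simple_pairs ?p ?m"
  have fin: "finite ?E" by (rule finite_subset[of _ "{..<?m} \<times> {..<?m}"]) (auto simp: simple_pairs_def)
  \<comment> \<open>On n_Q regularity means that every simple entry is nonzero, so their product
    cuts out the regular part as a principal open subset.\<close>
  define h :: "complex mat \<Rightarrow> complex" where "h x = (\<Prod>e\<in>?E. x $$ e)" for x
  have "(\<lambda>x. \<Prod>e\<in>?E. x $$ e) \<in> poly_fun ?m"
    by (intro poly_fun_prod fin) (auto simp: simple_pairs_def intro: poly_fun.pf_coord)
  then have h: "h \<in> poly_fun ?m" unfolding h_def .
  have eq: "nQreg n (Qseq n s) = {x \<in> strict_tri ?p ?m. h x \<noteq> 0}"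
    unfolding nQreg_def nQ_Qseq h_def using strict_tri_regular_iff(2)[OF inj_sgn_ord, of ?m _ s] fin
    by (auto simp: prod_zero_iff)
  define x where "x = mat ?m ?m (\<lambda>(a,b). if ?p a < ?p b then 1 else 0 :: complex)"
  have "x \<in> strict_tri ?p ?m" by (auto simp: x_def strict_tri_def)
  moreover have "x $$ (a,b) = 1" if "(a,b) \<in> ?E" for a b
    using that ord_rank_less_iff[OF inj_sgn_ord, of a ?m b s] by (auto simp: simple_pairs_def x_def)
  then have "h x \<noteq> 0" unfolding h_def using fin by (auto simp: prod_zero_iff)
  ultimately have "{x \<in> strict_tri ?p ?m. h x \<noteq> 0} \<noteq> {}" by blast
  then show ?thesis unfolding eq by (rule zariski_irreducible_open_subspace[OF msubspace_strict_tri h])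
qed

text \<open>The covering argument is applied to the full nilradicals, which are closed. Regularity
  of the points of \<open>Y\<close> is then recovered from membership in
  \<open>PhiZeroSreg n\<close>.\<close>

lemma irreducible_subset_nQreg:
  assumes Y: "zariski_irreducible (n+1) Y" and sub: "Y \<subseteq> PhiZeroSreg n"
  shows "\<exists>Q\<in>Seqs n. Y \<subseteq> nQreg n Q"
proof -
  have "finite (Seqs n)" by (rule card_ge_0_finite) (simp add: card_Seqs)
  moreover have "Y \<subseteq> (\<Union>Q\<in>Seqs n. nQ n Q)"
    using sub unfolding PhiZeroSreg_iff Seqs_eq by (fastforce simp: nQ_Qseq PhiZeroSreg_iff)
  moreover have "zariski_closed (n+1) (nQ n Q)" if "Q \<in> Seqs n" for Q
    using that zariski_closed_strict_tri by (auto simp: Seqs_eq nQ_Qseq)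
  ultimately obtain Q where Q: "Q \<in> Seqs n" "Y \<subseteq> nQ n Q"
    using zariski_irreducible_finite_cover[OF _ Y, of "Seqs n" "nQ n"] by blast
  then obtain s where s: "Q = Qseq n s" by (auto simp: Seqs_eq)
  have "Y \<subseteq> nQreg n Q" using Q(2) sub unfolding s nQreg_Qseq nQ_Qseq by (auto simp: PhiZeroSreg_iff)
  with Q(1) show ?thesis by blast
qed

theorem theorem4p5:
  fixes n :: nat
  assumes "n \<ge> 1"
  shows "card (Seqs n) = 2 ^ n
    \<and> (\<forall>x \<in> PhiZeroSreg n. \<exists>Q \<in> Seqs n. x \<in> bQ n Q)
    \<and> PhiZeroSreg n = (\<Union>Q \<in> Seqs n. nQreg n Q)
    \<and> (\<forall>Q1 \<in> Seqs n. \<forall>Q2 \<in> Seqs n. Q1 \<noteq> Q2 \<longrightarrow> nQreg n Q1 \<inter> nQreg n Q2 = {})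
    \<and> (\<forall>Q \<in> Seqs n. irr_component (n+1) (PhiZeroSreg n) (nQreg n Q))
    \<and> (\<forall>Y. irr_component (n+1) (PhiZeroSreg n) Y \<longrightarrow> (\<exists>Q \<in> Seqs n. Y = nQreg n Q))"
proof -
  have union: "PhiZeroSreg n = (\<Union>Q \<in> Seqs n. nQreg n Q)"
  proof (intro Set.set_eqI)
    fix x
    have "x \<in> PhiZeroSreg n \<longleftrightarrow> (\<exists>s. x \<in> nQreg n (Qseq n s))" unfolding PhiZeroSreg_iff nQreg_Qseq by simp
    then show "x \<in> PhiZeroSreg n \<longleftrightarrow> x \<in> (\<Union>Q \<in> Seqs n. nQreg n Q)" by (simp add: Seqs_eq)
  qed
  have borel: "\<exists>Q \<in> Seqs n. x \<in> bQ n Q" if x: "x \<in> PhiZeroSreg n" for x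
  proof -
    obtain s where "x \<in> strict_tri (sgn_ord s) (n+1)" using x unfolding PhiZeroSreg_iff by blast
    then have "x \<in> bQ n (Qseq n s)" unfolding bQ_Qseq by (auto simp: tri_def strict_tri_def)
    then show ?thesis unfolding Seqs_eq by blast
  qed
  have disjoint: "nQreg n Q1 \<inter> nQreg n Q2 = {}" if "Q1 \<in> Seqs n" "Q2 \<in> Seqs n" "Q1 \<noteq> Q2" for Q1 Q2
  proof -
    obtain s t where st: "Q1 = Qseq n s" "Q2 = Qseq n t" using \<open>Q1 \<in> Seqs n\<close> \<open>Q2 \<in> Seqs n\<close> by (auto simp: Seqs_eq)
    show ?thesis
    proof (rule ccontr)
      assume "\<not> ?thesis"
      then obtain x where "x \<in> nQreg n (Qseq n s)" "x \<in> nQreg n (Qseq n t)" unfolding st by blast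
      then have "\<forall>b\<in>{1..n}. s b = t b" using regular_sign_unique[of x s n t] unfolding nQreg_Qseq by blast
      with \<open>Q1 \<noteq> Q2\<close> show False unfolding st Qseq_eq_iff by blast
    qed
  qed
  have irr: "zariski_irreducible (n+1) (nQreg n Q)" if "Q \<in> Seqs n" for Q
    using that zariski_irreducible_nQreg by (auto simp: Seqs_eq)
  have comp: "irr_component (n+1) (PhiZeroSreg n) (nQreg n Q)" if Q: "Q \<in> Seqs n" for Q
    unfolding irr_component_def
  proof (intro conjI allI impI irr[OF Q])
    show "nQreg n Q \<subseteq> PhiZeroSreg n" using union Q by blast
    fix Y assume Y: "nQreg n Q \<subseteq> Y \<and> Y \<subseteq> PhiZeroSreg n \<and> zariski_irreducible (n+1) Y"
    then obtain Q' where Q': "Q' \<in> Seqs n" "Y \<subseteq> nQreg n Q'" using irreducible_subset_nQreg[of n Y] by blast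
    moreover have "nQreg n Q \<noteq> {}" using irr[OF Q] by (simp add: zariski_irreducible_def)
    \<comment> \<open>A nonempty piece inside another piece contradicts disjointness unless the two
      are equal.\<close>
    ultimately have "Q' = Q" using disjoint[OF Q Q'(1)] Y by blast
    with Q' Y show "Y = nQreg n Q" by blast
  qed
  have all: "\<exists>Q \<in> Seqs n. Y = nQreg n Q" if Y: "irr_component (n+1) (PhiZeroSreg n) Y" for Y
  proof -
    obtain Q where Q: "Q \<in> Seqs n" "Y \<subseteq> nQreg n Q"
      using irreducible_subset_nQreg[of n Y] Y unfolding irr_component_def by blast
    \<comment> \<open>A component is a maximal irreducible subset, and the piece containing it is
      irreducible.\<close>
    then have "nQreg n Q = Y" using Y irr[OF Q(1)] union unfolding irr_component_def by blast
    with Q(1) show ?thesis by blast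
  qed
  show ?thesis by (intro conjI allI ballI impI card_Seqs union borel disjoint comp all)
qed

end
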